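(* Let the polynomial degree be $p=1$ and let the damping parameter satisfy $0<\delta<2\alpha/L^2$. For any $0<\theta\le 1$, any $\lambda>0$ (and any $C_{\rm mark}\ge 1$, any initial guess $u_0^0\in\mathcal X_0$), the adaptive algorithm described in the context, which is steered by the elliptic reconstruction error estimator $\zeta_\ell$, guarantees full R-linear convergence of the quasi-error $$\mathsf Z_\ell^k := |||u_\ell^\star-u_\ell^{k-1}||| + \zeta_\ell(u_\ell^{k-1};z_\ell^k)\qquad\text{for all }(\ell,k)\in\mathcal Q,$$ i.e., there exist constants $0<q_{\rm lin}<1$ and $C_{\rm lin}>0$ such that $$\mathsf Z_\ell^k\le C_{\rm lin}\,q_{\rm lin}^{|\ell,k|-|\ell',k'|}\,\mathsf Z_{\ell'}^{k'}\qquad\text{for all }(\ell',k'),(\ell,k)\in\mathcal Q\text{ with }|\ell',k'|\le|\ell,k|.$$ The constants $q_{\rm lin}$ and $C_{\rm lin}$ depend only on $\lambda,q_{\rm ctr},\theta,\delta,C_{\rm eqv},\alpha,L$, and the constants in (A1)--(A4) and (QM).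
   Context: **Model problem.** $\Omega\subset\mathbb R^d$ ($d\in\mathbb N$) is a bounded polyhedral Lipschitz domain, $\mathcal X:=H_0^1(\Omega)$ with dual $\mathcal X'=H^{-1}(\Omega)$ and duality pairing $\langle\cdot,\cdot\rangle$. The matrix field $\boldsymbol A\in W^{1,\infty}(\Omega;\mathbb R^{d\times d}_{\rm sym})$ is such that $a(v,w):=\langle\boldsymbol A\nabla v,\nabla w\rangle_{L^2(\Omega)}$ is a scalar product on $\mathcal X$ whose induced norm $|||\cdot|||:=a(\cdot,\cdot)^{1/2}$ is equivalent to $\|\nabla(\cdot)\|_{L^2(\Omega)}$. The function $\mu:[0,\infty)\to[0,\infty)$ is continuously differentiable and satisfies, for constants $0<\widetilde\alpha\le\widetilde L$, $\widetilde\alpha(t-s)\le\mu(t^2)t-\mu(s^2)s\le\widetilde L(t-s)$ for all $0\le s\le t$. Put $\langle\mathcal A u,v\rangle:=\langle\mu(|\nabla u|^2)\nabla u,\nabla v\rangle_{L^2(\Omega)}$; then there are $0<\alpha\le L$ (fixed) with $\alpha|||v-w|||^2\le\langle\mathcal Av-\mathcal Aw,v-w\rangle$ and $\langle\mathcal Av-\mathcal Aw,u\rangle\le L|||v-w|||\,|||u|||$ for all $u,v,w\in\mathcal X$. Let $f\in L^2(\Omega)$, $\boldsymbol f\in[L^2(\Omega)]^d$ with $\boldsymbol f|_T\in[H^1(T)]^d$ for all $T\in\mathcal T_0$, and $\langle F,v\rangle:=\langle f,v\rangle_{L^2(\Omega)}+\langle\boldsymbol f,\nabla v\rangle_{L^2(\Omega)}$.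 The exact solution $u^\star\in\mathcal X$ is the unique solution of $\langle\mathcal Au^\star,v\rangle=\langle F,v\rangle$ for all $v\in\mathcal X$. **Discretization.** $\mathcal T_0$ is a conforming triangulation of $\Omega$ into compact simplices; refinement is by newest vertex bisection (NVB). $\mathbb T(\mathcal T_H)$ is the set of all conforming triangulations obtained from $\mathcal T_H$ by finitely many NVB steps, $\mathbb T:=\mathbb T(\mathcal T_0)$; $\mathtt{refine}(\mathcal T_H,\mathcal M_H)$ is the coarsest NVB refinement of $\mathcal T_H$ in which all elements of $\mathcal M_H\subseteq\mathcal T_H$ are refined. $\mathcal X_H:=\{v\in\mathcal X: v|_T\text{ is a polynomial of degree}\le p\ \forall T\in\mathcal T_H\}$, here with $p=1$. The discrete solution $u_H^\star\in\mathcal X_H$ is the unique solution of $\langle\mathcal Au_H^\star,v_H\rangle=\langle F,v_H\rangle$ for all $v_H\in\mathcal X_H$. Quantities on a mesh $\mathcal T_\ell$ carry the index $\ell$. **Zarantonello map.** For $w_H\in\mathcal X_H$, $z_H[w_H]\in\mathcal X_H$ solves $a(z_H[w_H],v_H)=\langle F-\mathcal Aw_H,v_H\rangle$ for all $v_H\in\mathcal X_H$, and $\Phi_H(w_H):=w_H+\delta z_H[w_H]$. For $0<\delta<2\alpha/L^2$ there is a constant $0<q_{\rm ctr}=q_{\rm ctr}[\delta]<1$, independent of $\mathcal T_H$ (given by $q_{\rm ctr}[\delta]^2=1-\delta(2\alpha-\delta L^2)$), with $|||\Phi_H(v_H)-\Phi_H(w_H)|||\le q_{\rm ctr}|||v_H-w_H|||$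 for all $v_H,w_H\in\mathcal X_H$. **Estimators.** With $\boldsymbol n$ the unit normal on $\partial T$ and $[\![\cdot]\!]$ the jump across element interfaces, for $T\in\mathcal T_H$ and $v_H,w_H,z_H\in\mathcal X_H$, $$\eta_H(T,v_H)^2:=|T|^{2/d}\|-\operatorname{div}(\mu(|\nabla v_H|^2)\nabla v_H-\boldsymbol f)-f\|_{L^2(T)}^2+|T|^{1/d}\|[\![(\mu(|\nabla v_H|^2)\nabla v_H-\boldsymbol f)\cdot\boldsymbol n]\!]\|_{L^2(\partial T\cap\Omega)}^2,$$ $$\zeta_H(w_H;T,z_H)^2:=|T|^{2/d}\|-\operatorname{div}(\boldsymbol A\nabla z_H)-f-\operatorname{div}(\mu(|\nabla w_H|^2)\nabla w_H-\boldsymbol f)\|_{L^2(T)}^2+|T|^{1/d}\|[\![(\boldsymbol A\nabla z_H+\mu(|\nabla w_H|^2)\nabla w_H-\boldsymbol f)\cdot\boldsymbol n]\!]\|_{L^2(\partial T\cap\Omega)}^2.$$ For $\mathcal U_H\subseteq\mathcal T_H$: $\eta_H(\mathcal U_H,v_H):=(\sum_{T\in\mathcal U_H}\eta_H(T,v_H)^2)^{1/2}$, $\eta_H(v_H):=\eta_H(\mathcal T_H,v_H)$, and analogously $\zeta_H(w_H;\mathcal U_H,z_H)$, $\zeta_H(w_H;z_H):=\zeta_H(w_H;\mathcal T_H,z_H)$. **Known properties for $p=1$** (constants $C_{\rm stab},C_{\rm rel},C_{\rm drel},C_{\rm mon}>0$, $0<q_{\rm red}<1$ fixed): for all $\mathcal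 T_H\in\mathbb T$, $\mathcal T_h\in\mathbb T(\mathcal T_H)$, $\mathcal U_H\subseteq\mathcal T_h\cap\mathcal T_H$, $v_H\in\mathcal X_H$, $v_h\in\mathcal X_h$: (A1) $|\eta_h(\mathcal U_H,v_h)-\eta_H(\mathcal U_H,v_H)|\le C_{\rm stab}|||v_h-v_H|||$; (A2) $\eta_h(\mathcal T_h\setminus\mathcal T_H,v_H)\le q_{\rm red}\,\eta_H(\mathcal T_H\setminus\mathcal T_h,v_H)$; (A3) $|||u^\star-u_H^\star|||\le C_{\rm rel}\,\eta_H(u_H^\star)$; (A4) $|||u_h^\star-u_H^\star|||\le C_{\rm drel}\,\eta_H(\mathcal T_H\setminus\mathcal T_h,u_H^\star)$; (QM) $\eta_h(u_h^\star)\le C_{\rm mon}\,\eta_H(u_H^\star)$. Moreover, there is $C_{\rm eqv}>0$ with $|\zeta_H(w_H;\mathcal U_H,z_H)-\eta_H(\mathcal U_H,w_H+\delta z_H)|\le(1+\delta)C_{\rm eqv}|||z_H|||$ for all $\mathcal T_H\in\mathbb T$, $\mathcal U_H\subseteq\mathcal T_H$, $z_H,w_H\in\mathcal X_H$. **Adaptive algorithm.** Input: $\mathcal T_0$, $u_0^0\in\mathcal X_0$, $0<\theta\le1$, $\lambda>0$, $C_{\rm mark}\ge1$, $\delta>0$. For $\ell=0,1,2,\dots$ do: (i) for $k=1,2,3,\dots$: compute $z_\ell^k:=z_\ell[u_\ell^{k-1}]\in\mathcal X_\ell$, set $u_\ell^k:=u_\ell^{k-1}+\delta z_\ell^k=\Phi_\ell(u_\ell^{k-1})$,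 compute $\zeta_\ell(u_\ell^{k-1};T,z_\ell^k)$ for all $T\in\mathcal T_\ell$, and terminate the $k$-loop if $|||z_\ell^k|||\le\lambda\,\zeta_\ell(u_\ell^{k-1};z_\ell^k)$. (ii) Upon termination set $\underline k[\ell]:=k$ and determine $\mathcal M_\ell\subseteq\mathcal T_\ell$ which has, up to the factor $C_{\rm mark}$, minimal cardinality among all sets satisfying the Dörfler criterion $\theta\,\zeta_\ell(u_\ell^{\underline k[\ell]-1};z_\ell^{\underline k[\ell]})^2\le\zeta_\ell(u_\ell^{\underline k[\ell]-1};\mathcal M_\ell,z_\ell^{\underline k[\ell]})^2$. (iii) $\mathcal T_{\ell+1}:=\mathtt{refine}(\mathcal T_\ell,\mathcal M_\ell)$. (iv) $u_{\ell+1}^0:=u_\ell^{\underline k[\ell]}$. **Index set.** $\mathcal Q:=\{(\ell,k)\in\mathbb N_0\times\mathbb N: z_\ell^k\text{ is defined in the algorithm}\}$, ordered by $(\ell',k')\le(\ell,k)$ iff $z_{\ell'}^{k'}$ is defined not later than $z_\ell^k$; $|\ell,k|:=\#\{(\ell',k')\in\mathcal Q:(\ell',k')<(\ell,k)\}\in\mathbb N_0$; $\underline\ell:=\sup\{\ell\in\mathbb N_0:(\ell,1)\in\mathcal Q\}\in\mathbb N_0\cup\{\infty\}$; $\underline k[\ell]:=\sup\{k\in\mathbb N:(\ell,k)\in\mathcal Q\}\in\mathbb N\cup\{\infty\}$. Either $\underline\ell=\infty$ and all $\underline k[\ell]<\infty$, or $\underline\ell<\infty$ and $\underline k[\underline\ell]=\infty$.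 *)

theory Defs
  imports "HOL-Analysis.Analysis" "Jordan_Normal_Form.Determinant"
begin

section \<open>Euclidean space of variable dimension\<close>

text \<open>
  The constants asserted to exist must not depend on the dimension d, so d has to be quantified
  below the existential quantifier and cannot be a type.  Points of d-space are therefore the
  functions in the topological space \<^term>\<open>powertop_real {..<d}\<close>, i.e. functions
  \<^typ>\<open>nat \<Rightarrow> real\<close> that are \<^term>\<open>undefined\<close> outside \<^term>\<open>{..<d}\<close>.
  This is also the space of the product measure \<^term>\<open>Pi\<^sub>M {..<d} (\<lambda>_. lborel)\<close>.
\<close>

type_synonym pt = "nat \<Rightarrow> real"
type_synonym sfun = "pt \<Rightarrow> real"
type_synonym vfun = "pt \<Rightarrow> nat \<Rightarrow> real"

definition Rn :: "nat \<Rightarrow> pt set"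
  where "Rn d = topspace (powertop_real {..<d})"

definition ip :: "nat \<Rightarrow> pt \<Rightarrow> pt \<Rightarrow> real"
  where "ip d x y = (\<Sum>i<d. x i * y i)"

definition edist :: "nat \<Rightarrow> pt \<Rightarrow> pt \<Rightarrow> real"
  where "edist d x y = sqrt (\<Sum>i<d. (x i - y i)\<^sup>2)"

definition leb_on :: "nat \<Rightarrow> pt set \<Rightarrow> pt measure"
  where "leb_on d U = restrict_space (Pi\<^sub>M {..<d} (\<lambda>_. lborel)) U"

definition L2 :: "pt measure \<Rightarrow> sfun set"
  where "L2 N = {u \<in> borel_measurable N. integrable N (\<lambda>x. (u x)\<^sup>2)}"

definition partial :: "nat \<Rightarrow> sfun \<Rightarrow> sfun"
  where "partial i \<phi> x = deriv (\<lambda>t. \<phi> (x(i := t))) (x i)"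

definition C1 :: "nat \<Rightarrow> sfun set"
  where "C1 d = {\<phi>. continuous_map (powertop_real {..<d}) euclideanreal \<phi> \<and>
    (\<forall>i<d. (\<forall>x\<in>Rn d. (\<lambda>t. \<phi> (x(i := t))) differentiable (at (x i))) \<and>
       continuous_map (powertop_real {..<d}) euclideanreal (partial i \<phi>))}"

definition Cc1 :: "nat \<Rightarrow> pt set \<Rightarrow> sfun set"
  where "Cc1 d U = {\<phi> \<in> C1 d. \<exists>K. compactin (powertop_real {..<d}) K \<and> K \<subseteq> U \<and>
    (\<forall>x\<in>Rn d - K. \<phi> x = 0)}"


section \<open>Sobolev spaces\<close>

definition loc_integrable :: "nat \<Rightarrow> pt set \<Rightarrow> sfun \<Rightarrow> bool"
  where "loc_integrable d U u \<longleftrightarrow>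
    (\<forall>K. compactin (powertop_real {..<d}) K \<and> K \<subseteq> U \<longrightarrow> integrable (leb_on d K) u)"

text \<open>
  Weak derivatives are tested with compactly supported functions of class C1, and the space
  \<open>H10\<close> below is the closure of these functions (as in Brezis' textbook);
  smooth test functions give the same notions.
\<close>

definition has_weak_grad :: "nat \<Rightarrow> pt set \<Rightarrow> sfun \<Rightarrow> vfun \<Rightarrow> bool"
  where "has_weak_grad d U u g \<longleftrightarrow> loc_integrable d U u \<and>
    (\<forall>i<d. loc_integrable d U (\<lambda>x. g x i) \<and>
      (\<forall>\<phi>\<in>Cc1 d U. (LINT x|leb_on d U. u x * partial i \<phi> x) = - (LINT x|leb_on d U. g x i * \<phi> x)))"

definition weak_grad :: "nat \<Rightarrow> pt set \<Rightarrow> sfun \<Rightarrow> vfun"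
  where "weak_grad d U u = (SOME g. has_weak_grad d U u g)"

definition has_weak_div :: "nat \<Rightarrow> pt set \<Rightarrow> vfun \<Rightarrow> sfun \<Rightarrow> bool"
  where "has_weak_div d U \<sigma> h \<longleftrightarrow> (\<forall>i<d. loc_integrable d U (\<lambda>x. \<sigma> x i)) \<and> loc_integrable d U h \<and>
    (\<forall>\<phi>\<in>Cc1 d U. (LINT x|leb_on d U. (\<Sum>i<d. \<sigma> x i * partial i \<phi> x)) = - (LINT x|leb_on d U. h x * \<phi> x))"

definition weak_div :: "nat \<Rightarrow> pt set \<Rightarrow> vfun \<Rightarrow> sfun"
  where "weak_div d U \<sigma> = (SOME h. has_weak_div d U \<sigma> h)"

definition H1 :: "nat \<Rightarrow> pt set \<Rightarrow> sfun set"
  where "H1 d U = {u \<in> L2 (leb_on d U).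
    \<exists>g. has_weak_grad d U u g \<and> (\<forall>i<d. (\<lambda>x. g x i) \<in> L2 (leb_on d U))}"

definition H1_norm_sq :: "nat \<Rightarrow> pt set \<Rightarrow> sfun \<Rightarrow> real"
  where "H1_norm_sq d U u =
    (LINT x|leb_on d U. (u x)\<^sup>2) + (LINT x|leb_on d U. (\<Sum>i<d. (weak_grad d U u x i)\<^sup>2))"

definition H10 :: "nat \<Rightarrow> pt set \<Rightarrow> sfun set"
  where "H10 d U = {u \<in> H1 d U.
    \<exists>\<phi>. (\<forall>n::nat. \<phi> n \<in> Cc1 d U) \<and> (\<lambda>n. H1_norm_sq d U (\<lambda>x. u x - \<phi> n x)) \<longlonglongrightarrow> 0}"

definition W1_infty :: "nat \<Rightarrow> pt set \<Rightarrow> sfun set"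
  where "W1_infty d U = {u. \<exists>g B. has_weak_grad d U u g \<and>
    (AE x in leb_on d U. \<bar>u x\<bar> \<le> B \<and> (\<forall>i<d. \<bar>g x i\<bar> \<le> B))}"


section \<open>Domains, simplices and newest vertex bisection\<close>

definition hull_of :: "nat \<Rightarrow> pt list \<Rightarrow> pt set"
  where "hull_of d vs = {(\<lambda>i\<in>{..<d}. \<Sum>j<length vs. c j * (vs ! j) i) | c.
    (\<forall>j<length vs. 0 \<le> c j) \<and> (\<Sum>j<length vs. c j) = (1::real)}"

text \<open>
  Locally, after a rotation, the domain is the strict epigraph of a Lipschitz function: the unit
  vector e is the vertical direction, and \<open>\<gamma>\<close> is constant along e, i.e. it is a
  function of the remaining d - 1 orthogonal coordinates.
\<close>

definition lipschitz_boundary :: "nat \<Rightarrow> pt set \<Rightarrow> bool"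
  where "lipschitz_boundary d \<Omega> \<longleftrightarrow>
    (\<forall>x \<in> (powertop_real {..<d}) frontier_of \<Omega>. \<exists>r>0. \<exists>e \<gamma> K. ip d e e = 1 \<and>
      (\<forall>y\<in>Rn d. \<forall>z\<in>Rn d. \<bar>\<gamma> y - \<gamma> z\<bar> \<le> K * edist d y z) \<and>
      (\<forall>y\<in>Rn d. \<forall>t. \<gamma> (\<lambda>i\<in>{..<d}. y i + t * e i) = \<gamma> y) \<and>
      (\<forall>y\<in>Rn d. edist d y x < r \<longrightarrow> (y \<in> \<Omega> \<longleftrightarrow> \<gamma> y < ip d y e)))"

definition polyhedral_lipschitz_domain :: "nat \<Rightarrow> pt set \<Rightarrow> bool"
  where "polyhedral_lipschitz_domain d \<Omega> \<longleftrightarrow>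
    \<Omega> \<noteq> {} \<and> openin (powertop_real {..<d}) \<Omega> \<and> connectedin (powertop_real {..<d}) \<Omega> \<and>
    (\<exists>B. \<forall>x\<in>\<Omega>. \<forall>i<d. \<bar>x i\<bar> \<le> B) \<and>
    lipschitz_boundary d \<Omega> \<and>
    (\<exists>Ps. finite Ps \<and> (\<forall>vs\<in>Ps. set vs \<subseteq> Rn d) \<and>
       (powertop_real {..<d}) closure_of \<Omega> = (\<Union>vs\<in>Ps. hull_of d vs))"

text \<open>
  A tagged simplex consists of its ordered vertices x_0, ..., x_d and a type in {0, ..., d-1}.
  Bisection halves the edge between x_0 and x_d (Maubach; in the notation of Stevenson); for d = 2
  this is newest vertex bisection of triangles.  All simplices created from one tagged mesh are
  nodes of a binary forest, so two of them coincide iff they coincide as point sets.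
\<close>

type_synonym tsimplex = "pt list \<times> nat"

definition elem :: "nat \<Rightarrow> tsimplex \<Rightarrow> pt set"
  where "elem d T = hull_of d (fst T)"

definition elem_interior :: "nat \<Rightarrow> tsimplex \<Rightarrow> pt set"
  where "elem_interior d T = (powertop_real {..<d}) interior_of (elem d T)"

definition vol :: "nat \<Rightarrow> tsimplex \<Rightarrow> real"
  where "vol d T = measure (Pi\<^sub>M {..<d} (\<lambda>_. lborel)) (elem d T)"

definition is_simplex :: "nat \<Rightarrow> tsimplex \<Rightarrow> bool"
  where "is_simplex d T \<longleftrightarrow> length (fst T) = d + 1 \<and> snd T < d \<and> set (fst T) \<subseteq> Rn d \<and>
    (\<forall>c::nat \<Rightarrow> real. (\<Sum>j\<le>d. c j) = 0 \<and> (\<forall>i<d. (\<Sum>j\<le>d. c j * (fst T ! j) i) = 0) \<longrightarrow>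
       (\<forall>j\<le>d. c j = 0))"

definition conforming_triangulation :: "nat \<Rightarrow> pt set \<Rightarrow> tsimplex set \<Rightarrow> bool"
  where "conforming_triangulation d \<Omega> \<T> \<longleftrightarrow> finite \<T> \<and> (\<forall>T\<in>\<T>. is_simplex d T) \<and>
    (\<Union>T\<in>\<T>. elem d T) = (powertop_real {..<d}) closure_of \<Omega> \<and>
    (\<forall>T\<in>\<T>. \<forall>T'\<in>\<T>. T \<noteq> T' \<longrightarrow> set (fst T) \<noteq> set (fst T') \<and>
       elem d T \<inter> elem d T' = hull_of d (filter (\<lambda>v. v \<in> set (fst T')) (fst T)))"

definition bisect :: "nat \<Rightarrow> tsimplex \<Rightarrow> tsimplex set"
  where "bisect d T = (case T of (vs, \<gamma>) \<Rightarrow>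
    let m = (\<lambda>i\<in>{..<d}. ((vs ! 0) i + (vs ! d) i) / 2);
        xs = take \<gamma> (drop 1 vs);
        ys = drop (\<gamma> + 1) (take d vs)
    in {(vs ! 0 # m # xs @ ys, (\<gamma> + 1) mod d), (vs ! d # m # xs @ rev ys, (\<gamma> + 1) mod d)})"

definition nvb_step :: "nat \<Rightarrow> tsimplex set \<Rightarrow> tsimplex set \<Rightarrow> bool"
  where "nvb_step d \<T> \<T>' \<longleftrightarrow> (\<exists>T\<in>\<T>. \<T>' = (\<T> - {T}) \<union> bisect d T)"

definition nvb_meshes :: "nat \<Rightarrow> pt set \<Rightarrow> tsimplex set \<Rightarrow> tsimplex set set"
  where "nvb_meshes d \<Omega> \<T> = {\<T>'. (nvb_step d)\<^sup>*\<^sup>* \<T> \<T>' \<and> conforming_triangulation d \<Omega> \<T>'}"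

definition is_refine :: "nat \<Rightarrow> pt set \<Rightarrow> tsimplex set \<Rightarrow> tsimplex set \<Rightarrow> tsimplex set \<Rightarrow> bool"
  where "is_refine d \<Omega> \<T> \<M> \<T>' \<longleftrightarrow> \<T>' \<in> nvb_meshes d \<Omega> \<T> \<and> \<M> \<inter> \<T>' = {} \<and>
    (\<forall>\<T>''\<in>nvb_meshes d \<Omega> \<T>. \<M> \<inter> \<T>'' = {} \<longrightarrow> \<T>'' \<in> nvb_meshes d \<Omega> \<T>')"


section \<open>Facets, surface measure, normals and traces\<close>

definition facet :: "tsimplex \<Rightarrow> nat \<Rightarrow> pt list"
  where "facet T j = take j (fst T) @ drop (Suc j) (fst T)"

text \<open>
  Surface measure on the (d-1)-simplex with vertices y_0, ..., y_{d-1}: the image of Lebesgue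
  measure on the reference simplex under the affine parametrization, weighted by the square root
  of the Gram determinant.  For d = 1 this is the unit mass at y_0.
\<close>

definition surface_measure :: "nat \<Rightarrow> pt list \<Rightarrow> pt measure"
  where "surface_measure d ys =
    (let J = sqrt (Determinant.det (Matrix.mat (d - 1) (d - 1)
           (\<lambda>(i, j). \<Sum>k<d. ((ys ! Suc i) k - (ys ! 0) k) * ((ys ! Suc j) k - (ys ! 0) k))));
         S = {t. (\<forall>j<d - 1. 0 \<le> t j) \<and> (\<Sum>j<d - 1. t j) \<le> 1}
     in distr (density (Pi\<^sub>M {..<d - 1} (\<lambda>_. lborel)) (\<lambda>t. ennreal (J * indicator S t)))
          (Pi\<^sub>M {..<d} (\<lambda>_. lborel))
          (\<lambda>t. \<lambda>i\<in>{..<d}. (ys ! 0) i + (\<Sum>j<d - 1. t j * ((ys ! Suc j) i - (ys ! 0) i))))"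

definition outer_normal :: "nat \<Rightarrow> tsimplex \<Rightarrow> nat \<Rightarrow> pt"
  where "outer_normal d T j = (THE n. n \<in> Rn d \<and> ip d n n = 1 \<and>
    (\<forall>v\<in>set (facet T j). \<forall>w\<in>set (facet T j). ip d n v = ip d n w) \<and>
    (\<forall>v\<in>set (facet T j). ip d n (fst T ! j) < ip d n v))"

text \<open>The trace on the boundary of T is the H1-continuous extension of the restriction of C1 functions.\<close>

definition has_trace :: "nat \<Rightarrow> tsimplex \<Rightarrow> sfun \<Rightarrow> sfun \<Rightarrow> bool"
  where "has_trace d T u g \<longleftrightarrow> u \<in> H1 d (elem_interior d T) \<and>
    (\<forall>j\<le>d. g \<in> L2 (surface_measure d (facet T j))) \<and>
    (\<exists>\<phi>. (\<forall>n::nat. \<phi> n \<in> C1 d) \<and>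
      (\<lambda>n. H1_norm_sq d (elem_interior d T) (\<lambda>x. u x - \<phi> n x)) \<longlonglongrightarrow> 0 \<and>
      (\<forall>j\<le>d. (\<lambda>n. LINT x|surface_measure d (facet T j). (g x - \<phi> n x)\<^sup>2) \<longlonglongrightarrow> 0))"

definition bdry_trace :: "nat \<Rightarrow> tsimplex \<Rightarrow> sfun \<Rightarrow> sfun"
  where "bdry_trace d T u = (SOME g. has_trace d T u g)"

text \<open>
  The normal jump on a facet is the sum of the outer normal traces over all elements sharing it.
\<close>

definition normal_jump :: "nat \<Rightarrow> tsimplex set \<Rightarrow> pt set \<Rightarrow> vfun \<Rightarrow> sfun"
  where "normal_jump d \<T> E \<sigma> x =
    (\<Sum>(T, j)\<in>{(T, j). T \<in> \<T> \<and> j \<le> d \<and> set (facet T j) = E}.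
       \<Sum>i<d. bdry_trace d T (\<lambda>y. \<sigma> y i) x * outer_normal d T j i)"

definition jump_norm_sq :: "nat \<Rightarrow> pt set \<Rightarrow> tsimplex set \<Rightarrow> tsimplex \<Rightarrow> vfun \<Rightarrow> real"
  where "jump_norm_sq d \<Omega> \<T> T \<sigma> =
    (\<Sum>j\<le>d. LINT x|surface_measure d (facet T j).
       indicator \<Omega> x * (normal_jump d \<T> (set (facet T j)) \<sigma> x)\<^sup>2)"


section \<open>Model problem\<close>

record model =
  mdim :: nat
  mdom :: "pt set"
  mA :: "pt \<Rightarrow> nat \<Rightarrow> nat \<Rightarrow> real"
  mmu :: "real \<Rightarrow> real"
  mf :: sfun
  mfv :: vfun

definition XX :: "model \<Rightarrow> sfun set"
  where "XX P = H10 (mdim P) (mdom P)"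

definition grd :: "model \<Rightarrow> sfun \<Rightarrow> vfun"
  where "grd P v = weak_grad (mdim P) (mdom P) v"

definition diff_flux :: "model \<Rightarrow> sfun \<Rightarrow> vfun"
  where "diff_flux P v x i = (\<Sum>j<mdim P. mA P x i j * grd P v x j)"

definition nonlin_flux :: "model \<Rightarrow> sfun \<Rightarrow> vfun"
  where "nonlin_flux P v x i = mmu P (\<Sum>j<mdim P. (grd P v x j)\<^sup>2) * grd P v x i"

definition a_form :: "model \<Rightarrow> sfun \<Rightarrow> sfun \<Rightarrow> real"
  where "a_form P v w = (LINT x|leb_on (mdim P) (mdom P). (\<Sum>i<mdim P. diff_flux P v x i * grd P w x i))"

definition enorm :: "model \<Rightarrow> sfun \<Rightarrow> real"
  where "enorm P v = sqrt (a_form P v v)"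

definition A_op :: "model \<Rightarrow> sfun \<Rightarrow> sfun \<Rightarrow> real"
  where "A_op P u v = (LINT x|leb_on (mdim P) (mdom P). (\<Sum>i<mdim P. nonlin_flux P u x i * grd P v x i))"

definition F_fun :: "model \<Rightarrow> sfun \<Rightarrow> real"
  where "F_fun P v = (LINT x|leb_on (mdim P) (mdom P). mf P x * v x) +
    (LINT x|leb_on (mdim P) (mdom P). (\<Sum>i<mdim P. mfv P x i * grd P v x i))"

definition grad_norm :: "model \<Rightarrow> sfun \<Rightarrow> real"
  where "grad_norm P v = sqrt (LINT x|leb_on (mdim P) (mdom P). (\<Sum>i<mdim P. (grd P v x i)\<^sup>2))"

definition a_scalar_product :: "model \<Rightarrow> bool"
  where "a_scalar_product P \<longleftrightarrow>
    (\<forall>v\<in>XX P. \<forall>w\<in>XX P. a_form P v w = a_form P w v) \<and>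
    (\<forall>u\<in>XX P. \<forall>v\<in>XX P. \<forall>w\<in>XX P. \<forall>s t.
       a_form P (\<lambda>x. s * u x + t * v x) w = s * a_form P u w + t * a_form P v w) \<and>
    (\<forall>v\<in>XX P. 0 \<le> a_form P v v \<and>
       (a_form P v v = 0 \<longrightarrow> (AE x in leb_on (mdim P) (mdom P). v x = 0)))"

definition mu_admissible :: "(real \<Rightarrow> real) \<Rightarrow> bool"
  where "mu_admissible \<mu> \<longleftrightarrow> (\<forall>t\<ge>0. 0 \<le> \<mu> t) \<and>
    (\<exists>\<mu>'. continuous_on {0..} \<mu>' \<and> (\<forall>t\<ge>0. (\<mu> has_real_derivative \<mu>' t) (at t within {0..}))) \<and>
    (\<exists>\<alpha>' L'. 0 < \<alpha>' \<and> \<alpha>' \<le> L' \<and> (\<forall>s t. 0 \<le> s \<and> s \<le> t \<longrightarrow>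
       \<alpha>' * (t - s) \<le> \<mu> (t\<^sup>2) * t - \<mu> (s\<^sup>2) * s \<and> \<mu> (t\<^sup>2) * t - \<mu> (s\<^sup>2) * s \<le> L' * (t - s)))"

definition model_problem :: "model \<Rightarrow> tsimplex set \<Rightarrow> bool"
  where "model_problem P \<T>0 \<longleftrightarrow> 1 \<le> mdim P \<and>
    polyhedral_lipschitz_domain (mdim P) (mdom P) \<and>
    conforming_triangulation (mdim P) (mdom P) \<T>0 \<and>
    (\<forall>i<mdim P. \<forall>j<mdim P. (\<lambda>x. mA P x i j) \<in> W1_infty (mdim P) (mdom P) \<and>
       (AE x in leb_on (mdim P) (mdom P). mA P x i j = mA P x j i)) \<and>
    a_scalar_product P \<and>
    (\<exists>c C. 0 < c \<and> 0 < C \<and> (\<forall>v\<in>XX P. c * grad_norm P v \<le> enorm P v \<and> enorm P v \<le> C * grad_norm P v)) \<and>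
    mu_admissible (mmu P) \<and>
    mf P \<in> L2 (leb_on (mdim P) (mdom P)) \<and>
    (\<forall>i<mdim P. (\<lambda>x. mfv P x i) \<in> L2 (leb_on (mdim P) (mdom P)) \<and>
       (\<forall>T\<in>\<T>0. (\<lambda>x. mfv P x i) \<in> H1 (mdim P) (elem_interior (mdim P) T)))"

definition monotone_lipschitz :: "model \<Rightarrow> real \<Rightarrow> real \<Rightarrow> bool"
  where "monotone_lipschitz P \<alpha> L \<longleftrightarrow> (\<forall>u\<in>XX P. \<forall>v\<in>XX P. \<forall>w\<in>XX P.
    \<alpha> * (enorm P (\<lambda>x. v x - w x))\<^sup>2 \<le> A_op P v (\<lambda>x. v x - w x) - A_op P w (\<lambda>x. v x - w x) \<and>
    A_op P v u - A_op P w u \<le> L * enorm P (\<lambda>x. v x - w x) * enorm P u)"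

definition exact_solution :: "model \<Rightarrow> sfun \<Rightarrow> bool"
  where "exact_solution P u \<longleftrightarrow> u \<in> XX P \<and> (\<forall>v\<in>XX P. A_op P u v = F_fun P v)"


section \<open>Discretization and estimators\<close>

abbreviation meshes :: "model \<Rightarrow> tsimplex set \<Rightarrow> tsimplex set set"
  where "meshes P \<T> \<equiv> nvb_meshes (mdim P) (mdom P) \<T>"

definition XH :: "model \<Rightarrow> tsimplex set \<Rightarrow> sfun set"
  where "XH P \<T> = {v \<in> XX P. \<forall>T\<in>\<T>. \<exists>c b.
    AE x in leb_on (mdim P) (elem_interior (mdim P) T). v x = c + (\<Sum>i<mdim P. b i * x i)}"

definition discrete_solution :: "model \<Rightarrow> tsimplex set \<Rightarrow> sfun \<Rightarrow> bool"
  where "discrete_solution P \<T> u \<longleftrightarrow> u \<in> XH P \<T> \<and> (\<forall>v\<in>XH P \<T>. A_op P u v = F_fun P v)"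

definition zarantonello :: "model \<Rightarrow> tsimplex set \<Rightarrow> sfun \<Rightarrow> sfun \<Rightarrow> bool"
  where "zarantonello P \<T> w z \<longleftrightarrow> z \<in> XH P \<T> \<and> (\<forall>v\<in>XH P \<T>. a_form P z v = F_fun P v - A_op P w v)"

definition eta_sq :: "model \<Rightarrow> tsimplex set \<Rightarrow> tsimplex \<Rightarrow> sfun \<Rightarrow> real"
  where "eta_sq P \<T> T v =
    (let d = mdim P; U = elem_interior d T; \<sigma> = (\<lambda>x i. nonlin_flux P v x i - mfv P x i)
     in vol d T powr (2 / real d) * (LINT x|leb_on d U. (- weak_div d U \<sigma> x - mf P x)\<^sup>2)
      + vol d T powr (1 / real d) * jump_norm_sq d (mdom P) \<T> T \<sigma>)"

definition eta :: "model \<Rightarrow> tsimplex set \<Rightarrow> tsimplex set \<Rightarrow> sfun \<Rightarrow> real"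
  where "eta P \<T> \<U> v = sqrt (\<Sum>T\<in>\<U>. eta_sq P \<T> T v)"

definition zeta_sq :: "model \<Rightarrow> tsimplex set \<Rightarrow> sfun \<Rightarrow> tsimplex \<Rightarrow> sfun \<Rightarrow> real"
  where "zeta_sq P \<T> w T z =
    (let d = mdim P; U = elem_interior d T; \<sigma> = (\<lambda>x i. nonlin_flux P w x i - mfv P x i)
     in vol d T powr (2 / real d) *
          (LINT x|leb_on d U. (- weak_div d U (diff_flux P z) x - mf P x - weak_div d U \<sigma> x)\<^sup>2)
      + vol d T powr (1 / real d) *
          jump_norm_sq d (mdom P) \<T> T (\<lambda>x i. diff_flux P z x i + nonlin_flux P w x i - mfv P x i))"

definition zeta :: "model \<Rightarrow> tsimplex set \<Rightarrow> sfun \<Rightarrow> tsimplex set \<Rightarrow> sfun \<Rightarrow> real"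
  where "zeta P \<T> w \<U> z = sqrt (\<Sum>T\<in>\<U>. zeta_sq P \<T> w T z)"


section \<open>Properties of the solver and of the estimators\<close>

definition zarantonello_contraction :: "model \<Rightarrow> tsimplex set \<Rightarrow> real \<Rightarrow> real \<Rightarrow> bool"
  where "zarantonello_contraction P \<T>0 \<delta> q \<longleftrightarrow> (\<forall>\<T>\<in>meshes P \<T>0. \<forall>v\<in>XH P \<T>. \<forall>w\<in>XH P \<T>. \<forall>zv zw.
    zarantonello P \<T> v zv \<and> zarantonello P \<T> w zw \<longrightarrow>
    enorm P (\<lambda>x. (v x + \<delta> * zv x) - (w x + \<delta> * zw x)) \<le> q * enorm P (\<lambda>x. v x - w x))"

definition stability :: "model \<Rightarrow> tsimplex set \<Rightarrow> real \<Rightarrow> bool"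
  where "stability P \<T>0 C \<longleftrightarrow> (\<forall>\<T>\<in>meshes P \<T>0. \<forall>\<T>'\<in>meshes P \<T>. \<forall>\<U>. \<U> \<subseteq> \<T>' \<inter> \<T> \<longrightarrow>
    (\<forall>v\<in>XH P \<T>. \<forall>v'\<in>XH P \<T>'. \<bar>eta P \<T>' \<U> v' - eta P \<T> \<U> v\<bar> \<le> C * enorm P (\<lambda>x. v' x - v x)))"

definition reduction :: "model \<Rightarrow> tsimplex set \<Rightarrow> real \<Rightarrow> bool"
  where "reduction P \<T>0 q \<longleftrightarrow> (\<forall>\<T>\<in>meshes P \<T>0. \<forall>\<T>'\<in>meshes P \<T>. \<forall>v\<in>XH P \<T>.
    eta P \<T>' (\<T>' - \<T>) v \<le> q * eta P \<T> (\<T> - \<T>') v)"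

definition reliability :: "model \<Rightarrow> tsimplex set \<Rightarrow> sfun \<Rightarrow> (tsimplex set \<Rightarrow> sfun) \<Rightarrow> real \<Rightarrow> bool"
  where "reliability P \<T>0 u ud C \<longleftrightarrow> (\<forall>\<T>\<in>meshes P \<T>0.
    enorm P (\<lambda>x. u x - ud \<T> x) \<le> C * eta P \<T> \<T> (ud \<T>))"

definition discrete_reliability :: "model \<Rightarrow> tsimplex set \<Rightarrow> (tsimplex set \<Rightarrow> sfun) \<Rightarrow> real \<Rightarrow> bool"
  where "discrete_reliability P \<T>0 ud C \<longleftrightarrow> (\<forall>\<T>\<in>meshes P \<T>0. \<forall>\<T>'\<in>meshes P \<T>.
    enorm P (\<lambda>x. ud \<T>' x - ud \<T> x) \<le> C * eta P \<T> (\<T> - \<T>') (ud \<T>))"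

definition quasi_monotonicity :: "model \<Rightarrow> tsimplex set \<Rightarrow> (tsimplex set \<Rightarrow> sfun) \<Rightarrow> real \<Rightarrow> bool"
  where "quasi_monotonicity P \<T>0 ud C \<longleftrightarrow> (\<forall>\<T>\<in>meshes P \<T>0. \<forall>\<T>'\<in>meshes P \<T>.
    eta P \<T>' \<T>' (ud \<T>') \<le> C * eta P \<T> \<T> (ud \<T>))"

definition estimator_equivalence :: "model \<Rightarrow> tsimplex set \<Rightarrow> real \<Rightarrow> real \<Rightarrow> bool"
  where "estimator_equivalence P \<T>0 \<delta> C \<longleftrightarrow> (\<forall>\<T>\<in>meshes P \<T>0. \<forall>\<U>\<subseteq>\<T>. \<forall>z\<in>XH P \<T>. \<forall>w\<in>XH P \<T>.
    \<bar>zeta P \<T> w \<U> z - eta P \<T> \<U> (\<lambda>x. w x + \<delta> * z x)\<bar> \<le> (1 + \<delta>) * C * enorm P z)"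


section \<open>Adaptive algorithm\<close>

text \<open>
  \<open>stop l k\<close> is the termination test evaluated right after the k-th solver step on level l;
  \<open>alg_pos stop n\<close> is the index of the n-th solver step performed by the algorithm.
\<close>

primrec alg_pos :: "(nat \<Rightarrow> nat \<Rightarrow> bool) \<Rightarrow> nat \<Rightarrow> nat \<times> nat" where
  "alg_pos stop 0 = (0, 1)"
| "alg_pos stop (Suc n) =
    (case alg_pos stop n of (l, k) \<Rightarrow> if stop l k then (Suc l, 1) else (l, Suc k))"

definition index_set :: "(nat \<Rightarrow> nat \<Rightarrow> bool) \<Rightarrow> (nat \<times> nat) set"
  where "index_set stop = range (alg_pos stop)"

definition computed_before :: "(nat \<Rightarrow> nat \<Rightarrow> bool) \<Rightarrow> nat \<times> nat \<Rightarrow> nat \<times> nat \<Rightarrow> bool"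
  where "computed_before stop p q \<longleftrightarrow> (\<exists>m n. m < n \<and> alg_pos stop m = p \<and> alg_pos stop n = q)"

definition index_count :: "(nat \<Rightarrow> nat \<Rightarrow> bool) \<Rightarrow> nat \<times> nat \<Rightarrow> nat"
  where "index_count stop q = card {p \<in> index_set stop. computed_before stop p q}"

definition alg_stop :: "model \<Rightarrow> real \<Rightarrow> (nat \<Rightarrow> tsimplex set) \<Rightarrow>
    (nat \<Rightarrow> nat \<Rightarrow> sfun) \<Rightarrow> (nat \<Rightarrow> nat \<Rightarrow> sfun) \<Rightarrow> nat \<Rightarrow> nat \<Rightarrow> bool"
  where "alg_stop P lam \<T> u z l k \<longleftrightarrow> enorm P (z l k) \<le> lam * zeta P (\<T> l) (u l (k - 1)) (\<T> l) (z l k)"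

definition doerfler :: "model \<Rightarrow> real \<Rightarrow> tsimplex set \<Rightarrow> sfun \<Rightarrow> sfun \<Rightarrow> tsimplex set set"
  where "doerfler P \<theta> \<T> w z = {\<M>. \<M> \<subseteq> \<T> \<and> \<theta> * (zeta P \<T> w \<T> z)\<^sup>2 \<le> (zeta P \<T> w \<M> z)\<^sup>2}"

definition adaptive_run :: "model \<Rightarrow> tsimplex set \<Rightarrow> real \<Rightarrow> real \<Rightarrow> real \<Rightarrow> real \<Rightarrow>
    (nat \<Rightarrow> tsimplex set) \<Rightarrow> (nat \<Rightarrow> tsimplex set) \<Rightarrow> (nat \<Rightarrow> nat \<Rightarrow> sfun) \<Rightarrow> (nat \<Rightarrow> nat \<Rightarrow> sfun) \<Rightarrow> bool"
  where "adaptive_run P \<T>0 \<theta> lam Cmark \<delta> \<T> \<M> u z \<longleftrightarrow>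
    \<T> 0 = \<T>0 \<and> u 0 0 \<in> XH P \<T>0 \<and>
    (\<forall>(l, k) \<in> index_set (alg_stop P lam \<T> u z).
       zarantonello P (\<T> l) (u l (k - 1)) (z l k) \<and>
       u l k = (\<lambda>x. u l (k - 1) x + \<delta> * z l k x) \<and>
       (alg_stop P lam \<T> u z l k \<longrightarrow>
          \<M> l \<in> doerfler P \<theta> (\<T> l) (u l (k - 1)) (z l k) \<and>
          (\<forall>\<M>'\<in>doerfler P \<theta> (\<T> l) (u l (k - 1)) (z l k). real (card (\<M> l)) \<le> Cmark * real (card \<M>')) \<and>
          is_refine (mdim P) (mdom P) (\<T> l) (\<M> l) (\<T> (Suc l)) \<and>
          u (Suc l) 0 = u l k))"

definition quasi_error :: "model \<Rightarrow> (tsimplex set \<Rightarrow> sfun) \<Rightarrow> (nat \<Rightarrow> tsimplex set) \<Rightarrow>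
    (nat \<Rightarrow> nat \<Rightarrow> sfun) \<Rightarrow> (nat \<Rightarrow> nat \<Rightarrow> sfun) \<Rightarrow> nat \<times> nat \<Rightarrow> real"
  where "quasi_error P ud \<T> u z = (\<lambda>(l, k).
    enorm P (\<lambda>x. ud (\<T> l) x - u l (k - 1) x) + zeta P (\<T> l) (u l (k - 1)) (\<T> l) (z l k))"

end

theory Submission
  imports Defs
begin

text \<open>
  Why the theorem holds.  Number the solver steps consecutively.  For step \<open>n\<close>, carried out on the
  mesh \<open>S n\<close>, let \<open>e n\<close> be the residual estimator of the exact discrete solution on \<open>S n\<close>, let
  \<open>a n\<close> be the algebraic error before the step, and let \<open>d n\<close> be the energy distance of the exact
  discrete solutions on \<open>S n\<close> and \<open>S (Suc n)\<close>, which vanishes if the mesh is kept.  The solver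
  update is at most \<open>2 / \<delta>\<close> times \<open>a n\<close>, so by estimator equivalence and stability the computed
  estimator \<open>\<zeta>\<close> differs from \<open>e n\<close> by at most a multiple of \<open>a n\<close>
  (\<open>zeta_near_eta_of_solution\<close>).  Hence the quasi-error is equivalent to \<open>e n + a n\<close>, and it
  suffices to combine three estimates that hold for every solver step:

  \<^item> \<open>a (Suc n) \<le> qctr * a n + d n\<close>, by contraction (\<open>error_recursion\<close>);
  \<^item> \<open>e (Suc n) \<le> q1 * e n + c' * a n + Cstab * d n\<close> with \<open>q1 < 1\<close> (\<open>estimator_recursion\<close>);
  \<^item> every tail sum of the squares of \<open>d\<close> is at most a multiple of \<open>(e n)\<^sup>2\<close>
    (\<open>quasi_orthogonality\<close>).

  The second estimate is what makes arbitrary \<open>\<theta>\<close> and \<open>lam\<close> admissible.  If the mesh is refined,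
  the marking criterion for \<open>\<zeta>\<close> is a marking criterion for the residual estimator of the exact
  discrete solution up to a multiple of \<open>a n\<close>.  If the solver continues, the failed stopping test
  bounds \<open>\<zeta>\<close>, and with it \<open>e n\<close>, by a multiple of \<open>a n\<close>.  In either case the perturbation is of
  the order of \<open>a n\<close>, which contracts by itself, so its size is irrelevant: for large \<open>K\<close> the
  quantity \<open>e n + K * a n\<close> contracts up to a multiple of \<open>d n\<close>.  A contraction perturbed by such a
  square-summable sequence decays geometrically (\<open>perturbed_contraction_R_linear\<close>).

  The third estimate is an energy argument.  The nonlinear operator is the gradient of a convex
  energy whose minimizer over a discrete space is the discrete solution.  The energy excess is
  bounded below and above by multiples of the squared distance to the minimizer, so the squares of
  \<open>d\<close> telescope, and what remains is controlled by discrete reliability.  Both bounds follow from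
  the convexity inequality of the energy (\<open>energy_convex\<close>), which holds pointwise under the
  integral, together with strong monotonicity and Lipschitz continuity of the operator.

  All this presupposes that the energy norm is a seminorm on a vector space and that the discrete
  spaces are nested.  The former requires that weak gradients are unique almost everywhere
  (\<open>fundamental_lemma_calculus_of_variations\<close>, \<open>H10_lincomb\<close>), the latter that bisection produces
  simplices inside their parents (\<open>nvb_steps_nested\<close>).
\<close>

section \<open>Measurability and continuously differentiable functions\<close>

abbreviation Tn :: "nat \<Rightarrow> pt topology"
  where "Tn d \<equiv> powertop_real {..<d}"

abbreviation lebn :: "nat \<Rightarrow> pt measure"
  where "lebn d \<equiv> Pi\<^sub>M {..<d} (\<lambda>_. lborel)"

lemma Rn_eq_PiE: "Rn d = PiE {..<d} (\<lambda>_. UNIV)"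
  by (simp add: Rn_def)

lemma space_lebn: "space (lebn d) = Rn d"
  by (simp add: space_PiM Rn_eq_PiE)

lemma Rn_upd: "x \<in> Rn d \<Longrightarrow> i < d \<Longrightarrow> x(i := t) \<in> Rn d"
  by (auto simp: Rn_eq_PiE PiE_def extensional_def)

text \<open>
  Only boxes are measurable by definition.  The product topology over all natural numbers is second
  countable, so there the open sets are Borel sets of the infinite product; the set \<open>S\<close> is the trace
  of such a set on the functions that are undefined outside \<open>{..<d}\<close>.
\<close>

lemma openin_sets_lebn:
  assumes "openin (Tn d) S"
  shows "S \<in> sets (lebn d)"
proof -
  let ?r = "\<lambda>x::pt. restrict x {..<d}"
  have "continuous_map (product_topology (\<lambda>_. euclideanreal) UNIV) (Tn d) ?r"
    by (auto simp: continuous_map_componentwise restrict_def extensional_def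
        intro!: continuous_map_product_projection)
  then have "openin (product_topology (\<lambda>_. euclideanreal) UNIV)
      {x \<in> topspace (product_topology (\<lambda>_. euclideanreal) UNIV). ?r x \<in> S}"
    using assms by (rule openin_continuous_map_preimage)
  then have "open {x. ?r x \<in> S}"
    by (simp add: euclidean_product_topology)
  then have b: "{x. ?r x \<in> S} \<in> sets (Pi\<^sub>M UNIV (\<lambda>_::nat. borel :: real measure))"
    using sets_PiM_equal_borel[where 'a=nat and 'b=real] borel_open by blast
  have "(\<lambda>x i. x i) \<in> measurable (lebn d) (Pi\<^sub>M UNIV (\<lambda>_::nat. borel :: real measure))"
  proof (rule measurable_PiM_single')
    fix i :: nat
    show "(\<lambda>x. x i) \<in> measurable (lebn d) borel"
    proof (cases "i < d")
      case True
      then show ?thesis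
        using measurable_component_singleton[of i "{..<d}" "\<lambda>_. lborel :: real measure"] by simp
    next
      case False
      have "(\<lambda>x. undefined) \<in> measurable (lebn d) (borel :: real measure)"
        by simp
      then show ?thesis
        by (rule measurable_cong[THEN iffD1, rotated])
          (use False in \<open>auto simp: space_PiM PiE_def extensional_def\<close>)
    qed
  qed (auto simp: space_PiM)
  from measurable_sets[OF this b]
  have "(\<lambda>x. x) -` {x. ?r x \<in> S} \<inter> space (lebn d) \<in> sets (lebn d)"
    by simp
  also have "(\<lambda>x. x) -` {x. ?r x \<in> S} \<inter> space (lebn d) = S"
  proof -
    have "S \<subseteq> Rn d"
      using openin_subset[OF assms] by (simp add: Rn_def)
    moreover have "?r x = x" if "x \<in> Rn d" for x
      using that by (auto simp: Rn_eq_PiE PiE_def extensional_restrict)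
    ultimately show ?thesis
      by (auto simp: space_lebn)
  qed
  finally show ?thesis .
qed

lemma compactin_sets_lebn:
  assumes "compactin (Tn d) K"
  shows "K \<in> sets (lebn d)"
proof -
  have "closedin (Tn d) K"
    using compactin_imp_closedin[OF _ assms] by (simp add: Hausdorff_space_product_topology)
  then have op: "openin (Tn d) (topspace (Tn d) - K)" and sub: "K \<subseteq> topspace (Tn d)"
    unfolding closedin_def by blast+
  have eq: "space (lebn d) - (topspace (Tn d) - K) = K"
    using sub unfolding space_lebn Rn_def by blast
  have "space (lebn d) - (topspace (Tn d) - K) \<in> sets (lebn d)"
    using openin_sets_lebn[OF op] by (rule sets.compl_sets)
  then show ?thesis unfolding eq .
qed

lemma continuous_measurable_lebn:
  assumes "continuous_map (Tn d) euclideanreal \<phi>"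
  shows "\<phi> \<in> borel_measurable (lebn d)"
proof (rule borel_measurableI)
  fix S :: "real set" assume "open S"
  have "openin (Tn d) {x \<in> topspace (Tn d). \<phi> x \<in> S}"
    by (intro openin_continuous_map_preimage[OF assms]) (use \<open>open S\<close> in simp)
  from openin_sets_lebn[OF this] show "\<phi> -` S \<inter> space (lebn d) \<in> sets (lebn d)"
    by (simp add: space_lebn Rn_def vimage_def Int_def conj_commute)
qed

lemma continuous_map_slice:
  assumes "x \<in> Rn d" "i < d"
  shows "continuous_map euclideanreal (Tn d) (\<lambda>t. x(i := t))"
proof -
  have "continuous_map euclideanreal euclideanreal (\<lambda>t. (x(i := t)) k)" for k
    by (cases "k = i") auto
  moreover have "(\<lambda>t. x(i := t)) ` topspace euclideanreal \<subseteq> extensional {..<d}"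
    using Rn_upd[OF assms] by (auto simp: Rn_eq_PiE PiE_def)
  ultimately show ?thesis
    unfolding continuous_map_componentwise by blast
qed

lemma C1_has_partial:
  assumes "\<phi> \<in> C1 d" "x \<in> Rn d" "i < d"
  shows "((\<lambda>t. \<phi> (x(i := t))) has_real_derivative partial i \<phi> (x(i := s))) (at s)"
proof -
  have "(\<lambda>t. \<phi> ((x(i := s))(i := t))) differentiable at ((x(i := s)) i)"
    using assms Rn_upd[OF assms(2,3), of s] unfolding C1_def by blast
  then have "(\<lambda>t. \<phi> (x(i := t))) differentiable at s"
    by simp
  then show ?thesis
    by (simp add: partial_def DERIV_deriv_iff_real_differentiable)
qed

lemma C1_continuous:
  "\<phi> \<in> C1 d \<Longrightarrow> continuous_map (Tn d) euclideanreal \<phi>"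
  "\<phi> \<in> C1 d \<Longrightarrow> i < d \<Longrightarrow> continuous_map (Tn d) euclideanreal (partial i \<phi>)"
  by (auto simp: C1_def)

lemma C1I:
  assumes c: "continuous_map (Tn d) euclideanreal \<phi>"
    and d: "\<And>x i. x \<in> Rn d \<Longrightarrow> i < d \<Longrightarrow> ((\<lambda>t. \<phi> (x(i := t))) has_real_derivative \<psi> i x) (at (x i))"
    and c': "\<And>i. i < d \<Longrightarrow> continuous_map (Tn d) euclideanreal (\<psi> i)"
  shows "\<phi> \<in> C1 d" "\<And>x i. x \<in> Rn d \<Longrightarrow> i < d \<Longrightarrow> partial i \<phi> x = \<psi> i x"
proof -
  show p: "partial i \<phi> x = \<psi> i x" if "x \<in> Rn d" "i < d" for x i
    using DERIV_imp_deriv[OF d[OF that]] by (simp add: partial_def)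
  have "continuous_map (Tn d) euclideanreal (partial i \<phi>)" if "i < d" for i
    by (rule continuous_map_eq[OF c'[OF that]]) (use p that in \<open>auto simp: Rn_def\<close>)
  moreover have "(\<lambda>t. \<phi> (x(i := t))) differentiable at (x i)" if "x \<in> Rn d" "i < d" for x i
    using d[OF that] real_differentiable_def by blast
  ultimately show "\<phi> \<in> C1 d"
    using c by (auto simp: C1_def)
qed

lemma C1_lincomb:
  assumes "\<phi> \<in> C1 d" "\<psi> \<in> C1 d"
  shows "(\<lambda>x. s * \<phi> x + t * \<psi> x) \<in> C1 d"
proof (rule C1I(1)[where \<psi>="\<lambda>i x. s * partial i \<phi> x + t * partial i \<psi> x"])
  show "continuous_map (Tn d) euclideanreal (\<lambda>x. s * \<phi> x + t * \<psi> x)"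
    using C1_continuous assms by (auto intro!: continuous_intros)
  show "((\<lambda>r. s * \<phi> (x(i := r)) + t * \<psi> (x(i := r))) has_real_derivative
      s * partial i \<phi> x + t * partial i \<psi> x) (at (x i))" if "x \<in> Rn d" "i < d" for x i
    using C1_has_partial[OF assms(1) that, of "x i"] C1_has_partial[OF assms(2) that, of "x i"]
    by (auto intro!: derivative_eq_intros)
  show "continuous_map (Tn d) euclideanreal (\<lambda>x. s * partial i \<phi> x + t * partial i \<psi> x)"
    if "i < d" for i
    using C1_continuous(2)[OF assms(1) that] C1_continuous(2)[OF assms(2) that]
    by (auto intro!: continuous_intros)
qed

lemma C1_mult:
  assumes "\<phi> \<in> C1 d" "\<psi> \<in> C1 d"
  shows "(\<lambda>x. \<phi> x * \<psi> x) \<in> C1 d"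
    and "\<And>x i. x \<in> Rn d \<Longrightarrow> i < d \<Longrightarrow>
      partial i (\<lambda>x. \<phi> x * \<psi> x) x = partial i \<phi> x * \<psi> x + \<phi> x * partial i \<psi> x"
proof -
  note D = C1I[where \<phi>="\<lambda>x. \<phi> x * \<psi> x" and d=d and
      \<psi>="\<lambda>i x. partial i \<phi> x * \<psi> x + \<phi> x * partial i \<psi> x"]
  have 1: "continuous_map (Tn d) euclideanreal (\<lambda>x. \<phi> x * \<psi> x)"
    using C1_continuous assms by (auto intro!: continuous_intros)
  have 2: "((\<lambda>r. \<phi> (x(i := r)) * \<psi> (x(i := r))) has_real_derivative
      partial i \<phi> x * \<psi> x + \<phi> x * partial i \<psi> x) (at (x i))" if "x \<in> Rn d" "i < d" for x i
    using DERIV_mult[OF C1_has_partial[OF assms(1) that, of "x i"] C1_has_partial[OF assms(2) that, of "x i"]]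
    by (simp add: algebra_simps)
  have 3: "continuous_map (Tn d) euclideanreal (\<lambda>x. partial i \<phi> x * \<psi> x + \<phi> x * partial i \<psi> x)"
    if "i < d" for i
    using C1_continuous(2)[OF assms(1) that] C1_continuous(2)[OF assms(2) that] C1_continuous(1) assms
    by (auto intro!: continuous_intros)
  show "(\<lambda>x. \<phi> x * \<psi> x) \<in> C1 d"
    "\<And>x i. x \<in> Rn d \<Longrightarrow> i < d \<Longrightarrow>
      partial i (\<lambda>x. \<phi> x * \<psi> x) x = partial i \<phi> x * \<psi> x + \<phi> x * partial i \<psi> x"
    using D[OF 1 2 3] by blast+
qed

lemma Cc1_C1: "\<phi> \<in> Cc1 d U \<Longrightarrow> \<phi> \<in> C1 d"
  by (simp add: Cc1_def)

text \<open>
  The partial derivatives vanish outside the same compact set, since its complement is open.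
\<close>

lemma Cc1_support:
  assumes "\<phi> \<in> Cc1 d U"
  obtains K where "compactin (Tn d) K" "K \<subseteq> U"
    "\<And>x. x \<in> Rn d \<Longrightarrow> x \<notin> K \<Longrightarrow> \<phi> x = 0"
    "\<And>x i. x \<in> Rn d \<Longrightarrow> x \<notin> K \<Longrightarrow> i < d \<Longrightarrow> partial i \<phi> x = 0"
proof -
  obtain K where K: "compactin (Tn d) K" "K \<subseteq> U" "\<And>x. x \<in> Rn d \<Longrightarrow> x \<notin> K \<Longrightarrow> \<phi> x = 0"
    using assms by (auto simp: Cc1_def)
  have "closedin (Tn d) K"
    using compactin_imp_closedin[OF _ K(1)] by (simp add: Hausdorff_space_product_topology)
  then have op: "openin (Tn d) (Rn d - K)"
    unfolding Rn_def closedin_def by blast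
  have "partial i \<phi> x = 0" if x: "x \<in> Rn d" "x \<notin> K" "i < d" for x i
  proof -
    have "openin euclideanreal {t \<in> topspace euclideanreal. x(i := t) \<in> Rn d - K}"
      by (rule openin_continuous_map_preimage[OF continuous_map_slice[OF x(1,3)] op])
    then have "open {t. x(i := t) \<in> Rn d - K}" by simp
    moreover have "x i \<in> {t. x(i := t) \<in> Rn d - K}"
      using x by simp
    ultimately have "\<forall>\<^sub>F t in nhds (x i). x(i := t) \<in> Rn d - K"
      by (metis eventually_nhds mem_Collect_eq)
    then have "\<forall>\<^sub>F t in nhds (x i). \<phi> (x(i := t)) = 0"
      by (rule eventually_mono) (use K(3) in auto)
    then have "deriv (\<lambda>t. \<phi> (x(i := t))) (x i) = deriv (\<lambda>t. 0) (x i)"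
      by (rule deriv_cong_ev) simp
    then show ?thesis by (simp add: partial_def)
  qed
  with K that show thesis by blast
qed

lemma Cc1_lincomb:
  assumes "\<phi> \<in> Cc1 d U" "\<psi> \<in> Cc1 d U"
  shows "(\<lambda>x. s * \<phi> x + t * \<psi> x) \<in> Cc1 d U"
proof -
  obtain K where K: "compactin (Tn d) K" "K \<subseteq> U" "\<And>x. x \<in> Rn d \<Longrightarrow> x \<notin> K \<Longrightarrow> \<phi> x = 0"
    using assms(1) by (rule Cc1_support) blast
  obtain L where L: "compactin (Tn d) L" "L \<subseteq> U" "\<And>x. x \<in> Rn d \<Longrightarrow> x \<notin> L \<Longrightarrow> \<psi> x = 0"
    using assms(2) by (rule Cc1_support) blast
  have "compactin (Tn d) (K \<union> L)" "K \<union> L \<subseteq> U" "\<forall>x\<in>Rn d - (K \<union> L). s * \<phi> x + t * \<psi> x = 0"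
    using K L compactin_Un by auto
  then show ?thesis
    using C1_lincomb[OF Cc1_C1[OF assms(1)] Cc1_C1[OF assms(2)], of s t]
    unfolding Cc1_def by blast
qed

lemma Cc1_mult:
  assumes "\<phi> \<in> Cc1 d U" "\<psi> \<in> C1 d"
  shows "(\<lambda>x. \<phi> x * \<psi> x) \<in> Cc1 d U"
proof -
  obtain K where K: "compactin (Tn d) K" "K \<subseteq> U" "\<And>x. x \<in> Rn d \<Longrightarrow> x \<notin> K \<Longrightarrow> \<phi> x = 0"
    using assms(1) by (rule Cc1_support) blast
  then have "\<forall>x\<in>Rn d - K. \<phi> x * \<psi> x = 0" by simp
  then show ?thesis
    using C1_mult(1)[OF Cc1_C1[OF assms(1)] assms(2)] K unfolding Cc1_def by blast
qed

lemma continuous_bounded_of_support: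
  assumes "continuous_map (Tn d) euclideanreal \<phi>" "compactin (Tn d) K"
    "\<And>x. x \<in> Rn d \<Longrightarrow> x \<notin> K \<Longrightarrow> \<phi> x = 0"
  obtains B where "0 \<le> B" "\<And>x. x \<in> Rn d \<Longrightarrow> \<bar>\<phi> x\<bar> \<le> B"
proof -
  have "compactin euclideanreal (\<phi> ` K)"
    using assms(1,2) image_compactin by blast
  then have "bounded (\<phi> ` K)"
    by (simp add: compact_imp_bounded)
  then obtain B where B: "\<And>x. x \<in> K \<Longrightarrow> \<bar>\<phi> x\<bar> \<le> B"
    by (auto simp: bounded_iff)
  have "\<bar>\<phi> x\<bar> \<le> max B 0" if "x \<in> Rn d" for x
    using B[of x] assms(3)[of x] that by (cases "x \<in> K") auto
  then show thesis using that[of "max B 0"] by auto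
qed

lemma compact_bounded_coordinate:
  assumes "compactin (Tn d) K" "i < d"
  obtains B where "0 \<le> B" "\<And>x. x \<in> K \<Longrightarrow> \<bar>x i\<bar> \<le> B"
proof -
  have "continuous_map (Tn d) euclideanreal (\<lambda>x. x i)"
    using continuous_map_product_projection[of i "{..<d}" "\<lambda>_. euclideanreal"] assms(2) by simp
  then have "compactin euclideanreal ((\<lambda>x. x i) ` K)"
    using assms(1) image_compactin by blast
  then have "bounded ((\<lambda>x. x i) ` K)"
    by (simp add: compact_imp_bounded)
  then obtain B where B: "\<And>x. x \<in> K \<Longrightarrow> \<bar>x i\<bar> \<le> B"
    by (auto simp: bounded_iff)
  show thesis using that[of "max B 0"] B by force
qed

lemma product_sigma_finite_lborel: "product_sigma_finite (\<lambda>_::nat. lborel :: real measure)"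
  by standard

lemma compact_finite_lebn:
  assumes "compactin (Tn d) K"
  shows "emeasure (lebn d) K < \<infinity>"
proof -
  have "\<forall>i. \<exists>B. i < d \<longrightarrow> (\<forall>x\<in>K. \<bar>x i\<bar> \<le> B)"
    using compact_bounded_coordinate[OF assms] by metis
  then obtain B where B: "\<And>i x. i < d \<Longrightarrow> x \<in> K \<Longrightarrow> \<bar>x i\<bar> \<le> B i" by metis
  let ?Q = "PiE {..<d} (\<lambda>i. {- B i .. B i})"
  have "K \<subseteq> Rn d"
    using compactin_subset_topspace[OF assms] by (simp add: Rn_def)
  have "K \<subseteq> ?Q"
  proof
    fix x assume x: "x \<in> K"
    show "x \<in> ?Q"
    proof (rule PiE_I)
      show "x i \<in> {- B i .. B i}" if "i \<in> {..<d}" for i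
        using B[of i x] x that by (simp add: abs_le_iff minus_le_iff)
      show "x i = undefined" if "i \<notin> {..<d}" for i
        using \<open>K \<subseteq> Rn d\<close> x that by (auto simp: Rn_eq_PiE PiE_def extensional_def)
    qed
  qed
  then have "emeasure (lebn d) K \<le> emeasure (lebn d) ?Q"
    by (intro emeasure_mono) (auto intro!: sets_PiM_I_finite)
  also have "\<dots> = (\<Prod>i<d. emeasure lborel {- B i .. B i})"
    by (rule product_sigma_finite.emeasure_PiM[OF product_sigma_finite_lborel]) auto
  also have "\<dots> < \<infinity>"
    by (auto simp: less_top[symmetric] ennreal_prod_eq_top emeasure_lborel_Icc_eq)
  finally show ?thesis .
qed

lemma integrable_compact_support:
  assumes c: "continuous_map (Tn d) euclideanreal \<phi>" and K: "compactin (Tn d) K"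
    and z: "\<And>x. x \<in> Rn d \<Longrightarrow> x \<notin> K \<Longrightarrow> \<phi> x = 0"
  shows "integrable (lebn d) \<phi>"
proof -
  obtain B where B: "0 \<le> B" "\<And>x. x \<in> Rn d \<Longrightarrow> \<bar>\<phi> x\<bar> \<le> B"
    using continuous_bounded_of_support[OF c K z] by blast
  have "integrable (lebn d) (\<lambda>x. B * indicator K x)"
    using compactin_sets_lebn[OF K] compact_finite_lebn[OF K] by simp
  then show ?thesis
  proof (rule Bochner_Integration.integrable_bound)
    show "AE x in lebn d. norm (\<phi> x) \<le> norm (B * indicator K x)"
      using B z by (auto simp: space_lebn indicator_def intro!: AE_I2)
  qed (rule continuous_measurable_lebn[OF c])
qed

section \<open>Smooth bump functions and the fundamental lemma\<close>

lemma not_in_box: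
  assumes "x \<in> Rn d" "x \<notin> PiE {..<d} S"
  shows "\<exists>i<d. x i \<notin> S i"
  using assms unfolding Rn_eq_PiE PiE_iff by blast

lemma pos_part_sq_deriv: "((\<lambda>s::real. (max 0 s)\<^sup>2) has_real_derivative 2 * max 0 s) (at s)"
proof -
  consider "s > 0" | "s < 0" | "s = 0" by linarith
  then show ?thesis
  proof cases
    case 1
    have "((\<lambda>s::real. s\<^sup>2) has_real_derivative 2 * max 0 s) (at s)"
      using 1 by (auto intro!: derivative_eq_intros)
    then show ?thesis
      by (rule has_field_derivative_transform_within_open[where S="{0<..}"]) (use 1 in auto)
  next
    case 2
    have "((\<lambda>s::real. 0) has_real_derivative 2 * max 0 s) (at s)"
      using 2 by (auto intro!: derivative_eq_intros)
    then show ?thesis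
      by (rule has_field_derivative_transform_within_open[where S="{..<0}"]) (use 2 in auto)
  next
    case 3
    have "((\<lambda>h::real. (max 0 h)\<^sup>2 / h) \<longlongrightarrow> 0) (at 0)"
    proof (rule Lim_null_comparison)
      show "\<forall>\<^sub>F h in at (0::real). norm ((max 0 h)\<^sup>2 / h) \<le> \<bar>h\<bar>"
        by (rule always_eventually) (auto simp: max_def power2_eq_square)
      show "((\<lambda>h::real. \<bar>h\<bar>) \<longlongrightarrow> 0) (at 0)"
        by (rule tendsto_rabs_zero) (rule tendsto_ident_at)
    qed
    then show ?thesis
      using 3 by (simp add: DERIV_def)
  qed
qed

text \<open>
  For \<open>a < b\<close>, a continuously differentiable function that vanishes outside \<open>{a<..<b}\<close> and increases to the indicator of this interval as \<open>k\<close> grows; squaring the positive part makes it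
  differentiable at the end points.
\<close>

definition bump :: "nat \<Rightarrow> real \<Rightarrow> real \<Rightarrow> real \<Rightarrow> real"
  where "bump k a b t = 1 - exp (- real k * (max 0 ((t - a) * (b - t)))\<^sup>2)"

definition bump_deriv :: "nat \<Rightarrow> real \<Rightarrow> real \<Rightarrow> real \<Rightarrow> real"
  where "bump_deriv k a b t =
    exp (- real k * (max 0 ((t - a) * (b - t)))\<^sup>2) * (real k * (2 * max 0 ((t - a) * (b - t)) * (a + b - 2 * t)))"

lemma bump_has_deriv: "(bump k a b has_real_derivative bump_deriv k a b t) (at t)"
proof -
  have "((\<lambda>t. (t - a) * (b - t)) has_real_derivative (a + b - 2 * t)) (at t)"
    by (auto intro!: derivative_eq_intros)
  from DERIV_chain2[OF pos_part_sq_deriv this]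
  have 1: "((\<lambda>t. (max 0 ((t - a) * (b - t)))\<^sup>2) has_real_derivative
      2 * max 0 ((t - a) * (b - t)) * (a + b - 2 * t)) (at t)" .
  show ?thesis
    unfolding bump_def[abs_def] bump_deriv_def
    by (rule derivative_eq_intros 1 refl)+ simp
qed

lemma continuous_bump_deriv: "continuous_on UNIV (bump_deriv k a b)"
  unfolding bump_deriv_def[abs_def] by (intro continuous_intros)

lemma bump_bounds: "0 \<le> bump k a b t" "bump k a b t \<le> 1"
  by (auto simp: bump_def)

lemma bump_outside:
  assumes "a < b" "\<not> (a < t \<and> t < b)"
  shows "bump k a b t = 0"
proof -
  have "(t - a) * (b - t) \<le> 0"
    using assms by (auto simp: mult_le_0_iff)
  then show ?thesis by (simp add: bump_def max_def)
qed

lemma bump_tendsto: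
  assumes "a < b"
  shows "(\<lambda>k. bump k a b t) \<longlonglongrightarrow> indicator {a<..<b} t"
proof (cases "a < t \<and> t < b")
  case True
  then have p: "(t - a) * (b - t) > 0" by simp
  let ?c = "exp (- ((t - a) * (b - t))\<^sup>2)"
  have "0 < ((t - a) * (b - t))\<^sup>2"
    using p by (intro zero_less_power)
  then have "?c < 1" by simp
  then have "(\<lambda>k. 1 - ?c ^ k) \<longlonglongrightarrow> 1 - 0"
    by (intro tendsto_intros LIMSEQ_power_zero) simp
  moreover have "bump k a b t = 1 - ?c ^ k" for k
    using p by (simp add: bump_def max_def exp_of_nat_mult[symmetric])
  ultimately show ?thesis using True by simp
next
  case False
  then show ?thesis using bump_outside[OF assms False] by auto
qed

lemma C1_prod:
  assumes d: "\<And>i t. i < d \<Longrightarrow> (\<beta> i has_real_derivative \<beta>' i t) (at t)"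
    and c: "\<And>i. i < d \<Longrightarrow> continuous_on UNIV (\<beta>' i)"
  shows "(\<lambda>x. \<Prod>i<d. \<beta> i (x i)) \<in> C1 d"
proof (rule C1I(1)[where \<psi>="\<lambda>i x. \<beta>' i (x i) * (\<Prod>j\<in>{..<d} - {i}. \<beta> j (x j))"])
  have proj: "continuous_map (Tn d) euclideanreal (\<lambda>x. x i)" if "i < d" for i
    using continuous_map_product_projection[of i "{..<d}" "\<lambda>_. euclideanreal"] that by simp
  have comp: "continuous_map (Tn d) euclideanreal (\<lambda>x. h (x i))"
    if "continuous_on UNIV h" "i < d" for h :: "real \<Rightarrow> real" and i
    using continuous_map_compose[OF proj[OF that(2)], of euclideanreal h] that(1)
    by (simp add: o_def)
  have cb: "continuous_on UNIV (\<beta> i)" if "i < d" for i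
    using d[OF that] by (meson DERIV_isCont continuous_at_imp_continuous_on)
  show "continuous_map (Tn d) euclideanreal (\<lambda>x. \<Prod>i<d. \<beta> i (x i))"
    by (intro continuous_map_prod comp cb) auto
  show "continuous_map (Tn d) euclideanreal (\<lambda>x. \<beta>' i (x i) * (\<Prod>j\<in>{..<d} - {i}. \<beta> j (x j)))"
    if "i < d" for i
    by (intro continuous_map_real_mult continuous_map_prod comp cb c that) auto
  fix x i assume "x \<in> Rn d" and i: "i < d"
  have eq: "(\<Prod>j<d. \<beta> j ((x(i := t)) j)) = \<beta> i t * (\<Prod>j\<in>{..<d} - {i}. \<beta> j (x j))" for t
  proof -
    have "(\<Prod>j<d. \<beta> j ((x(i := t)) j)) =
        \<beta> i ((x(i := t)) i) * (\<Prod>j\<in>{..<d} - {i}. \<beta> j ((x(i := t)) j))"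
      using i by (intro prod.remove) auto
    also have "(\<Prod>j\<in>{..<d} - {i}. \<beta> j ((x(i := t)) j)) = (\<Prod>j\<in>{..<d} - {i}. \<beta> j (x j))"
      by (intro prod.cong) auto
    finally show ?thesis by simp
  qed
  show "((\<lambda>t. \<Prod>j<d. \<beta> j ((x(i := t)) j)) has_real_derivative
      \<beta>' i (x i) * (\<Prod>j\<in>{..<d} - {i}. \<beta> j (x j))) (at (x i))"
    unfolding eq using d[OF i] by (rule DERIV_cmult_right)
qed

lemma box_bump_Cc1:
  assumes ab: "\<And>i. i < d \<Longrightarrow> a i < b i" and sub: "PiE {..<d} (\<lambda>i. {a i..b i}) \<subseteq> U"
  shows "(\<lambda>x. \<Prod>i<d. bump k (a i) (b i) (x i)) \<in> Cc1 d U"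
proof -
  have "(\<lambda>x. \<Prod>i<d. bump k (a i) (b i) (x i)) \<in> C1 d"
    by (rule C1_prod[OF bump_has_deriv continuous_bump_deriv])
  moreover have "compactin (Tn d) (PiE {..<d} (\<lambda>i. {a i..b i}))"
    by (simp add: compactin_PiE)
  moreover have "(\<Prod>i<d. bump k (a i) (b i) (x i)) = 0"
    if x: "x \<in> Rn d - PiE {..<d} (\<lambda>i. {a i..b i})" for x
  proof -
    obtain i where i: "i < d" "x i \<notin> {a i..b i}"
      using not_in_box[of x d "\<lambda>i. {a i..b i}"] x by blast
    then have "bump k (a i) (b i) (x i) = 0"
      by (intro bump_outside ab) auto
    then show ?thesis using i(1) by (auto intro!: prod_zero)
  qed
  ultimately show ?thesis using sub unfolding Cc1_def by blast
qed

lemma leb_on_conv_lebn: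
  assumes "U \<in> sets (lebn d)"
  shows "integrable (leb_on d U) f \<longleftrightarrow> integrable (lebn d) (\<lambda>x. indicator U x * f x :: real)"
    and "(LINT x|leb_on d U. f x) = (LINT x|lebn d. indicator U x * f x)"
    and "(AE x in leb_on d U. P x) \<longleftrightarrow> (AE x in lebn d. x \<in> U \<longrightarrow> P x)"
proof -
  have U: "U \<inter> space (lebn d) \<in> sets (lebn d)"
    using assms by (rule sets.Int) simp
  show "integrable (leb_on d U) f \<longleftrightarrow> integrable (lebn d) (\<lambda>x. indicator U x * f x :: real)"
    "(LINT x|leb_on d U. f x) = (LINT x|lebn d. indicator U x * f x)"
    "(AE x in leb_on d U. P x) \<longleftrightarrow> (AE x in lebn d. x \<in> U \<longrightarrow> P x)"
    using integrable_restrict_space[OF U, of f] integral_restrict_space[OF U, of f]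
      AE_restrict_space_iff[OF U, of P] unfolding leb_on_def by simp_all
qed

lemma space_leb_on: "space (leb_on d U) = U \<inter> Rn d"
  by (simp add: leb_on_def space_restrict_space space_lebn)

lemma obox_sets: "PiE {..<d} (\<lambda>i. {a i<..<b i}) \<in> sets (lebn d)"
  by (intro sets_PiM_I_finite) auto

lemma cbox_sets: "PiE {..<d} (\<lambda>i. {a i..b i}) \<in> sets (lebn d)"
  by (intro sets_PiM_I_finite) auto

lemma integrable_cbox:
  assumes "loc_integrable d U g" "PiE {..<d} (\<lambda>i. {a i..b i}) \<subseteq> U"
  shows "integrable (lebn d) (\<lambda>x. indicator (PiE {..<d} (\<lambda>i. {a i..b i})) x * g x)"
proof -
  have "compactin (Tn d) (PiE {..<d} (\<lambda>i. {a i..b i}))"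
    by (simp add: compactin_PiE)
  then have "integrable (leb_on d (PiE {..<d} (\<lambda>i. {a i..b i}))) g"
    using assms by (auto simp: loc_integrable_def)
  then show ?thesis by (simp add: leb_on_conv_lebn[OF cbox_sets])
qed

text \<open>
  Products of one-dimensional bumps are test functions that converge to the indicator of the open
  box, with the indicator of the closed box as a dominating factor.
\<close>

lemma integral_obox_zero:
  assumes g: "loc_integrable d U g" and U: "U \<in> sets (lebn d)"
    and z: "\<And>\<phi>. \<phi> \<in> Cc1 d U \<Longrightarrow> (LINT x|leb_on d U. g x * \<phi> x) = 0"
    and ab: "\<And>i. i < d \<Longrightarrow> a i < b i" and sub: "PiE {..<d} (\<lambda>i. {a i..b i}) \<subseteq> U"
  shows "(LINT x|lebn d. indicator (PiE {..<d} (\<lambda>i. {a i<..<b i})) x * g x) = 0"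
proof -
  let ?C = "PiE {..<d} (\<lambda>i. {a i..b i})" and ?O = "PiE {..<d} (\<lambda>i. {a i<..<b i})"
  define \<phi> where "\<phi> = (\<lambda>k x. \<Prod>i<d. bump k (a i) (b i) (x i))"
  have h: "integrable (lebn d) (\<lambda>x. indicator ?C x * g x)"
    by (rule integrable_cbox[OF g sub])
  have OC: "?O \<subseteq> ?C" by (intro PiE_mono) auto
  have \<phi>: "\<phi> k \<in> Cc1 d U" for k
    unfolding \<phi>_def by (rule box_bump_Cc1[OF ab sub])
  have \<phi>m: "\<phi> k \<in> borel_measurable (lebn d)" for k
    using continuous_measurable_lebn C1_continuous(1) Cc1_C1 \<phi> by blast
  have bound: "\<bar>\<phi> k x\<bar> \<le> 1" for k x
    unfolding \<phi>_def by (simp add: abs_prod bump_bounds prod_le_1)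
  have lim: "(\<lambda>k. \<phi> k x) \<longlonglongrightarrow> indicator ?O x" if "x \<in> Rn d" for x
  proof -
    have "(\<lambda>k. \<phi> k x) \<longlonglongrightarrow> (\<Prod>i<d. indicator {a i<..<b i} (x i))"
      unfolding \<phi>_def by (intro tendsto_prod bump_tendsto ab) auto
    also have "(\<Prod>i<d. indicator {a i<..<b i} (x i)) = (indicator ?O x :: real)"
    proof (cases "x \<in> ?O")
      case True
      then have "x i \<in> {a i<..<b i}" if "i < d" for i
        using that by (simp add: PiE_iff)
      then have "(\<Prod>i<d. indicator {a i<..<b i} (x i)) = (1::real)"
        by (intro prod.neutral) simp
      then show ?thesis using True by simp
    next
      case False
      then obtain i where "i < d" "x i \<notin> {a i<..<b i}"
        using not_in_box[OF \<open>x \<in> Rn d\<close>] by blast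
      then have "(\<Prod>i<d. indicator {a i<..<b i} (x i)) = (0::real)"
        by (intro prod_zero) (auto intro!: bexI[of _ i])
      then show ?thesis using False by simp
    qed
    finally show ?thesis .
  qed
  have supp: "\<phi> k x = indicator ?C x * \<phi> k x" if "x \<in> Rn d" for k x
  proof (cases "x \<in> ?C")
    case False
    then obtain i where i: "i < d" "x i \<notin> {a i..b i}"
      using not_in_box[OF \<open>x \<in> Rn d\<close>] by blast
    then have "bump k (a i) (b i) (x i) = 0"
      by (intro bump_outside ab) auto
    then show ?thesis using i(1) False by (auto simp: \<phi>_def intro!: prod_zero)
  qed simp
  have 0: "(LINT x|lebn d. (indicator ?C x * g x) * \<phi> k x) = 0" for k
  proof -
    have "(LINT x|lebn d. (indicator ?C x * g x) * \<phi> k x) = (LINT x|lebn d. indicator U x * (g x * \<phi> k x))"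
    proof (rule Bochner_Integration.integral_cong[OF refl])
      fix x assume "x \<in> space (lebn d)"
      then show "(indicator ?C x * g x) * \<phi> k x = indicator U x * (g x * \<phi> k x)"
        using supp[of x k] sub by (auto simp: space_lebn indicator_def split: if_splits)
    qed
    also have "\<dots> = 0" using z[OF \<phi>] by (simp add: leb_on_conv_lebn[OF U])
    finally show ?thesis .
  qed
  have "(\<lambda>k. LINT x|lebn d. (indicator ?C x * g x) * \<phi> k x) \<longlonglongrightarrow>
      (LINT x|lebn d. (indicator ?C x * g x) * indicator ?O x)"
  proof (rule integral_dominated_convergence)
    show "integrable (lebn d) (\<lambda>x. \<bar>indicator ?C x * g x\<bar>)"
      using h by simp
    show "AE x in lebn d. (\<lambda>k. (indicator ?C x * g x) * \<phi> k x) \<longlonglongrightarrow> (indicator ?C x * g x) * indicator ?O x"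
      by (rule AE_I2) (auto intro!: tendsto_mult lim simp: space_lebn)
    show "AE x in lebn d. norm ((indicator ?C x * g x) * \<phi> k x) \<le> \<bar>indicator ?C x * g x\<bar>" for k
      by (rule AE_I2) (auto simp: abs_mult intro!: mult_left_le bound)
    show "(\<lambda>x. (indicator ?C x * g x) * \<phi> k x) \<in> borel_measurable (lebn d)" for k
      using h \<phi>m by measurable
    show "(\<lambda>x. (indicator ?C x * g x) * indicator ?O x) \<in> borel_measurable (lebn d)"
      using h obox_sets by measurable
  qed
  then have "(LINT x|lebn d. (indicator ?C x * g x) * indicator ?O x) = 0"
    unfolding 0 by (simp add: LIMSEQ_const_iff)
  also have "(LINT x|lebn d. (indicator ?C x * g x) * indicator ?O x) =
      (LINT x|lebn d. indicator ?O x * g x)"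
    using OC by (intro Bochner_Integration.integral_cong refl) (auto simp: indicator_def)
  finally show ?thesis .
qed

text \<open>
  It suffices that the coordinate maps are measurable for the sigma algebra generated by the boxes,
  and half-spaces are countable unions of open boxes.
\<close>

lemma sets_lebn_generated_by_boxes:
  "sets (lebn d) \<subseteq> sigma_sets (Rn d) (range (\<lambda>(a, b). PiE {..<d} (\<lambda>i. {a i<..<b i})))"
proof -
  let ?G = "range (\<lambda>(a, b). PiE {..<d} (\<lambda>i. {a i<..<b i})) :: pt set set"
  let ?N = "sigma (Rn d) ?G"
  have G: "?G \<subseteq> Pow (Rn d)"
    by (auto simp: Rn_eq_PiE PiE_def)
  have "sets (lebn d) \<subseteq> sets ?N"
  proof (rule sets_PiM_in_sets)
    show "space ?N = (\<Pi>\<^sub>E i\<in>{..<d}. space (lborel :: real measure))"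
      using G by (simp add: Rn_eq_PiE)
    fix i :: nat and A :: "real set"
    assume i: "i \<in> {..<d}" and A: "A \<in> sets lborel"
    have "(\<lambda>x. x i) \<in> borel_measurable ?N"
    proof (rule borel_measurableI_less)
      fix y :: real
      have eq: "{x \<in> space ?N. x i < y} =
          (\<Union>n::nat. PiE {..<d} (\<lambda>j. {- real n <..< (if j = i then y else real n)}))" (is "_ = ?R")
      proof
        show "?R \<subseteq> {x \<in> space ?N. x i < y}"
          using i G by (auto simp: Rn_eq_PiE PiE_def Pi_def split: if_splits)
        show "{x \<in> space ?N. x i < y} \<subseteq> ?R"
        proof
          fix x assume "x \<in> {x \<in> space ?N. x i < y}"
          then have x: "x \<in> Rn d" "x i < y" using G by auto
          obtain n :: nat where "Max ((\<lambda>j. \<bar>x j\<bar>) ` {..<d}) < real n"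
            using reals_Archimedean2 by blast
          then have "\<bar>x j\<bar> < real n" if "j < d" for j
            using that by (subst (asm) Max_less_iff) auto
          then have "x \<in> PiE {..<d} (\<lambda>j. {- real n <..< (if j = i then y else real n)})"
            using x by (auto simp: Rn_eq_PiE PiE_def Pi_def abs_less_iff minus_less_iff)
          then show "x \<in> ?R" by blast
        qed
      qed
      have "PiE {..<d} (\<lambda>j. {- real n <..< (if j = i then y else real n)}) \<in> ?G" for n
        by (rule range_eqI[of _ _ "(\<lambda>j. - real n, \<lambda>j. if j = i then y else real n)"]) simp
      then have "PiE {..<d} (\<lambda>j. {- real n <..< (if j = i then y else real n)}) \<in> sets ?N" for n
        using G by (simp add: sets_measure_of)
      then show "{x \<in> space ?N. x i < y} \<in> sets ?N"
        unfolding eq by (intro sets.countable_UN) auto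
    qed
    from measurable_sets[OF this, of A] A
    show "{x \<in> space ?N. x i \<in> A} \<in> sets ?N"
      by (simp add: vimage_def Int_def conj_commute)
  qed
  then show ?thesis using G by (simp add: sets_measure_of)
qed

text \<open>
  Intersections of boxes are boxes, so the integrals over boxes determine those over all measurable
  subsets of the given box by a Dynkin argument; an integrable function all of whose set integrals
  vanish is zero almost everywhere.
\<close>

lemma AE_zero_on_obox:
  assumes g: "loc_integrable d U g" and U: "U \<in> sets (lebn d)"
    and z: "\<And>\<phi>. \<phi> \<in> Cc1 d U \<Longrightarrow> (LINT x|leb_on d U. g x * \<phi> x) = 0"
    and pq: "\<And>i. i < d \<Longrightarrow> p i < q i" and sub: "PiE {..<d} (\<lambda>i. {p i..q i}) \<subseteq> U"
  shows "AE x in lebn d. x \<in> PiE {..<d} (\<lambda>i. {p i<..<q i}) \<longrightarrow> g x = 0"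
proof -
  let ?O = "PiE {..<d} (\<lambda>i. {p i<..<q i})" and ?C = "PiE {..<d} (\<lambda>i. {p i..q i})"
  let ?G = "range (\<lambda>(a, b). PiE {..<d} (\<lambda>i. {a i<..<b i})) :: pt set set"
  define h where "h = (\<lambda>x. indicator ?O x * g x)"
  have "integrable (lebn d) (\<lambda>x. indicator ?O x *\<^sub>R (indicator ?C x * g x))"
    by (intro integrable_mult_indicator obox_sets integrable_cbox[OF g sub])
  also have "(\<lambda>x. indicator ?O x *\<^sub>R (indicator ?C x * g x)) = h"
  proof
    have "?O \<subseteq> ?C" by (auto simp: PiE_def Pi_def less_imp_le)
    then show "indicator ?O x *\<^sub>R (indicator ?C x * g x) = h x" for x
      by (auto simp: h_def indicator_def)
  qed
  finally have h: "integrable (lebn d) h" .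
  have hA: "set_integrable (lebn d) A h" if "A \<in> sets (lebn d)" for A
    using integrable_mult_indicator[OF that h] by (simp add: set_integrable_def)
  have total: "(LINT x|lebn d. h x) = 0"
    unfolding h_def by (rule integral_obox_zero[OF g U z pq sub])
  have GS: "?G \<subseteq> sets (lebn d)" using obox_sets by auto
  have Gp: "?G \<subseteq> Pow (Rn d)" by (auto simp: Rn_eq_PiE PiE_def)
  have sub_sets: "sigma_sets (Rn d) ?G \<subseteq> sets (lebn d)"
    using sets.sigma_sets_subset[OF GS] by (simp add: space_lebn)
  have "set_lebesgue_integral (lebn d) A h = 0" if A: "A \<in> sets (lebn d)" for A
  proof -
    have "Int_stable ?G"
    proof (rule Int_stableI)
      fix A B assume "A \<in> ?G" "B \<in> ?G"
      then obtain a b a' b' where AB: "A = PiE {..<d} (\<lambda>i. {a i<..<b i})"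
        "B = PiE {..<d} (\<lambda>i. {a' i<..<b' i})" by auto
      have "A \<inter> B = PiE {..<d} (\<lambda>i. {max (a i) (a' i)<..<min (b i) (b' i)})"
        unfolding AB PiE_Int by (intro PiE_cong) auto
      then show "A \<inter> B \<in> ?G"
        by (intro range_eqI[of _ _ "(\<lambda>i. max (a i) (a' i), \<lambda>i. min (b i) (b' i))"]) simp
    qed
    moreover note Gp
    moreover have "A \<in> sigma_sets (Rn d) ?G"
      using A sets_lebn_generated_by_boxes by blast
    ultimately show ?thesis
    proof (induct rule: sigma_sets_induct_disjoint)
      case (basic A)
      then obtain a b where A: "A = PiE {..<d} (\<lambda>i. {a i<..<b i})" by auto
      let ?a = "\<lambda>i. max (a i) (p i)" and ?b = "\<lambda>i. min (b i) (q i)"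
      have int: "A \<inter> ?O = PiE {..<d} (\<lambda>i. {?a i<..<?b i})"
        unfolding A PiE_Int by (intro PiE_cong) auto
      have "set_lebesgue_integral (lebn d) A h = (LINT x|lebn d. indicator (A \<inter> ?O) x * g x)"
        unfolding set_lebesgue_integral_def h_def
        by (intro Bochner_Integration.integral_cong) (auto simp: indicator_def)
      also have "\<dots> = 0"
      proof (cases "\<forall>i<d. ?a i < ?b i")
        case True
        have "PiE {..<d} (\<lambda>i. {?a i..?b i}) \<subseteq> ?C" by (intro PiE_mono) auto
        then show ?thesis
          unfolding int using True sub by (intro integral_obox_zero[OF g U z]) auto
      next
        case False
        then have "PiE {..<d} (\<lambda>i. {?a i<..<?b i}) = {}"
          by (auto simp only: PiE_eq_empty_iff greaterThanLessThan_empty_iff lessThan_iff not_less not_all not_imp)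
        then show ?thesis unfolding int by simp
      qed
      finally show ?case .
    next
      case empty
      then show ?case by (simp add: set_lebesgue_integral_def)
    next
      case (compl A)
      then have A: "A \<in> sets (lebn d)" using sub_sets by blast
      have "set_lebesgue_integral (lebn d) (Rn d - A) h = (LINT x|lebn d. h x - indicator A x *\<^sub>R h x)"
        unfolding set_lebesgue_integral_def
        by (intro Bochner_Integration.integral_cong) (auto simp: indicator_def space_lebn)
      also have "\<dots> = (LINT x|lebn d. h x) - set_lebesgue_integral (lebn d) A h"
        unfolding set_lebesgue_integral_def
        by (intro Bochner_Integration.integral_diff h integrable_mult_indicator A)
      finally show ?case using total compl by simp
    next
      case (union A)
      then have A: "A i \<in> sets (lebn d)" for i using sub_sets by blast
      have "set_lebesgue_integral (lebn d) (\<Union>i. A i) h = (\<Sum>i. set_lebesgue_integral (lebn d) (A i) h)"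
        using union(1) by (intro lebesgue_integral_countable_add A hA) (auto simp: disjoint_family_on_def A)
      then show ?case using union(3) by simp
    qed
  qed
  moreover have sf: "sigma_finite_measure (lebn d)"
    by (rule product_sigma_finite.sigma_finite[OF product_sigma_finite_lborel]) simp
  ultimately have "AE x in lebn d. h x = 0"
    by (intro sigma_finite_measure.density_zero[OF sf h])
  then show ?thesis
    by eventually_elim (auto simp: h_def indicator_def split: if_splits)
qed

text \<open>
  Rational boxes are used because there are only countably many of them: null sets and measurability
  can be glued along the cover of an open set by these boxes.
\<close>

lemma openin_rational_box:
  assumes "openin (Tn d) U" "x \<in> U"
  obtains r :: "nat \<Rightarrow> rat \<times> rat" where "r \<in> PiE {..<d} (\<lambda>_. UNIV)"
    "\<And>i. i < d \<Longrightarrow> of_rat (fst (r i)) < x i \<and> x i < (of_rat (snd (r i)) :: real)"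
    "PiE {..<d} (\<lambda>i. {of_rat (fst (r i))..of_rat (snd (r i))}) \<subseteq> U"
proof -
  obtain V where "\<forall>i\<in>{..<d}. openin euclideanreal (V i)" and V2: "x \<in> PiE {..<d} V"
    and V3: "PiE {..<d} V \<subseteq> U"
    using assms unfolding openin_product_topology_alt by blast
  then have V1: "\<And>i. i < d \<Longrightarrow> open (V i)" by simp
  note V = V1 V2 V3
  have "\<exists>r::rat \<times> rat. of_rat (fst r) < x i \<and> x i < (of_rat (snd r) :: real) \<and>
      {of_rat (fst r)..of_rat (snd r)} \<subseteq> V i" if i: "i < d" for i
  proof -
    have "x i \<in> V i" using V(2) i by auto
    then obtain e where e: "e > 0" "\<And>y. dist y (x i) < e \<Longrightarrow> y \<in> V i"
      using V(1)[OF i] unfolding open_dist by metis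
    obtain r1 where r1: "x i - e < of_rat r1" "of_rat r1 < x i"
      using of_rat_dense[of "x i - e" "x i"] e(1) by auto
    obtain r2 where r2: "x i < of_rat r2" "of_rat r2 < x i + e"
      using of_rat_dense[of "x i" "x i + e"] e(1) by auto
    have "{of_rat r1..of_rat r2} \<subseteq> V i"
      using r1 r2 by (auto intro!: e(2) simp: dist_real_def)
    then show ?thesis using r1 r2 by (intro exI[of _ "(r1, r2)"]) auto
  qed
  then obtain r :: "nat \<Rightarrow> rat \<times> rat" where r: "\<And>i. i < d \<Longrightarrow> of_rat (fst (r i)) < x i \<and>
      x i < (of_rat (snd (r i)) :: real) \<and> {of_rat (fst (r i))..of_rat (snd (r i))} \<subseteq> V i"
    by metis
  show thesis
  proof
    show "restrict r {..<d} \<in> PiE {..<d} (\<lambda>_. UNIV)" by simp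
    show "of_rat (fst (restrict r {..<d} i)) < x i \<and> x i < (of_rat (snd (restrict r {..<d} i)) :: real)"
      if "i < d" for i using r[OF that] that by simp
    have "PiE {..<d} (\<lambda>i. {of_rat (fst (restrict r {..<d} i))..of_rat (snd (restrict r {..<d} i))}) \<subseteq> PiE {..<d} V"
    proof (rule PiE_mono)
      fix i assume "i \<in> {..<d}"
      then show "{of_rat (fst (restrict r {..<d} i))..of_rat (snd (restrict r {..<d} i))} \<subseteq> V i"
        using r[of i] by simp
    qed
    then show "PiE {..<d} (\<lambda>i. {of_rat (fst (restrict r {..<d} i))..of_rat (snd (restrict r {..<d} i))}) \<subseteq> U"
      using V(3) by (rule subset_trans)
  qed
qed

lemma fundamental_lemma_calculus_of_variations:
  assumes g: "loc_integrable d U g" and U: "openin (Tn d) U"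
    and z: "\<And>\<phi>. \<phi> \<in> Cc1 d U \<Longrightarrow> (LINT x|leb_on d U. g x * \<phi> x) = 0"
  shows "AE x in leb_on d U. g x = 0"
proof -
  have Us: "U \<in> sets (lebn d)" by (rule openin_sets_lebn[OF U])
  define R where "R = {r \<in> PiE {..<d} (\<lambda>_. UNIV :: (rat \<times> rat) set).
    (\<forall>i<d. (of_rat (fst (r i)) :: real) < of_rat (snd (r i))) \<and>
    PiE {..<d} (\<lambda>i. {of_rat (fst (r i))..of_rat (snd (r i))}) \<subseteq> U}"
  have "countable R"
    unfolding R_def by (rule countable_subset[OF _ countable_PiE[of "{..<d}" "\<lambda>_. UNIV"]]) auto
  then have "AE x in lebn d. \<forall>r\<in>R. x \<in> PiE {..<d} (\<lambda>i. {of_rat (fst (r i))<..<of_rat (snd (r i))}) \<longrightarrow> g x = 0"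
  proof (rule AE_ball_countable'[rotated])
    fix r assume r: "r \<in> R"
    show "AE x in lebn d. x \<in> PiE {..<d} (\<lambda>i. {of_rat (fst (r i))<..<of_rat (snd (r i))}) \<longrightarrow> g x = 0"
    proof (rule AE_zero_on_obox[OF g Us z])
      show "(of_rat (fst (r i)) :: real) < of_rat (snd (r i))" if "i < d" for i
        using r that unfolding R_def by blast
      show "PiE {..<d} (\<lambda>i. {of_rat (fst (r i))..of_rat (snd (r i))}) \<subseteq> U"
        using r unfolding R_def by blast
    qed
  qed
  then have "AE x in lebn d. x \<in> U \<longrightarrow> g x = 0"
  proof eventually_elim
    case (elim x)
    show ?case
    proof
      assume x: "x \<in> U"
      obtain r :: "nat \<Rightarrow> rat \<times> rat" where r: "r \<in> PiE {..<d} (\<lambda>_. UNIV)"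
        "\<And>i. i < d \<Longrightarrow> of_rat (fst (r i)) < x i \<and> x i < (of_rat (snd (r i)) :: real)"
        "PiE {..<d} (\<lambda>i. {of_rat (fst (r i))..of_rat (snd (r i))}) \<subseteq> U"
        by (rule openin_rational_box[OF U x]) (rule that)
      have "(of_rat (fst (r i)) :: real) < of_rat (snd (r i))" if "i < d" for i
        using r(2)[OF that] by linarith
      then have "r \<in> R" unfolding R_def using r(1,3) by simp
      moreover have "x \<in> Rn d" using openin_subset[OF U] x by (auto simp: Rn_def)
      then have "x \<in> PiE {..<d} (\<lambda>i. {of_rat (fst (r i))<..<of_rat (snd (r i))})"
        using r(2) by (auto simp: Rn_eq_PiE PiE_def)
      ultimately show "g x = 0" using elim by blast
    qed
  qed
  then show ?thesis by (simp add: leb_on_conv_lebn[OF Us])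
qed

section \<open>Weak gradients\<close>

lemma compact_subset_integrable:
  assumes "loc_integrable d U g" "compactin (Tn d) K" "K \<subseteq> U"
  shows "integrable (lebn d) (\<lambda>x. indicator K x * g x)"
  using assms leb_on_conv_lebn(1)[OF compactin_sets_lebn[OF assms(2)], of g]
  unfolding loc_integrable_def by blast

lemma loc_integrable_lincomb:
  assumes "loc_integrable d U u" "loc_integrable d U v"
  shows "loc_integrable d U (\<lambda>x. s * u x + t * v x)"
  using assms unfolding loc_integrable_def by auto

lemma integrable_mult_compact_support:
  assumes u: "loc_integrable d U u" and U: "U \<in> sets (lebn d)"
    and c: "continuous_map (Tn d) euclideanreal \<phi>"
    and K: "compactin (Tn d) K" "K \<subseteq> U" and z: "\<And>x. x \<in> Rn d \<Longrightarrow> x \<notin> K \<Longrightarrow> \<phi> x = 0"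
  shows "integrable (leb_on d U) (\<lambda>x. u x * \<phi> x)"
proof -
  obtain B where B: "0 \<le> B" "\<And>x. x \<in> Rn d \<Longrightarrow> \<bar>\<phi> x\<bar> \<le> B"
    using continuous_bounded_of_support[OF c K(1) z] by blast
  have i: "integrable (lebn d) (\<lambda>x. indicator K x * u x)"
    by (rule compact_subset_integrable[OF u K])
  have m: "\<phi> \<in> borel_measurable (lebn d)"
    by (rule continuous_measurable_lebn[OF c])
  have "integrable (lebn d) (\<lambda>x. (indicator K x * u x) * \<phi> x)"
  proof (rule Bochner_Integration.integrable_bound)
    show "integrable (lebn d) (\<lambda>x. B * (indicator K x * u x))" using i by simp
    show "(\<lambda>x. (indicator K x * u x) * \<phi> x) \<in> borel_measurable (lebn d)"
      using i m by measurable
    show "AE x in lebn d. norm ((indicator K x * u x) * \<phi> x) \<le> norm (B * (indicator K x * u x))"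
    proof (rule AE_I2)
      fix x assume "x \<in> space (lebn d)"
      then have "\<bar>\<phi> x\<bar> \<le> \<bar>B\<bar>" using B by (simp add: space_lebn)
      then show "norm ((indicator K x * u x) * \<phi> x) \<le> norm (B * (indicator K x * u x))"
        using mult_right_mono[of "\<bar>\<phi> x\<bar>" "\<bar>B\<bar>" "\<bar>indicator K x * u x\<bar>"]
        by (simp add: abs_mult mult.commute)
    qed
  qed
  also have "?this \<longleftrightarrow> integrable (lebn d) (\<lambda>x. indicator U x * (u x * \<phi> x))"
  proof (rule Bochner_Integration.integrable_cong[OF refl])
    fix x assume "x \<in> space (lebn d)"
    then show "(indicator K x * u x) * \<phi> x = indicator U x * (u x * \<phi> x)"
      using z[of x] K(2) by (cases "x \<in> K") (auto simp: space_lebn)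
  qed
  finally show ?thesis by (simp add: leb_on_conv_lebn[OF U])
qed

lemma integrable_mult_Cc1:
  assumes u: "loc_integrable d U u" and U: "U \<in> sets (lebn d)" and \<phi>: "\<phi> \<in> Cc1 d U"
  shows "integrable (leb_on d U) (\<lambda>x. u x * \<phi> x)"
    and "i < d \<Longrightarrow> integrable (leb_on d U) (\<lambda>x. u x * partial i \<phi> x)"
proof -
  obtain K where K: "compactin (Tn d) K" "K \<subseteq> U" "\<And>x. x \<in> Rn d \<Longrightarrow> x \<notin> K \<Longrightarrow> \<phi> x = 0"
    "\<And>x i. x \<in> Rn d \<Longrightarrow> x \<notin> K \<Longrightarrow> i < d \<Longrightarrow> partial i \<phi> x = 0"
    using \<phi> by (rule Cc1_support) (rule that)
  show "integrable (leb_on d U) (\<lambda>x. u x * \<phi> x)"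
    by (rule integrable_mult_compact_support[OF u U C1_continuous(1)[OF Cc1_C1[OF \<phi>]] K(1-3)])
  show "integrable (leb_on d U) (\<lambda>x. u x * partial i \<phi> x)" if "i < d"
    by (rule integrable_mult_compact_support[OF u U C1_continuous(2)[OF Cc1_C1[OF \<phi>] that] K(1,2)])
      (rule K(4)[OF _ _ that])
qed

text \<open>
  Integrate over the \<open>i\<close>-th coordinate first: by compactness of the support, the fundamental theorem
  of calculus gives zero on every line.
\<close>

lemma integral_partial_zero:
  assumes \<phi>: "\<phi> \<in> Cc1 d U" and i: "i < d"
  shows "(LINT x|lebn d. partial i \<phi> x) = 0"
proof -
  obtain K where K: "compactin (Tn d) K" "\<And>x. x \<in> Rn d \<Longrightarrow> x \<notin> K \<Longrightarrow> \<phi> x = 0"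
    "\<And>x. x \<in> Rn d \<Longrightarrow> x \<notin> K \<Longrightarrow> partial i \<phi> x = 0"
    using \<phi> i by (metis Cc1_support)
  obtain B where B: "0 \<le> B" "\<And>x. x \<in> K \<Longrightarrow> \<bar>x i\<bar> \<le> B"
    using compact_bounded_coordinate[OF K(1) i] by blast
  note cp = C1_continuous(2)[OF Cc1_C1[OF \<phi>] i]
  have I: "insert i ({..<d} - {i}) = {..<d}" using i by auto
  have int: "integrable (lebn d) (partial i \<phi>)"
    by (rule integrable_compact_support[OF cp K(1) K(3)])
  have "(LINT x|lebn d. partial i \<phi> x) =
      (LINT x|Pi\<^sub>M ({..<d} - {i}) (\<lambda>_. lborel). (LINT y|lborel. partial i \<phi> (x(i := y))))"
    using product_sigma_finite.product_integral_insert[OF product_sigma_finite_lborel,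
        of "{..<d} - {i}" i "partial i \<phi>"] int unfolding I by simp
  also have "\<dots> = (LINT x|Pi\<^sub>M ({..<d} - {i}) (\<lambda>_. lborel :: real measure). 0)"
  proof (rule Bochner_Integration.integral_cong[OF refl])
    fix x assume "x \<in> space (Pi\<^sub>M ({..<d} - {i}) (\<lambda>_. lborel :: real measure))"
    then have x: "x(i := y) \<in> Rn d" for y
      using i by (auto simp: space_PiM Rn_eq_PiE PiE_def extensional_def)
    define F where "F = (\<lambda>t. \<phi> (x(i := t)))"
    define f where "f = (\<lambda>t. partial i \<phi> (x(i := t)))"
    have D: "(F has_real_derivative f t) (at t)" for t
      using C1_has_partial[OF Cc1_C1[OF \<phi>] x[of 0] i, of t] by (simp add: F_def f_def)
    have "continuous_map euclideanreal euclideanreal (partial i \<phi> \<circ> (\<lambda>t. (x(i := 0))(i := t)))"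
      by (rule continuous_map_compose[OF continuous_map_slice[OF x i] cp])
    then have "continuous_on UNIV f"
      by (simp add: o_def f_def)
    then have C: "isCont f t" for t
      by (simp add: continuous_on_eq_continuous_at)
    have out: "x(i := t) \<notin> K" if "\<bar>t\<bar> > B" for t
      using B(2)[of "x(i := t)"] that by auto
    \<comment> \<open>The bounds are enlarged by one so that the end points lie outside the support.\<close>
    have "(LINT t|lborel. f t * indicator {- (B + 1)..B + 1} t) = F (B + 1) - F (- (B + 1))"
      using B(1) by (intro integral_FTC_Icc_real D C) auto
    also have "(\<lambda>t. f t * indicator {- (B + 1)..B + 1} t) = f"
    proof
      show "f t * indicator {- (B + 1)..B + 1} t = f t" for t
      proof (cases "\<bar>t\<bar> > B")
        case True
        then show ?thesis using K(3)[OF x out] by (simp add: f_def)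
      next
        case False
        then have "t \<in> {- (B + 1)..B + 1}" by auto
        then show ?thesis by simp
      qed
    qed
    also have "F (B + 1) = 0" using B(1) K(2)[OF x out, of "B + 1"] by (simp add: F_def)
    also have "F (- (B + 1)) = 0" using B(1) K(2)[OF x out, of "- (B + 1)"] by (simp add: F_def)
    finally show "(LINT y|lborel. partial i \<phi> (x(i := y))) = 0" by (simp add: f_def)
  qed
  finally show ?thesis by simp
qed

lemma integrable_Cc1:
  assumes \<phi>: "\<phi> \<in> Cc1 d U"
  shows "integrable (lebn d) \<phi>" "i < d \<Longrightarrow> integrable (lebn d) (partial i \<phi>)"
proof -
  obtain K where K: "compactin (Tn d) K" "K \<subseteq> U" "\<And>x. x \<in> Rn d \<Longrightarrow> x \<notin> K \<Longrightarrow> \<phi> x = 0"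
    "\<And>x i. x \<in> Rn d \<Longrightarrow> x \<notin> K \<Longrightarrow> i < d \<Longrightarrow> partial i \<phi> x = 0"
    using \<phi> by (rule Cc1_support) (rule that)
  show "integrable (lebn d) \<phi>"
    by (rule integrable_compact_support[OF C1_continuous(1)[OF Cc1_C1[OF \<phi>]] K(1,3)])
  show "integrable (lebn d) (partial i \<phi>)" if "i < d"
    by (rule integrable_compact_support[OF C1_continuous(2)[OF Cc1_C1[OF \<phi>] that] K(1)])
      (rule K(4)[OF _ _ that])
qed

lemma integral_leb_on_whole:
  fixes f :: sfun
  assumes "U \<in> sets (lebn d)" "\<And>x. x \<in> Rn d \<Longrightarrow> x \<notin> U \<Longrightarrow> f x = 0"
  shows "(LINT x|leb_on d U. f x) = (LINT x|lebn d. f x)"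
  using assms(2) unfolding leb_on_conv_lebn(2)[OF assms(1)]
  by (intro Bochner_Integration.integral_cong[OF refl]) (auto simp: indicator_def space_lebn)

lemma integrable_imp_loc_integrable:
  assumes "integrable (lebn d) f"
  shows "loc_integrable d U f"
  unfolding loc_integrable_def
proof (intro allI impI)
  fix K assume "compactin (Tn d) K \<and> K \<subseteq> U"
  then have "K \<in> sets (lebn d)" using compactin_sets_lebn by blast
  then show "integrable (leb_on d K) f"
    using integrable_mult_indicator[OF _ assms, of K] by (simp add: leb_on_conv_lebn)
qed

text \<open>
  Integration by parts: the product of the two test functions is again a test function, and the
  integral of its partial derivative vanishes.
\<close>

lemma Cc1_has_weak_grad:
  assumes U: "openin (Tn d) U" and \<phi>: "\<phi> \<in> Cc1 d U"
  shows "has_weak_grad d U \<phi> (\<lambda>x i. partial i \<phi> x)"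
proof -
  have Us: "U \<in> sets (lebn d)" by (rule openin_sets_lebn[OF U])
  have "(LINT x|leb_on d U. \<phi> x * partial i \<psi> x) = - (LINT x|leb_on d U. partial i \<phi> x * \<psi> x)"
    if i: "i < d" and \<psi>: "\<psi> \<in> Cc1 d U" for i \<psi>
  proof -
    have m: "(\<lambda>x. \<phi> x * \<psi> x) \<in> Cc1 d U"
      by (rule Cc1_mult[OF \<phi> Cc1_C1[OF \<psi>]])
    have loc: "loc_integrable d U \<phi>" "loc_integrable d U (partial i \<phi>)"
      using integrable_imp_loc_integrable integrable_Cc1[OF \<phi>] i by blast+
    obtain K where K: "K \<subseteq> U" "\<And>x. x \<in> Rn d \<Longrightarrow> x \<notin> K \<Longrightarrow> partial i (\<lambda>x. \<phi> x * \<psi> x) x = 0"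
      using Cc1_support[OF m] i by metis
    have "0 = (LINT x|lebn d. partial i (\<lambda>x. \<phi> x * \<psi> x) x)"
      using integral_partial_zero[OF m i] by simp
    also have "\<dots> = (LINT x|leb_on d U. partial i (\<lambda>x. \<phi> x * \<psi> x) x)"
      using K by (intro integral_leb_on_whole[OF Us, symmetric]) blast
    also have "\<dots> = (LINT x|leb_on d U. partial i \<phi> x * \<psi> x + \<phi> x * partial i \<psi> x)"
      using C1_mult(2)[OF Cc1_C1[OF \<phi>] Cc1_C1[OF \<psi>] _ i]
      by (intro Bochner_Integration.integral_cong refl) (simp add: space_leb_on)
    also have "\<dots> = (LINT x|leb_on d U. partial i \<phi> x * \<psi> x) + (LINT x|leb_on d U. \<phi> x * partial i \<psi> x)"
      by (intro Bochner_Integration.integral_add integrable_mult_Cc1[OF loc(2) Us \<psi>]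
          integrable_mult_Cc1(2)[OF loc(1) Us \<psi> i])
    finally show ?thesis by simp
  qed
  then show ?thesis
    unfolding has_weak_grad_def using integrable_imp_loc_integrable integrable_Cc1[OF \<phi>] by blast
qed

lemma has_weak_grad_lincomb:
  assumes U: "U \<in> sets (lebn d)" and u: "has_weak_grad d U u g" and v: "has_weak_grad d U v h"
  shows "has_weak_grad d U (\<lambda>x. s * u x + t * v x) (\<lambda>x i. s * g x i + t * h x i)"
proof -
  have lu: "loc_integrable d U u" "\<And>i. i < d \<Longrightarrow> loc_integrable d U (\<lambda>x. g x i)"
    and lv: "loc_integrable d U v" "\<And>i. i < d \<Longrightarrow> loc_integrable d U (\<lambda>x. h x i)"
    using u v unfolding has_weak_grad_def by blast+
  have "(LINT x|leb_on d U. (s * u x + t * v x) * partial i \<phi> x) =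
      - (LINT x|leb_on d U. (s * g x i + t * h x i) * \<phi> x)" if i: "i < d" and \<phi>: "\<phi> \<in> Cc1 d U" for i \<phi>
  proof -
    have "(LINT x|leb_on d U. (s * u x + t * v x) * partial i \<phi> x) =
        (LINT x|leb_on d U. s * (u x * partial i \<phi> x) + t * (v x * partial i \<phi> x))"
      by (simp add: algebra_simps)
    also have "\<dots> = s * (LINT x|leb_on d U. u x * partial i \<phi> x) + t * (LINT x|leb_on d U. v x * partial i \<phi> x)"
      using integrable_mult_Cc1(2)[OF lu(1) U \<phi> i] integrable_mult_Cc1(2)[OF lv(1) U \<phi> i]
      by simp
    also have "\<dots> = - (s * (LINT x|leb_on d U. g x i * \<phi> x) + t * (LINT x|leb_on d U. h x i * \<phi> x))"
      using u v i \<phi> unfolding has_weak_grad_def by simp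
    also have "s * (LINT x|leb_on d U. g x i * \<phi> x) + t * (LINT x|leb_on d U. h x i * \<phi> x) =
        (LINT x|leb_on d U. s * (g x i * \<phi> x) + t * (h x i * \<phi> x))"
      using integrable_mult_Cc1(1)[OF lu(2)[OF i] U \<phi>] integrable_mult_Cc1(1)[OF lv(2)[OF i] U \<phi>]
      by simp
    also have "\<dots> = (LINT x|leb_on d U. (s * g x i + t * h x i) * \<phi> x)"
      by (simp add: algebra_simps)
    finally show ?thesis .
  qed
  then show ?thesis
    unfolding has_weak_grad_def using lu lv loc_integrable_lincomb by blast
qed

lemma has_weak_grad_unique:
  assumes U: "openin (Tn d) U" and g: "has_weak_grad d U u g" and h: "has_weak_grad d U u h"
    and i: "i < d"
  shows "AE x in leb_on d U. g x i = h x i"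
proof -
  have Us: "U \<in> sets (lebn d)" by (rule openin_sets_lebn[OF U])
  have l: "loc_integrable d U (\<lambda>x. g x i)" "loc_integrable d U (\<lambda>x. h x i)"
    using g h i unfolding has_weak_grad_def by blast+
  have "AE x in leb_on d U. 1 * g x i + (-1) * h x i = 0"
  proof (rule fundamental_lemma_calculus_of_variations[OF loc_integrable_lincomb[OF l] U])
    fix \<phi> assume \<phi>: "\<phi> \<in> Cc1 d U"
    have "(LINT x|leb_on d U. (1 * g x i + (-1) * h x i) * \<phi> x) =
        (LINT x|leb_on d U. g x i * \<phi> x - h x i * \<phi> x)"
      by (simp add: algebra_simps)
    also have "\<dots> = (LINT x|leb_on d U. g x i * \<phi> x) - (LINT x|leb_on d U. h x i * \<phi> x)"
      by (intro Bochner_Integration.integral_diff integrable_mult_Cc1(1)[OF _ Us \<phi>] l)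
    also have "\<dots> = 0"
    proof -
      have "(LINT x|leb_on d U. u x * partial i \<phi> x) = - (LINT x|leb_on d U. g x i * \<phi> x)"
        "(LINT x|leb_on d U. u x * partial i \<phi> x) = - (LINT x|leb_on d U. h x i * \<phi> x)"
        using g h i \<phi> unfolding has_weak_grad_def by blast+
      then show ?thesis by simp
    qed
    finally show "(LINT x|leb_on d U. (1 * g x i + (-1) * h x i) * \<phi> x) = 0" .
  qed
  then show ?thesis by eventually_elim simp
qed

lemma has_weak_grad_weak_grad:
  "has_weak_grad d U u g \<Longrightarrow> has_weak_grad d U u (weak_grad d U u)"
  unfolding weak_grad_def by (rule someI[of "has_weak_grad d U u"])

text \<open>
  Local integrability speaks only about compact subsets; countably many closed boxes exhaust an open
  set, and measurability can be checked on each of them.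
\<close>

lemma loc_integrable_measurable:
  assumes g: "loc_integrable d U g" and U: "openin (Tn d) U"
  shows "g \<in> borel_measurable (leb_on d U)"
proof -
  have Us: "U \<in> sets (lebn d)" by (rule openin_sets_lebn[OF U])
  define box where "box = (\<lambda>r::nat \<Rightarrow> rat \<times> rat.
    PiE {..<d} (\<lambda>i. {of_rat (fst (r i))..(of_rat (snd (r i)) :: real)}))"
  define R where "R = {r \<in> PiE {..<d} (\<lambda>_. UNIV). box r \<subseteq> U}"
  have R: "countable (box ` R)"
    unfolding R_def
    by (intro countable_image countable_subset[OF _ countable_PiE[of "{..<d}" "\<lambda>_. UNIV"]]) auto
  have cov: "space (leb_on d U) = \<Union>(box ` R)"
  proof
    show "\<Union>(box ` R) \<subseteq> space (leb_on d U)"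
      using openin_subset[OF U] by (auto simp: R_def space_leb_on Rn_def)
    show "space (leb_on d U) \<subseteq> \<Union>(box ` R)"
    proof
      fix x assume "x \<in> space (leb_on d U)"
      then have x: "x \<in> U" "x \<in> Rn d" by (auto simp: space_leb_on)
      obtain r :: "nat \<Rightarrow> rat \<times> rat" where r: "r \<in> PiE {..<d} (\<lambda>_. UNIV)"
        "\<And>i. i < d \<Longrightarrow> of_rat (fst (r i)) < x i \<and> x i < (of_rat (snd (r i)) :: real)"
        "PiE {..<d} (\<lambda>i. {of_rat (fst (r i))..of_rat (snd (r i))}) \<subseteq> U"
        by (rule openin_rational_box[OF U x(1)]) (rule that)
      have "x \<in> box r"
        unfolding box_def
      proof (rule PiE_I)
        show "x i \<in> {of_rat (fst (r i))..of_rat (snd (r i))}" if "i \<in> {..<d}" for i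
          using r(2)[of i] that by simp
        show "x i = undefined" if "i \<notin> {..<d}" for i
          using x(2) that by (auto simp: Rn_eq_PiE PiE_def extensional_def)
      qed
      moreover have "r \<in> R" using r(1,3) by (simp add: R_def box_def)
      ultimately show "x \<in> \<Union>(box ` R)" by blast
    qed
  qed
  show ?thesis
  proof (rule measurable_piecewise_restrict[OF R _ equalityD1[OF cov]])
    fix C assume "C \<in> box ` R"
    then obtain r where C: "C = box r" "C \<subseteq> U" by (auto simp: R_def)
    have Cs: "C \<in> sets (lebn d)" unfolding C(1) box_def by (rule cbox_sets)
    have "compactin (Tn d) C" unfolding C(1) box_def by (simp add: compactin_PiE)
    then have "g \<in> borel_measurable (leb_on d C)"
      using g C(2) unfolding loc_integrable_def by blast
    also have "leb_on d C = restrict_space (leb_on d U) C"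
      using C(2) unfolding leb_on_def by (simp add: restrict_restrict_space Int_absorb1 Us Cs)
    finally show "g \<in> measurable (restrict_space (leb_on d U) C) borel" .
    show "C \<inter> space (leb_on d U) \<in> sets (leb_on d U)"
      using C(2) Cs openin_subset[OF U]
      by (auto simp: leb_on_def sets_restrict_space space_restrict_space Rn_def space_PiM image_iff Us
         intro!: bexI[of _ C])
  qed
qed

section \<open>The Sobolev space with zero boundary values is a vector space\<close>

lemma L2D: "u \<in> L2 N \<Longrightarrow> u \<in> borel_measurable N" "u \<in> L2 N \<Longrightarrow> integrable N (\<lambda>x. (u x)\<^sup>2)"
  by (auto simp: L2_def)

lemma L2_mult_integrable:
  assumes u: "u \<in> L2 N" and v: "v \<in> L2 N"
  shows "integrable N (\<lambda>x. u x * v x)"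
proof (rule Bochner_Integration.integrable_bound)
  show "integrable N (\<lambda>x. (u x)\<^sup>2 + (v x)\<^sup>2)"
    using L2D u v by auto
  show "(\<lambda>x. u x * v x) \<in> borel_measurable N"
    using L2D(1)[OF u] L2D(1)[OF v] by measurable
  show "AE x in N. norm (u x * v x) \<le> norm ((u x)\<^sup>2 + (v x)\<^sup>2)"
  proof (rule AE_I2)
    fix x
    have "2 * (\<bar>u x\<bar> * \<bar>v x\<bar>) \<le> (u x)\<^sup>2 + (v x)\<^sup>2"
      using sum_squares_bound[of "\<bar>u x\<bar>" "\<bar>v x\<bar>"] by simp
    moreover have "0 \<le> \<bar>u x\<bar> * \<bar>v x\<bar>" by simp
    ultimately have "\<bar>u x\<bar> * \<bar>v x\<bar> \<le> (u x)\<^sup>2 + (v x)\<^sup>2" by linarith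
    then show "norm (u x * v x) \<le> norm ((u x)\<^sup>2 + (v x)\<^sup>2)"
      by (simp add: abs_mult)
  qed
qed

lemma sq_lincomb_le: "(s * a + t * b)\<^sup>2 \<le> 2 * s\<^sup>2 * a\<^sup>2 + 2 * t\<^sup>2 * (b::real)\<^sup>2"
  using zero_le_power2[of "s * a - t * b"] by (simp add: power2_eq_square algebra_simps)

lemma L2_lincomb:
  assumes u: "u \<in> L2 N" and v: "v \<in> L2 N"
  shows "(\<lambda>x. s * u x + t * v x) \<in> L2 N"
proof -
  note L2D[OF u] L2D[OF v]
  moreover have "(\<lambda>x. (s * u x + t * v x)\<^sup>2) =
      (\<lambda>x. s\<^sup>2 * (u x)\<^sup>2 + 2 * s * t * (u x * v x) + t\<^sup>2 * (v x)\<^sup>2)"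
    by (simp add: power2_eq_square algebra_simps)
  ultimately show ?thesis
    using L2_mult_integrable[OF u v] unfolding L2_def by simp
qed

lemma L2_cong_AE:
  assumes u: "u \<in> L2 N" and v: "v \<in> borel_measurable N" and eq: "AE x in N. v x = u x"
  shows "v \<in> L2 N"
proof -
  have "integrable N (\<lambda>x. (v x)\<^sup>2) \<longleftrightarrow> integrable N (\<lambda>x. (u x)\<^sup>2)"
    using L2D[OF u] v eq by (intro integrable_cong_AE) auto
  then show ?thesis using L2D[OF u] v by (simp add: L2_def)
qed

lemma L2_bounded_mult:
  assumes u: "u \<in> L2 N" and v: "v \<in> borel_measurable N" and le: "\<And>x. \<bar>v x\<bar> \<le> B * \<bar>u x\<bar>"
  shows "v \<in> L2 N"
proof -
  have "integrable N (\<lambda>x. (v x)\<^sup>2)"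
  proof (rule Bochner_Integration.integrable_bound)
    show "integrable N (\<lambda>x. B\<^sup>2 * (u x)\<^sup>2)" using L2D[OF u] by simp
    show "(\<lambda>x. (v x)\<^sup>2) \<in> borel_measurable N" using v by measurable
    show "AE x in N. norm ((v x)\<^sup>2) \<le> norm (B\<^sup>2 * (u x)\<^sup>2)"
    proof (rule AE_I2)
      fix x
      have "\<bar>v x\<bar>\<^sup>2 \<le> (B * \<bar>u x\<bar>)\<^sup>2" by (rule power_mono[OF le]) simp
      then show "norm ((v x)\<^sup>2) \<le> norm (B\<^sup>2 * (u x)\<^sup>2)" by (simp add: power_mult_distrib)
    qed
  qed
  then show ?thesis using v by (simp add: L2_def)
qed

lemma compact_support_L2:
  assumes U: "U \<in> sets (lebn d)" and c: "continuous_map (Tn d) euclideanreal \<phi>"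
    and K: "compactin (Tn d) K" and z: "\<And>x. x \<in> Rn d \<Longrightarrow> x \<notin> K \<Longrightarrow> \<phi> x = 0"
  shows "\<phi> \<in> L2 (leb_on d U)"
proof -
  have "integrable (lebn d) (\<lambda>x. \<phi> x * \<phi> x)"
    using z by (intro integrable_compact_support[OF continuous_map_real_mult[OF c c] K]) simp
  then have "integrable (lebn d) (\<lambda>x. indicator U x * (\<phi> x)\<^sup>2)"
    using integrable_mult_indicator[OF U, of "\<lambda>x. \<phi> x * \<phi> x"] by (simp add: power2_eq_square)
  moreover have "\<phi> \<in> borel_measurable (leb_on d U)"
    unfolding leb_on_def by (rule measurable_restrict_space1[OF continuous_measurable_lebn[OF c]])
  ultimately show ?thesis by (simp add: L2_def leb_on_conv_lebn[OF U])
qed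

lemma Cc1_L2:
  assumes U: "U \<in> sets (lebn d)" and \<phi>: "\<phi> \<in> Cc1 d U"
  shows "\<phi> \<in> L2 (leb_on d U)" "i < d \<Longrightarrow> partial i \<phi> \<in> L2 (leb_on d U)"
proof -
  obtain K where K: "compactin (Tn d) K" "K \<subseteq> U" "\<And>x. x \<in> Rn d \<Longrightarrow> x \<notin> K \<Longrightarrow> \<phi> x = 0"
    "\<And>x i. x \<in> Rn d \<Longrightarrow> x \<notin> K \<Longrightarrow> i < d \<Longrightarrow> partial i \<phi> x = 0"
    using \<phi> by (rule Cc1_support) (rule that)
  show "\<phi> \<in> L2 (leb_on d U)"
    by (rule compact_support_L2[OF U C1_continuous(1)[OF Cc1_C1[OF \<phi>]] K(1,3)])
  show "partial i \<phi> \<in> L2 (leb_on d U)" if "i < d"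
    by (rule compact_support_L2[OF U C1_continuous(2)[OF Cc1_C1[OF \<phi>] that] K(1)])
      (rule K(4)[OF _ _ that])
qed

text \<open>
  The chosen weak gradient is only determined up to null sets, so every identity for it holds almost
  everywhere.
\<close>

lemma weak_grad_AE:
  assumes "openin (Tn d) U" "has_weak_grad d U u g" "i < d"
  shows "AE x in leb_on d U. weak_grad d U u x i = g x i"
  by (rule has_weak_grad_unique[OF assms(1) has_weak_grad_weak_grad[OF assms(2)] assms(2,3)])

lemma H1D:
  assumes U: "openin (Tn d) U" and u: "u \<in> H1 d U"
  shows "u \<in> L2 (leb_on d U)" "has_weak_grad d U u (weak_grad d U u)"
    "i < d \<Longrightarrow> (\<lambda>x. weak_grad d U u x i) \<in> L2 (leb_on d U)"
proof -
  obtain g where g: "has_weak_grad d U u g" "\<And>i. i < d \<Longrightarrow> (\<lambda>x. g x i) \<in> L2 (leb_on d U)"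
    using u unfolding H1_def by blast
  show "u \<in> L2 (leb_on d U)" using u unfolding H1_def by blast
  show w: "has_weak_grad d U u (weak_grad d U u)"
    by (rule has_weak_grad_weak_grad[OF g(1)])
  show "(\<lambda>x. weak_grad d U u x i) \<in> L2 (leb_on d U)" if i: "i < d"
  proof (rule L2_cong_AE[OF g(2)[OF i] _ weak_grad_AE[OF U g(1) i]])
    show "(\<lambda>x. weak_grad d U u x i) \<in> borel_measurable (leb_on d U)"
      using w i unfolding has_weak_grad_def by (intro loc_integrable_measurable[OF _ U]) blast
  qed
qed

lemma H1_lincomb:
  assumes U: "openin (Tn d) U" and u: "u \<in> H1 d U" and v: "v \<in> H1 d U"
  shows "(\<lambda>x. s * u x + t * v x) \<in> H1 d U"
    and "i < d \<Longrightarrow> AE x in leb_on d U. weak_grad d U (\<lambda>x. s * u x + t * v x) x i =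
      s * weak_grad d U u x i + t * weak_grad d U v x i"
proof -
  have w: "has_weak_grad d U (\<lambda>x. s * u x + t * v x)
      (\<lambda>x i. s * weak_grad d U u x i + t * weak_grad d U v x i)"
    by (rule has_weak_grad_lincomb[OF openin_sets_lebn[OF U] H1D(2)[OF U u] H1D(2)[OF U v]])
  then show "(\<lambda>x. s * u x + t * v x) \<in> H1 d U"
    using L2_lincomb H1D[OF U u] H1D[OF U v] unfolding H1_def by blast
  show "AE x in leb_on d U. weak_grad d U (\<lambda>x. s * u x + t * v x) x i =
      s * weak_grad d U u x i + t * weak_grad d U v x i" if "i < d"
    by (rule weak_grad_AE[OF U w that])
qed

lemma Cc1_H1:
  assumes U: "openin (Tn d) U" and \<phi>: "\<phi> \<in> Cc1 d U"
  shows "\<phi> \<in> H1 d U"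
  using Cc1_has_weak_grad[OF U \<phi>] Cc1_L2[OF openin_sets_lebn[OF U] \<phi>] unfolding H1_def by blast

lemma AE_all_less:
  assumes "\<And>i. i < d \<Longrightarrow> AE x in N. P x i"
  shows "AE x in N. \<forall>i<(d::nat). P x i"
proof -
  have "AE x in N. \<forall>i\<in>{..<d}. P x i"
    using assms by (intro AE_ball_countable') auto
  then show ?thesis by eventually_elim simp
qed

lemma H1_norm_sq_integrable:
  assumes U: "openin (Tn d) U" and u: "u \<in> H1 d U"
  shows "integrable (leb_on d U) (\<lambda>x. (u x)\<^sup>2)"
    "integrable (leb_on d U) (\<lambda>x. \<Sum>i<d. (weak_grad d U u x i)\<^sup>2)"
  using L2D(2)[OF H1D(1)[OF U u]] L2D(2)[OF H1D(3)[OF U u]] by auto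

lemma H1_norm_sq_nonneg: "0 \<le> H1_norm_sq d U u"
  unfolding H1_norm_sq_def
  by (intro add_nonneg_nonneg Bochner_Integration.integral_nonneg sum_nonneg) auto

lemma H1_norm_sq_lincomb:
  assumes U: "openin (Tn d) U" and u: "u \<in> H1 d U" and v: "v \<in> H1 d U"
  shows "H1_norm_sq d U (\<lambda>x. s * u x + t * v x) \<le> 2 * s\<^sup>2 * H1_norm_sq d U u + 2 * t\<^sup>2 * H1_norm_sq d U v"
proof -
  let ?N = "leb_on d U" and ?w = "\<lambda>x. s * u x + t * v x"
  note iu = H1_norm_sq_integrable[OF U u] and iv = H1_norm_sq_integrable[OF U v]
    and iw = H1_norm_sq_integrable[OF U H1_lincomb(1)[OF U u v, of s t]]
  have 1: "(LINT x|?N. (?w x)\<^sup>2) \<le> (LINT x|?N. 2 * s\<^sup>2 * (u x)\<^sup>2 + 2 * t\<^sup>2 * (v x)\<^sup>2)"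
    using iu iv iw sq_lincomb_le
    by (intro integral_mono Bochner_Integration.integrable_add integrable_mult_right) blast+
  have "AE x in ?N. \<forall>i<d. weak_grad d U ?w x i = s * weak_grad d U u x i + t * weak_grad d U v x i"
    by (intro AE_all_less H1_lincomb(2)[OF U u v])
  then have "AE x in ?N. (\<Sum>i<d. (weak_grad d U ?w x i)\<^sup>2) \<le>
      2 * s\<^sup>2 * (\<Sum>i<d. (weak_grad d U u x i)\<^sup>2) + 2 * t\<^sup>2 * (\<Sum>i<d. (weak_grad d U v x i)\<^sup>2)"
  proof eventually_elim
    case (elim x)
    have "(\<Sum>i<d. (weak_grad d U ?w x i)\<^sup>2) \<le>
        (\<Sum>i<d. 2 * s\<^sup>2 * (weak_grad d U u x i)\<^sup>2 + 2 * t\<^sup>2 * (weak_grad d U v x i)\<^sup>2)"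
      using elim sq_lincomb_le by (intro sum_mono) simp
    then show ?case by (simp add: sum.distrib sum_distrib_left)
  qed
  then have 2: "(LINT x|?N. (\<Sum>i<d. (weak_grad d U ?w x i)\<^sup>2)) \<le>
      (LINT x|?N. 2 * s\<^sup>2 * (\<Sum>i<d. (weak_grad d U u x i)\<^sup>2) + 2 * t\<^sup>2 * (\<Sum>i<d. (weak_grad d U v x i)\<^sup>2))"
    by (intro integral_mono_AE iw Bochner_Integration.integrable_add integrable_mult_right iu iv)
  have "(LINT x|?N. 2 * s\<^sup>2 * (u x)\<^sup>2 + 2 * t\<^sup>2 * (v x)\<^sup>2) =
      2 * s\<^sup>2 * (LINT x|?N. (u x)\<^sup>2) + 2 * t\<^sup>2 * (LINT x|?N. (v x)\<^sup>2)"
    using iu(1) iv(1) by simp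
  moreover have "(LINT x|?N. 2 * s\<^sup>2 * (\<Sum>i<d. (weak_grad d U u x i)\<^sup>2) + 2 * t\<^sup>2 * (\<Sum>i<d. (weak_grad d U v x i)\<^sup>2)) =
      2 * s\<^sup>2 * (LINT x|?N. (\<Sum>i<d. (weak_grad d U u x i)\<^sup>2)) + 2 * t\<^sup>2 * (LINT x|?N. (\<Sum>i<d. (weak_grad d U v x i)\<^sup>2))"
    by (subst Bochner_Integration.integral_add) (use iu(2) iv(2) in \<open>auto intro!: integrable_mult_right\<close>)
  ultimately show ?thesis
    using 1 2 unfolding H1_norm_sq_def by (simp add: algebra_simps)
qed

text \<open>
  The approximating test functions are combined in the same way.  The H1 norm of the difference is
  expressed by chosen weak gradients, so that its estimate rests on their linearity, and this is where
  test functions must have weak gradients themselves.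
\<close>

lemma H10_lincomb:
  assumes U: "openin (Tn d) U" and u: "u \<in> H10 d U" and v: "v \<in> H10 d U"
  shows "(\<lambda>x. s * u x + t * v x) \<in> H10 d U"
proof -
  obtain \<phi> where \<phi>: "\<And>n::nat. \<phi> n \<in> Cc1 d U" "(\<lambda>n. H1_norm_sq d U (\<lambda>x. u x - \<phi> n x)) \<longlonglongrightarrow> 0"
    using u unfolding H10_def by blast
  obtain \<psi> where \<psi>: "\<And>n::nat. \<psi> n \<in> Cc1 d U" "(\<lambda>n. H1_norm_sq d U (\<lambda>x. v x - \<psi> n x)) \<longlonglongrightarrow> 0"
    using v unfolding H10_def by blast
  have u1: "u \<in> H1 d U" and v1: "v \<in> H1 d U"
    using u v unfolding H10_def by blast+
  have ud: "(\<lambda>x. u x - \<phi> n x) \<in> H1 d U" for n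
    using H1_lincomb(1)[OF U u1 Cc1_H1[OF U \<phi>(1)], of 1 "-1" n] by simp
  have vd: "(\<lambda>x. v x - \<psi> n x) \<in> H1 d U" for n
    using H1_lincomb(1)[OF U v1 Cc1_H1[OF U \<psi>(1)], of 1 "-1" n] by simp
  define w where "w = (\<lambda>n x. s * \<phi> n x + t * \<psi> n x)"
  have w: "w n \<in> Cc1 d U" for n
    unfolding w_def by (rule Cc1_lincomb[OF \<phi>(1) \<psi>(1)])
  have "(\<lambda>n. H1_norm_sq d U (\<lambda>x. (s * u x + t * v x) - w n x)) \<longlonglongrightarrow> 0"
  proof (rule Lim_null_comparison)
    have eq: "(\<lambda>x. (s * u x + t * v x) - w n x) = (\<lambda>x. s * (u x - \<phi> n x) + t * (v x - \<psi> n x))" for n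
      by (simp add: w_def algebra_simps)
    show "\<forall>\<^sub>F n in sequentially. norm (H1_norm_sq d U (\<lambda>x. (s * u x + t * v x) - w n x)) \<le>
        2 * s\<^sup>2 * H1_norm_sq d U (\<lambda>x. u x - \<phi> n x) + 2 * t\<^sup>2 * H1_norm_sq d U (\<lambda>x. v x - \<psi> n x)"
      unfolding eq using H1_norm_sq_lincomb[OF U ud vd]
      by (intro always_eventually allI) (simp add: H1_norm_sq_nonneg)
    have "(\<lambda>n. 2 * s\<^sup>2 * H1_norm_sq d U (\<lambda>x. u x - \<phi> n x) + 2 * t\<^sup>2 * H1_norm_sq d U (\<lambda>x. v x - \<psi> n x))
        \<longlonglongrightarrow> 2 * s\<^sup>2 * 0 + 2 * t\<^sup>2 * 0"
      by (intro tendsto_intros \<phi>(2) \<psi>(2))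
    then show "(\<lambda>n. 2 * s\<^sup>2 * H1_norm_sq d U (\<lambda>x. u x - \<phi> n x) + 2 * t\<^sup>2 * H1_norm_sq d U (\<lambda>x. v x - \<psi> n x))
        \<longlonglongrightarrow> 0" by simp
  qed
  then show ?thesis
    using H1_lincomb(1)[OF U u1 v1] w unfolding H10_def by blast
qed

section \<open>The energy norm\<close>

lemma model_open: "model_problem P \<T>0 \<Longrightarrow> openin (Tn (mdim P)) (mdom P)"
  by (simp add: model_problem_def polyhedral_lipschitz_domain_def)

lemma XX_lincomb:
  assumes "model_problem P \<T>0" "u \<in> XX P" "v \<in> XX P"
  shows "(\<lambda>x. s * u x + t * v x) \<in> XX P"
  using H10_lincomb[OF model_open[OF assms(1)]] assms(2,3) by (simp add: XX_def)

lemma XX_H1: "u \<in> XX P \<Longrightarrow> u \<in> H1 (mdim P) (mdom P)"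
  by (simp add: XX_def H10_def)

lemma XX_grad_L2:
  assumes "model_problem P \<T>0" "u \<in> XX P"
  shows "u \<in> L2 (leb_on (mdim P) (mdom P))"
    and "i < mdim P \<Longrightarrow> (\<lambda>x. grd P u x i) \<in> L2 (leb_on (mdim P) (mdom P))"
  using H1D[OF model_open[OF assms(1)] XX_H1[OF assms(2)]] by (simp_all add: grd_def)

lemma grd_lincomb:
  assumes "model_problem P \<T>0" "u \<in> XX P" "v \<in> XX P"
  shows "AE x in leb_on (mdim P) (mdom P). \<forall>i<mdim P.
    grd P (\<lambda>x. s * u x + t * v x) x i = s * grd P u x i + t * grd P v x i"
  unfolding grd_def
  by (intro AE_all_less H1_lincomb(2)[OF model_open[OF assms(1)] XX_H1[OF assms(2)] XX_H1[OF assms(3)]])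

text \<open>
  The Cauchy--Schwarz inequality in the form that applies to a semidefinite form known only on the
  plane spanned by two vectors.
\<close>

lemma quadratic_form_discriminant:
  fixes A B C :: real
  assumes "\<And>s t. 0 \<le> s\<^sup>2 * A + 2 * s * t * B + t\<^sup>2 * C"
  shows "B\<^sup>2 \<le> A * C"
proof -
  have C: "0 \<le> C" using assms[of 0 1] by simp
  show ?thesis
  proof (cases "C = 0")
    case True
    have "0 \<le> A + 2 * t * B" for t using assms[of 1 t] True by simp
    from this[of "- (A + 1) / (2 * B)"] have "B = 0"
      by (cases "B = 0") (simp_all add: field_simps)
    then show ?thesis using True by simp
  next
    case False
    have "0 \<le> C\<^sup>2 * A + 2 * C * (- B) * B + (- B)\<^sup>2 * C"
      by (rule assms)
    also have "\<dots> = C * (A * C - B\<^sup>2)"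
      by (simp add: power2_eq_square algebra_simps)
    finally show ?thesis
      using C False by (simp add: zero_le_mult_iff)
  qed
qed

lemma a_form_lincomb:
  assumes mp: "model_problem P \<T>0" and u: "u \<in> XX P" and v: "v \<in> XX P"
  shows "a_form P (\<lambda>x. s * u x + t * v x) (\<lambda>x. s * u x + t * v x) =
    s\<^sup>2 * a_form P u u + 2 * s * t * a_form P u v + t\<^sup>2 * a_form P v v"
proof -
  let ?w = "\<lambda>x. s * u x + t * v x"
  have w: "?w \<in> XX P" by (rule XX_lincomb[OF mp u v])
  have sp: "a_scalar_product P" using mp by (simp add: model_problem_def)
  then have sym: "\<And>v w. v \<in> XX P \<Longrightarrow> w \<in> XX P \<Longrightarrow> a_form P v w = a_form P w v"
    and lin: "\<And>y. y \<in> XX P \<Longrightarrow> a_form P ?w y = s * a_form P u y + t * a_form P v y"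
    using u v unfolding a_scalar_product_def by blast+
  have "a_form P ?w ?w = s * a_form P u ?w + t * a_form P v ?w" by (rule lin[OF w])
  also have "a_form P u ?w = s * a_form P u u + t * a_form P u v"
    using sym[OF u w] lin[OF u] sym[OF v u] by simp
  also have "a_form P v ?w = s * a_form P u v + t * a_form P v v"
    using sym[OF v w] lin[OF v] by simp
  finally show ?thesis by (simp add: power2_eq_square algebra_simps)
qed

lemma a_form_nonneg: "model_problem P \<T>0 \<Longrightarrow> v \<in> XX P \<Longrightarrow> 0 \<le> a_form P v v"
  by (simp add: model_problem_def a_scalar_product_def)

lemma enorm_sq: "model_problem P \<T>0 \<Longrightarrow> v \<in> XX P \<Longrightarrow> (enorm P v)\<^sup>2 = a_form P v v"
  by (simp add: enorm_def a_form_nonneg)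

lemma enorm_nonneg: "model_problem P \<T>0 \<Longrightarrow> v \<in> XX P \<Longrightarrow> 0 \<le> enorm P v"
  by (simp add: enorm_def a_form_nonneg)

text \<open>
  The Cauchy--Schwarz inequality makes the energy norm a seminorm.  Scalar factors are included because
  differences, sums and damped updates then are instances.
\<close>

lemma enorm_lincomb:
  assumes mp: "model_problem P \<T>0" and u: "u \<in> XX P" and v: "v \<in> XX P"
  shows "enorm P (\<lambda>x. s * u x + t * v x) \<le> \<bar>s\<bar> * enorm P u + \<bar>t\<bar> * enorm P v"
proof -
  have "(a_form P u v)\<^sup>2 \<le> a_form P u u * a_form P v v"
  proof (rule quadratic_form_discriminant)
    show "0 \<le> s\<^sup>2 * a_form P u u + 2 * s * t * a_form P u v + t\<^sup>2 * a_form P v v" for s t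
      unfolding a_form_lincomb[OF mp u v, symmetric]
      by (rule a_form_nonneg[OF mp XX_lincomb[OF mp u v]])
  qed
  also have "\<dots> = (enorm P u * enorm P v)\<^sup>2"
    using enorm_sq[OF mp] u v by (simp add: power_mult_distrib)
  finally have CS: "\<bar>a_form P u v\<bar> \<le> enorm P u * enorm P v"
    by (rule abs_le_square_iff[THEN iffD2, THEN order_trans])
      (simp add: enorm_nonneg[OF mp] u v)
  have "(enorm P (\<lambda>x. s * u x + t * v x))\<^sup>2 =
      s\<^sup>2 * (enorm P u)\<^sup>2 + 2 * (s * t * a_form P u v) + t\<^sup>2 * (enorm P v)\<^sup>2"
    using enorm_sq[OF mp] a_form_lincomb[OF mp u v] XX_lincomb[OF mp u v] u v by simp
  also have "s * t * a_form P u v \<le> \<bar>s\<bar> * \<bar>t\<bar> * (enorm P u * enorm P v)"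
  proof -
    have "s * t * a_form P u v \<le> \<bar>s * t * a_form P u v\<bar>" by simp
    also have "\<dots> = \<bar>s\<bar> * \<bar>t\<bar> * \<bar>a_form P u v\<bar>" by (simp add: abs_mult)
    also have "\<dots> \<le> \<bar>s\<bar> * \<bar>t\<bar> * (enorm P u * enorm P v)"
      by (intro mult_left_mono CS) simp
    finally show ?thesis .
  qed
  also have "s\<^sup>2 * (enorm P u)\<^sup>2 + 2 * (\<bar>s\<bar> * \<bar>t\<bar> * (enorm P u * enorm P v)) + t\<^sup>2 * (enorm P v)\<^sup>2 =
      (\<bar>s\<bar> * enorm P u + \<bar>t\<bar> * enorm P v)\<^sup>2"
    by (simp add: power2_sum power_mult_distrib algebra_simps)
  finally show ?thesis
    by (rule power2_le_imp_le) (simp_all add: enorm_nonneg[OF mp] u v)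
qed

lemma enorm_triangle_diff:
  assumes mp: "model_problem P \<T>0" and u: "u \<in> XX P" and v: "v \<in> XX P" and w: "w \<in> XX P"
  shows "enorm P (\<lambda>x. u x - w x) \<le> enorm P (\<lambda>x. u x - v x) + enorm P (\<lambda>x. v x - w x)"
proof -
  have 1: "(\<lambda>x. u x - v x) \<in> XX P" "(\<lambda>x. v x - w x) \<in> XX P"
    using XX_lincomb[OF mp u v, of 1 "-1"] XX_lincomb[OF mp v w, of 1 "-1"] by simp_all
  show ?thesis using enorm_lincomb[OF mp 1, of 1 1] by simp
qed

lemma enorm_scale:
  assumes mp: "model_problem P \<T>0" and u: "u \<in> XX P"
  shows "enorm P (\<lambda>x. s * u x) = \<bar>s\<bar> * enorm P u"
proof -
  have "(\<lambda>x. s * u x) \<in> XX P"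
    using XX_lincomb[OF mp u u, of s 0] by simp
  then have "(enorm P (\<lambda>x. s * u x))\<^sup>2 = (\<bar>s\<bar> * enorm P u)\<^sup>2"
    using a_form_lincomb[OF mp u u, of s 0] enorm_sq[OF mp] u by (simp add: power_mult_distrib)
  then show ?thesis
    using \<open>(\<lambda>x. s * u x) \<in> XX P\<close> enorm_nonneg[OF mp] u by (simp add: power2_eq_iff_nonneg)
qed

lemma enorm_minus_commute:
  assumes mp: "model_problem P \<T>0" and u: "u \<in> XX P" and v: "v \<in> XX P"
  shows "enorm P (\<lambda>x. u x - v x) = enorm P (\<lambda>x. v x - u x)"
proof -
  have "(\<lambda>x. u x - v x) \<in> XX P"
    using XX_lincomb[OF mp u v, of 1 "-1"] by simp
  from enorm_scale[OF mp this, of "-1"] show ?thesis by simp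
qed

lemma enorm_zero:
  assumes mp: "model_problem P \<T>0" and u: "u \<in> XX P"
  shows "enorm P (\<lambda>x. 0) = 0"
  using enorm_scale[OF mp u, of 0] by simp

section \<open>The convex energy of the nonlinear operator\<close>

definition potential :: "(real \<Rightarrow> real) \<Rightarrow> real \<Rightarrow> real"
  where "potential \<mu> r = integral {0..r} (\<lambda>t. \<mu> (t\<^sup>2) * t)"

lemma mu_continuous:
  assumes "mu_admissible \<mu>"
  shows "continuous_on {0..} \<mu>"
proof -
  obtain \<mu>' where "\<And>t. t \<ge> 0 \<Longrightarrow> (\<mu> has_real_derivative \<mu>' t) (at t within {0..})"
    using assms unfolding mu_admissible_def by blast
  then show ?thesis by (intro DERIV_continuous_on) auto
qed

text \<open>
  The growth condition with \<open>s = 0\<close> bounds \<open>\<mu> (t\<^sup>2) * t\<close> by a multiple of \<open>t\<close> and hence says nothing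
  about \<open>\<mu> 0\<close>, which enters the bound separately.
\<close>

lemma mu_bound:
  assumes "mu_admissible \<mu>"
  obtains B where "0 \<le> B" "\<And>t. 0 \<le> t \<Longrightarrow> 0 \<le> \<mu> t \<and> \<mu> t \<le> B"
proof -
  obtain \<alpha>' L' where L: "0 < \<alpha>' \<and> \<alpha>' \<le> L' \<and> (\<forall>s t. 0 \<le> s \<and> s \<le> t \<longrightarrow>
       \<alpha>' * (t - s) \<le> \<mu> (t\<^sup>2) * t - \<mu> (s\<^sup>2) * s \<and> \<mu> (t\<^sup>2) * t - \<mu> (s\<^sup>2) * s \<le> L' * (t - s))"
    using assms unfolding mu_admissible_def by (elim conjE exE) (rule that, intro conjI)
  have nn: "\<And>t. 0 \<le> t \<Longrightarrow> 0 \<le> \<mu> t" using assms unfolding mu_admissible_def by blast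
  have "\<mu> t \<le> max L' (\<mu> 0)" if "0 \<le> t" for t
  proof (cases "t = 0")
    case False
    then have "0 < sqrt t" using that by simp
    moreover have "\<mu> t * sqrt t \<le> L' * sqrt t"
      using L[THEN conjunct2, THEN conjunct2, rule_format, of 0 "sqrt t"] that by simp
    ultimately have "\<mu> t \<le> L'" by simp
    then show ?thesis by simp
  qed simp
  moreover have "0 \<le> max L' (\<mu> 0)" using L by linarith
  ultimately show thesis using nn by (intro that[of "max L' (\<mu> 0)"]) simp_all
qed

lemma mu_flux_mono:
  assumes "mu_admissible \<mu>" "0 \<le> s" "s \<le> t"
  shows "\<mu> (s\<^sup>2) * s \<le> \<mu> (t\<^sup>2) * t"
proof -
  obtain \<alpha>' where "0 < \<alpha>'" "\<alpha>' * (t - s) \<le> \<mu> (t\<^sup>2) * t - \<mu> (s\<^sup>2) * s"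
    using assms unfolding mu_admissible_def by metis
  moreover have "0 \<le> \<alpha>' * (t - s)" using \<open>0 < \<alpha>'\<close> assms(3) by simp
  ultimately show ?thesis by linarith
qed

lemma mu_flux_integrable:
  assumes "mu_admissible \<mu>" "0 \<le> a"
  shows "(\<lambda>t. \<mu> (t\<^sup>2) * t) integrable_on {a..b}"
proof -
  have "continuous_on {a..b} (\<lambda>t. \<mu> (t\<^sup>2))"
    by (rule continuous_on_compose2[OF mu_continuous[OF assms(1)]]) (auto intro!: continuous_intros)
  then show ?thesis
    by (intro integrable_continuous_real continuous_intros)
qed

lemma potential_diff:
  assumes \<mu>: "mu_admissible \<mu>" and ab: "0 \<le> a" "a \<le> b"
  shows "\<mu> (a\<^sup>2) * a * (b - a) \<le> potential \<mu> b - potential \<mu> a"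
    and "potential \<mu> b - potential \<mu> a \<le> \<mu> (b\<^sup>2) * b * (b - a)"
proof -
  let ?\<phi> = "\<lambda>t. \<mu> (t\<^sup>2) * t"
  have eq: "potential \<mu> b - potential \<mu> a = integral {a..b} ?\<phi>"
    using Henstock_Kurzweil_Integration.integral_combine[OF ab mu_flux_integrable[OF \<mu> order_refl]]
    unfolding potential_def by simp
  have i: "?\<phi> integrable_on {a..b}" by (rule mu_flux_integrable[OF \<mu> ab(1)])
  have "integral {a..b} (\<lambda>t. ?\<phi> a) \<le> integral {a..b} ?\<phi>"
    using ab by (intro integral_le i integrable_const_ivl mu_flux_mono[OF \<mu>]) auto
  then show "\<mu> (a\<^sup>2) * a * (b - a) \<le> potential \<mu> b - potential \<mu> a"
    using ab unfolding eq by (simp add: mult_ac)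
  have "integral {a..b} ?\<phi> \<le> integral {a..b} (\<lambda>t. ?\<phi> b)"
    using ab by (intro integral_le i integrable_const_ivl mu_flux_mono[OF \<mu>]) auto
  then show "potential \<mu> b - potential \<mu> a \<le> \<mu> (b\<^sup>2) * b * (b - a)"
    using ab unfolding eq by (simp add: mult_ac)
qed

lemma potential_convex:
  assumes \<mu>: "mu_admissible \<mu>" and ab: "0 \<le> a" "0 \<le> b"
  shows "\<mu> (a\<^sup>2) * a * (b - a) \<le> potential \<mu> b - potential \<mu> a"
proof (cases "a \<le> b")
  case True
  then show ?thesis by (rule potential_diff(1)[OF \<mu> ab(1)])
next
  case False
  then have "potential \<mu> a - potential \<mu> b \<le> \<mu> (a\<^sup>2) * a * (a - b)"
    by (intro potential_diff(2)[OF \<mu> ab(2)]) simp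
  then show ?thesis by (simp add: algebra_simps)
qed

lemma potential_bounds:
  assumes \<mu>: "mu_admissible \<mu>" and B: "\<And>t. 0 \<le> t \<Longrightarrow> \<mu> t \<le> B" and r: "0 \<le> r"
  shows "0 \<le> potential \<mu> r" "potential \<mu> r \<le> B * r\<^sup>2"
proof -
  have 0: "potential \<mu> 0 = 0" by (simp add: potential_def)
  show "0 \<le> potential \<mu> r" using potential_diff(1)[OF \<mu> order_refl r] 0 by simp
  have "potential \<mu> r \<le> \<mu> (r\<^sup>2) * r * r" using potential_diff(2)[OF \<mu> order_refl r] 0 by simp
  also have "\<dots> = \<mu> (r\<^sup>2) * r\<^sup>2" by (simp add: power2_eq_square)
  also have "\<dots> \<le> B * r\<^sup>2" by (intro mult_right_mono B) auto
  finally show "potential \<mu> r \<le> B * r\<^sup>2" .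
qed

lemma potential_measurable:
  assumes \<mu>: "mu_admissible \<mu>"
  shows "potential \<mu> \<in> borel_measurable borel"
proof (rule borel_measurable_mono, rule monoI)
  fix a b :: real assume "a \<le> b"
  consider "b < 0" | "a < 0" "0 \<le> b" | "0 \<le> a" by linarith
  then show "potential \<mu> a \<le> potential \<mu> b"
  proof cases
    case 1
    then show ?thesis using \<open>a \<le> b\<close> by (simp add: potential_def)
  next
    case 2
    obtain B where "\<And>t. 0 \<le> t \<Longrightarrow> 0 \<le> \<mu> t \<and> \<mu> t \<le> B" using mu_bound[OF \<mu>] by metis
    then have "0 \<le> potential \<mu> b" using potential_bounds(1)[OF \<mu>, of B b] 2 by simp
    then show ?thesis using 2 by (simp add: potential_def)
  next
    case 3
    have "0 \<le> \<mu> (a\<^sup>2) * a * (b - a)"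
      using 3 \<open>a \<le> b\<close> \<mu> unfolding mu_admissible_def by (intro mult_nonneg_nonneg) auto
    then show ?thesis using potential_diff(1)[OF \<mu> 3 \<open>a \<le> b\<close>] by linarith
  qed
qed

definition grad_abs :: "model \<Rightarrow> sfun \<Rightarrow> pt \<Rightarrow> real"
  where "grad_abs P v x = sqrt (\<Sum>i<mdim P. (grd P v x i)\<^sup>2)"

definition energy :: "model \<Rightarrow> sfun \<Rightarrow> real"
  where "energy P v =
    (LINT x|leb_on (mdim P) (mdom P). potential (mmu P) (grad_abs P v x)) - F_fun P v"

lemma grad_abs_sq: "(grad_abs P v x)\<^sup>2 = (\<Sum>i<mdim P. (grd P v x i)\<^sup>2)"
  by (simp add: grad_abs_def sum_nonneg)

lemma grad_abs_nonneg: "0 \<le> grad_abs P v x"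
  by (simp add: grad_abs_def sum_nonneg)

lemma grad_abs_integrable:
  assumes mp: "model_problem P \<T>0" and v: "v \<in> XX P"
  shows "grad_abs P v \<in> borel_measurable (leb_on (mdim P) (mdom P))"
    "integrable (leb_on (mdim P) (mdom P)) (\<lambda>x. (grad_abs P v x)\<^sup>2)"
proof -
  have "(\<lambda>x. grd P v x i) \<in> borel_measurable (leb_on (mdim P) (mdom P))" if "i < mdim P" for i
    using L2D(1)[OF XX_grad_L2(2)[OF mp v that]] .
  then have "(\<lambda>x. \<Sum>i<mdim P. (grd P v x i)\<^sup>2) \<in> borel_measurable (leb_on (mdim P) (mdom P))"
    by (intro borel_measurable_sum borel_measurable_power) auto
  then show "grad_abs P v \<in> borel_measurable (leb_on (mdim P) (mdom P))"
    unfolding grad_abs_def[abs_def] by measurable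
  show "integrable (leb_on (mdim P) (mdom P)) (\<lambda>x. (grad_abs P v x)\<^sup>2)"
    unfolding grad_abs_sq using L2D(2)[OF XX_grad_L2(2)[OF mp v]] by auto
qed

lemma potential_grad_integrable:
  assumes mp: "model_problem P \<T>0" and v: "v \<in> XX P"
  shows "integrable (leb_on (mdim P) (mdom P)) (\<lambda>x. potential (mmu P) (grad_abs P v x))"
proof -
  have \<mu>: "mu_admissible (mmu P)" using mp by (simp add: model_problem_def)
  obtain B where B: "0 \<le> B" "\<And>t. 0 \<le> t \<Longrightarrow> 0 \<le> mmu P t \<and> mmu P t \<le> B"
    using mu_bound[OF \<mu>] by metis
  note g = grad_abs_integrable[OF mp v]
  show ?thesis
  proof (rule Bochner_Integration.integrable_bound)
    show "integrable (leb_on (mdim P) (mdom P)) (\<lambda>x. B * (grad_abs P v x)\<^sup>2)" using g(2) by simp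
    show "(\<lambda>x. potential (mmu P) (grad_abs P v x)) \<in> borel_measurable (leb_on (mdim P) (mdom P))"
      by (rule measurable_compose[OF g(1) potential_measurable[OF \<mu>]])
    show "AE x in leb_on (mdim P) (mdom P).
        norm (potential (mmu P) (grad_abs P v x)) \<le> norm (B * (grad_abs P v x)\<^sup>2)"
      using potential_bounds[OF \<mu> _ grad_abs_nonneg, of B] B by (intro AE_I2) simp
  qed
qed

lemma nonlin_flux_L2:
  assumes mp: "model_problem P \<T>0" and v: "v \<in> XX P" and i: "i < mdim P"
  shows "(\<lambda>x. nonlin_flux P v x i) \<in> L2 (leb_on (mdim P) (mdom P))"
proof -
  have \<mu>: "mu_admissible (mmu P)" using mp by (simp add: model_problem_def)
  obtain B where B: "0 \<le> B" "\<And>t. 0 \<le> t \<Longrightarrow> 0 \<le> mmu P t \<and> mmu P t \<le> B"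
    using mu_bound[OF \<mu>] by metis
  note g = XX_grad_L2(2)[OF mp v i]
  have eq: "nonlin_flux P v x i = mmu P (max 0 ((grad_abs P v x)\<^sup>2)) * grd P v x i" for x
    by (simp add: nonlin_flux_def grad_abs_sq max_absorb2 sum_nonneg)
  show ?thesis
  proof (rule L2_bounded_mult[OF g])
    have "continuous_on UNIV (\<lambda>t. mmu P (max 0 t))"
      by (rule continuous_on_compose2[OF mu_continuous[OF \<mu>]]) (auto intro!: continuous_intros)
    then have m: "(\<lambda>t. mmu P (max 0 t)) \<in> borel_measurable borel"
      by (rule borel_measurable_continuous_onI)
    have "(\<lambda>x. (grad_abs P v x)\<^sup>2) \<in> borel_measurable (leb_on (mdim P) (mdom P))"
      using grad_abs_integrable(1)[OF mp v] by measurable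
    from measurable_compose[OF this m]
    show "(\<lambda>x. nonlin_flux P v x i) \<in> borel_measurable (leb_on (mdim P) (mdom P))"
      unfolding eq using L2D(1)[OF g] by (rule borel_measurable_times)
    show "\<bar>nonlin_flux P v x i\<bar> \<le> B * \<bar>grd P v x i\<bar>" for x
      unfolding eq abs_mult using B(2)[of "max 0 ((grad_abs P v x)\<^sup>2)"]
      by (intro mult_right_mono) auto
  qed
qed

lemma A_op_lincomb:
  assumes mp: "model_problem P \<T>0" and w: "w \<in> XX P" and u: "u \<in> XX P" and v: "v \<in> XX P"
  shows "A_op P w (\<lambda>x. s * u x + t * v x) = s * A_op P w u + t * A_op P w v"
proof -
  let ?N = "leb_on (mdim P) (mdom P)" and ?y = "\<lambda>x. s * u x + t * v x"
  have i: "integrable ?N (\<lambda>x. \<Sum>i<mdim P. nonlin_flux P w x i * grd P y x i)" if "y \<in> XX P" for y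
    by (intro Bochner_Integration.integrable_sum L2_mult_integrable nonlin_flux_L2[OF mp w] XX_grad_L2(2)[OF mp that])
      auto
  have "A_op P w ?y = (LINT x|?N. s * (\<Sum>i<mdim P. nonlin_flux P w x i * grd P u x i) +
      t * (\<Sum>i<mdim P. nonlin_flux P w x i * grd P v x i))"
    unfolding A_op_def
  proof (rule integral_cong_AE)
    show "AE x in ?N. (\<Sum>i<mdim P. nonlin_flux P w x i * grd P ?y x i) =
        s * (\<Sum>i<mdim P. nonlin_flux P w x i * grd P u x i) +
        t * (\<Sum>i<mdim P. nonlin_flux P w x i * grd P v x i)"
      using grd_lincomb[OF mp u v, of s t]
    proof eventually_elim
      case (elim x)
      then show ?case
        by (simp add: sum_distrib_left sum.distrib[symmetric] algebra_simps)
    qed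
    show "(\<lambda>x. \<Sum>i<mdim P. nonlin_flux P w x i * grd P ?y x i) \<in> borel_measurable ?N"
      using i[OF XX_lincomb[OF mp u v]] by (rule borel_measurable_integrable)
    show "(\<lambda>x. s * (\<Sum>i<mdim P. nonlin_flux P w x i * grd P u x i) +
        t * (\<Sum>i<mdim P. nonlin_flux P w x i * grd P v x i)) \<in> borel_measurable ?N"
      using borel_measurable_integrable[OF i[OF u]] borel_measurable_integrable[OF i[OF v]]
      by (intro borel_measurable_add borel_measurable_times) auto
  qed
  also have "\<dots> = s * A_op P w u + t * A_op P w v"
    unfolding A_op_def
    by (subst Bochner_Integration.integral_add) (use i[OF u] i[OF v] in \<open>simp_all only: integrable_mult_right integral_mult_right_zero\<close>)
  finally show ?thesis .
qed

lemma F_fun_lincomb: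
  assumes mp: "model_problem P \<T>0" and u: "u \<in> XX P" and v: "v \<in> XX P"
  shows "F_fun P (\<lambda>x. s * u x + t * v x) = s * F_fun P u + t * F_fun P v"
proof -
  let ?N = "leb_on (mdim P) (mdom P)" and ?y = "\<lambda>x. s * u x + t * v x"
  have f: "mf P \<in> L2 ?N" and fv: "\<And>i. i < mdim P \<Longrightarrow> (\<lambda>x. mfv P x i) \<in> L2 ?N"
    using mp by (auto simp: model_problem_def)
  have i: "integrable ?N (\<lambda>x. \<Sum>i<mdim P. mfv P x i * grd P y x i)" if "y \<in> XX P" for y
    by (intro Bochner_Integration.integrable_sum L2_mult_integrable fv XX_grad_L2(2)[OF mp that]) auto
  have j: "integrable ?N (\<lambda>x. mf P x * y x)" if "y \<in> XX P" for y
    by (intro L2_mult_integrable f XX_grad_L2(1)[OF mp that])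
  have "(LINT x|?N. (\<Sum>i<mdim P. mfv P x i * grd P ?y x i)) =
      (LINT x|?N. s * (\<Sum>i<mdim P. mfv P x i * grd P u x i) + t * (\<Sum>i<mdim P. mfv P x i * grd P v x i))"
  proof (rule integral_cong_AE)
    show "AE x in ?N. (\<Sum>i<mdim P. mfv P x i * grd P ?y x i) =
        s * (\<Sum>i<mdim P. mfv P x i * grd P u x i) + t * (\<Sum>i<mdim P. mfv P x i * grd P v x i)"
      using grd_lincomb[OF mp u v, of s t]
    proof eventually_elim
      case (elim x)
      then show ?case
        by (simp add: sum_distrib_left sum.distrib[symmetric] algebra_simps)
    qed
    show "(\<lambda>x. \<Sum>i<mdim P. mfv P x i * grd P ?y x i) \<in> borel_measurable ?N"
      using i[OF XX_lincomb[OF mp u v]] by (rule borel_measurable_integrable)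
    show "(\<lambda>x. s * (\<Sum>i<mdim P. mfv P x i * grd P u x i) +
        t * (\<Sum>i<mdim P. mfv P x i * grd P v x i)) \<in> borel_measurable ?N"
      using borel_measurable_integrable[OF i[OF u]] borel_measurable_integrable[OF i[OF v]]
      by (intro borel_measurable_add borel_measurable_times) auto
  qed
  also have "\<dots> = s * (LINT x|?N. (\<Sum>i<mdim P. mfv P x i * grd P u x i)) +
      t * (LINT x|?N. (\<Sum>i<mdim P. mfv P x i * grd P v x i))"
    by (subst Bochner_Integration.integral_add) (use i[OF u] i[OF v] in \<open>simp_all only: integrable_mult_right integral_mult_right_zero\<close>)
  finally have 1: "(LINT x|?N. (\<Sum>i<mdim P. mfv P x i * grd P ?y x i)) = \<dots>" .
  have "(LINT x|?N. mf P x * ?y x) = (LINT x|?N. s * (mf P x * u x) + t * (mf P x * v x))"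
    by (simp add: algebra_simps)
  also have "\<dots> = s * (LINT x|?N. mf P x * u x) + t * (LINT x|?N. mf P x * v x)"
    using j[OF u] j[OF v] by simp
  finally have 2: "(LINT x|?N. mf P x * ?y x) = \<dots>" .
  show ?thesis
    unfolding F_fun_def 1 2 by (simp add: algebra_simps)
qed

text \<open>
  The flux is the gradient of the radial function given by the potential.  By Cauchy--Schwarz the
  subgradient inequality reduces to the one for the potential on the half-line.
\<close>

lemma flux_pointwise_convex:
  assumes mp: "model_problem P \<T>0"
  shows "(\<Sum>i<mdim P. nonlin_flux P w x i * (grd P v x i - grd P w x i)) \<le>
    potential (mmu P) (grad_abs P v x) - potential (mmu P) (grad_abs P w x)"
proof -
  have \<mu>: "mu_admissible (mmu P)" using mp by (simp add: model_problem_def)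
  let ?m = "mmu P ((grad_abs P w x)\<^sup>2)" and ?a = "grad_abs P w x" and ?b = "grad_abs P v x"
  have m: "0 \<le> ?m" using \<mu> by (simp add: mu_admissible_def)
  have "(\<Sum>i<mdim P. grd P w x i * grd P v x i) \<le> ?a * ?b"
  proof -
    have "(\<Sum>i<mdim P. grd P w x i * grd P v x i) \<le> (\<Sum>i<mdim P. \<bar>grd P w x i\<bar> * \<bar>grd P v x i\<bar>)"
      by (intro sum_mono) (simp add: abs_mult[symmetric])
    also have "\<dots> \<le> L2_set (grd P w x) {..<mdim P} * L2_set (grd P v x) {..<mdim P}"
      by (rule L2_set_mult_ineq)
    finally show ?thesis by (simp add: L2_set_def grad_abs_def)
  qed
  then have "?m * ((\<Sum>i<mdim P. grd P w x i * grd P v x i) - ?a\<^sup>2) \<le> ?m * (?a * ?b - ?a\<^sup>2)"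
    using m by (intro mult_left_mono) auto
  also have "?m * (?a * ?b - ?a\<^sup>2) = ?m * ?a * (?b - ?a)"
    by (simp add: power2_eq_square algebra_simps)
  also have "\<dots> \<le> potential (mmu P) ?b - potential (mmu P) ?a"
    by (intro potential_convex[OF \<mu>] grad_abs_nonneg)
  also have "?m * ((\<Sum>i<mdim P. grd P w x i * grd P v x i) - ?a\<^sup>2) =
      (\<Sum>i<mdim P. nonlin_flux P w x i * (grd P v x i - grd P w x i))"
    unfolding grad_abs_sq sum_subtractf[symmetric] nonlin_flux_def sum_distrib_left
    by (intro sum.cong refl) (simp add: power2_eq_square algebra_simps)
  finally show ?thesis .
qed

lemma energy_convex:
  assumes mp: "model_problem P \<T>0" and v: "v \<in> XX P" and w: "w \<in> XX P"
  shows "A_op P w (\<lambda>x. v x - w x) - F_fun P (\<lambda>x. v x - w x) \<le> energy P v - energy P w"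
proof -
  let ?N = "leb_on (mdim P) (mdom P)"
  have d: "(\<lambda>x. v x - w x) \<in> XX P" using XX_lincomb[OF mp v w, of 1 "-1"] by simp
  have g: "AE x in ?N. \<forall>i<mdim P. grd P (\<lambda>x. v x - w x) x i = grd P v x i - grd P w x i"
    using grd_lincomb[OF mp v w, of 1 "-1"] by simp
  have "A_op P w (\<lambda>x. v x - w x) \<le>
      (LINT x|?N. potential (mmu P) (grad_abs P v x) - potential (mmu P) (grad_abs P w x))"
    unfolding A_op_def
  proof (rule integral_mono_AE)
    show "integrable ?N (\<lambda>x. \<Sum>i<mdim P. nonlin_flux P w x i * grd P (\<lambda>x. v x - w x) x i)"
      by (intro Bochner_Integration.integrable_sum L2_mult_integrable nonlin_flux_L2[OF mp w] XX_grad_L2(2)[OF mp d])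
        auto
    show "integrable ?N (\<lambda>x. potential (mmu P) (grad_abs P v x) - potential (mmu P) (grad_abs P w x))"
      by (intro Bochner_Integration.integrable_diff potential_grad_integrable[OF mp] v w)
    show "AE x in ?N. (\<Sum>i<mdim P. nonlin_flux P w x i * grd P (\<lambda>x. v x - w x) x i) \<le>
        potential (mmu P) (grad_abs P v x) - potential (mmu P) (grad_abs P w x)"
      using g
    proof eventually_elim
      case (elim x)
      then show ?case using flux_pointwise_convex[OF mp, of w x v] by simp
    qed
  qed
  also have "\<dots> = (LINT x|?N. potential (mmu P) (grad_abs P v x)) -
      (LINT x|?N. potential (mmu P) (grad_abs P w x))"
    by (intro Bochner_Integration.integral_diff potential_grad_integrable[OF mp] v w)
  finally show ?thesis
    using F_fun_lincomb[OF mp v w, of 1 "-1"] unfolding energy_def by simp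
qed

text \<open>
  Convexity alone gives only a nonnegative excess.  Splitting the segment at its midpoint and applying
  strong monotonicity between the midpoint and \<open>w\<close> yields a quarter of the monotonicity constant.
\<close>

lemma energy_lower_bound:
  assumes mp: "model_problem P \<T>0" and ml: "monotone_lipschitz P \<alpha> L"
    and v: "v \<in> XX P" and w: "w \<in> XX P"
    and gal: "A_op P w (\<lambda>x. v x - w x) = F_fun P (\<lambda>x. v x - w x)"
  shows "\<alpha> / 4 * (enorm P (\<lambda>x. v x - w x))\<^sup>2 \<le> energy P v - energy P w"
proof -
  define m where "m = (\<lambda>x. (1/2) * v x + (1/2) * w x)"
  let ?d = "\<lambda>x. v x - w x"
  have m: "m \<in> XX P" unfolding m_def by (rule XX_lincomb[OF mp v w])
  have d: "?d \<in> XX P" using XX_lincomb[OF mp v w, of 1 "-1"] by simp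
  have eq: "(\<lambda>x. v x - m x) = (\<lambda>x. (1/2) * ?d x + 0 * ?d x)" "(\<lambda>x. m x - w x) = (\<lambda>x. (1/2) * ?d x + 0 * ?d x)"
    by (simp_all add: m_def field_simps)
  have A: "A_op P y (\<lambda>x. (1/2) * ?d x + 0 * ?d x) = A_op P y ?d / 2" if "y \<in> XX P" for y
    using A_op_lincomb[OF mp that d d, of "1/2" 0] by simp
  have F: "F_fun P (\<lambda>x. (1/2) * ?d x + 0 * ?d x) = F_fun P ?d / 2"
    using F_fun_lincomb[OF mp d d, of "1/2" 0] by simp
  have "\<alpha> * (enorm P (\<lambda>x. m x - w x))\<^sup>2 \<le> A_op P m (\<lambda>x. m x - w x) - A_op P w (\<lambda>x. m x - w x)"
    using ml m w unfolding monotone_lipschitz_def by blast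
  moreover have "enorm P (\<lambda>x. (1/2) * ?d x + 0 * ?d x) = enorm P ?d / 2"
    using enorm_scale[OF mp d, of "1/2"] by simp
  ultimately have "\<alpha> * (enorm P ?d / 2)\<^sup>2 \<le> A_op P m ?d / 2 - A_op P w ?d / 2"
    unfolding eq A[OF m] A[OF w] by metis
  then have 1: "\<alpha> / 4 * (enorm P ?d)\<^sup>2 \<le> A_op P m ?d / 2 - A_op P w ?d / 2"
    by (simp add: power_divide)
  have 2: "A_op P m ?d / 2 - F_fun P ?d / 2 \<le> energy P v - energy P m"
    using energy_convex[OF mp v m] unfolding eq A[OF m] F .
  have 3: "A_op P w ?d / 2 - F_fun P ?d / 2 \<le> energy P m - energy P w"
    using energy_convex[OF mp m w] unfolding eq A[OF w] F .
  show ?thesis using 1 2 3 gal by linarith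
qed

text \<open>
  The subgradient at \<open>v\<close> bounds the energy excess by the residual of \<open>v\<close>, which Galerkin
  orthogonality turns into a difference of operator values.
\<close>

lemma energy_upper_bound:
  assumes mp: "model_problem P \<T>0" and ml: "monotone_lipschitz P \<alpha> L"
    and v: "v \<in> XX P" and w: "w \<in> XX P"
    and gal: "A_op P w (\<lambda>x. v x - w x) = F_fun P (\<lambda>x. v x - w x)"
  shows "energy P v - energy P w \<le> L * (enorm P (\<lambda>x. v x - w x))\<^sup>2"
proof -
  let ?d = "\<lambda>x. v x - w x"
  have d: "?d \<in> XX P" using XX_lincomb[OF mp v w, of 1 "-1"] by simp
  have eq: "(\<lambda>x. w x - v x) = (\<lambda>x. (-1) * ?d x + 0 * ?d x)" by simp
  have "- A_op P v ?d + F_fun P ?d \<le> energy P w - energy P v"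
    using energy_convex[OF mp w v] A_op_lincomb[OF mp v d d, of "-1" 0] F_fun_lincomb[OF mp d d, of "-1" 0]
    unfolding eq by simp
  moreover have "A_op P v ?d - A_op P w ?d \<le> L * enorm P ?d * enorm P ?d"
    using ml v w d unfolding monotone_lipschitz_def by blast
  ultimately show ?thesis using gal by (simp add: power2_eq_square)
qed

section \<open>Bisection and nested discrete spaces\<close>

text \<open>
  The part of being a tagged simplex that guarantees that bisection picks actual vertices; unlike
  affine independence it is evidently inherited by the children.
\<close>

definition well_tagged :: "nat \<Rightarrow> tsimplex \<Rightarrow> bool"
  where "well_tagged d T \<longleftrightarrow> length (fst T) = d + 1 \<and> snd T < d \<and> set (fst T) \<subseteq> Rn d"

lemma hull_of_subset_Rn: "hull_of d vs \<subseteq> Rn d"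
proof
  fix x assume "x \<in> hull_of d vs"
  then obtain c where "x = (\<lambda>i\<in>{..<d}. \<Sum>j<length vs. c j * (vs ! j) i)"
    unfolding hull_of_def by blast
  then show "x \<in> Rn d" by (simp add: Rn_eq_PiE)
qed

lemma hull_of_memI:
  assumes "\<And>j. j < length vs \<Longrightarrow> 0 \<le> c j" "(\<Sum>j<length vs. c j) = (1::real)"
    "x = (\<lambda>i\<in>{..<d}. \<Sum>j<length vs. c j * (vs ! j) i)"
  shows "x \<in> hull_of d vs"
  using assms unfolding hull_of_def by blast

lemma vertex_in_hull_of:
  assumes "v \<in> set vs" "v \<in> Rn d"
  shows "v \<in> hull_of d vs"
proof -
  obtain k where k: "k < length vs" "vs ! k = v"
    using assms(1) by (auto simp: in_set_conv_nth)
  show ?thesis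
  proof (rule hull_of_memI)
    show "(\<Sum>j<length vs. if j = k then 1 else 0) = (1::real)" using k(1) by simp
    have "(\<Sum>j<length vs. (if j = k then 1 else 0) * (vs ! j) i) = v i" for i
    proof -
      have "(\<Sum>j<length vs. (if j = k then 1 else 0) * (vs ! j) i) =
          (\<Sum>j<length vs. if j = k then (vs ! j) i else 0)"
        by (intro sum.cong) auto
      then show ?thesis using k by simp
    qed
    then show "v = (\<lambda>i\<in>{..<d}. \<Sum>j<length vs. (if j = k then 1 else 0) * (vs ! j) i)"
      using assms(2) by (simp add: Rn_eq_PiE PiE_def extensional_restrict)
  qed simp
qed

text \<open>
  Convex combinations of convex combinations are convex combinations.
\<close>

lemma hull_of_mono:
  assumes "set ws \<subseteq> hull_of d vs"
  shows "hull_of d ws \<subseteq> hull_of d vs"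
proof
  fix x assume "x \<in> hull_of d ws"
  then obtain c where c: "x = (\<lambda>i\<in>{..<d}. \<Sum>k<length ws. c k * (ws ! k) i)"
    "\<And>k. k < length ws \<Longrightarrow> 0 \<le> c k" "(\<Sum>k<length ws. c k) = (1::real)"
    unfolding hull_of_def by blast
  let ?Q = "\<lambda>k e. ws ! k = (\<lambda>i\<in>{..<d}. \<Sum>j<length vs. e j * (vs ! j) i) \<and>
      (\<forall>j<length vs. 0 \<le> e j) \<and> (\<Sum>j<length vs. e j) = (1::real)"
  have "\<forall>k\<in>{..<length ws}. \<exists>e. ?Q k e"
  proof
    fix k assume "k \<in> {..<length ws}"
    then have "ws ! k \<in> set ws" by simp
    then have "ws ! k \<in> hull_of d vs" using assms by (rule rev_subsetD)
    then show "\<exists>e. ?Q k e" unfolding hull_of_def mem_Collect_eq .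
  qed
  from bchoice[OF this] obtain e where e': "\<And>k. k < length ws \<Longrightarrow> ?Q k (e k)"
    by auto
  then have e: "\<And>k. k < length ws \<Longrightarrow> ws ! k = (\<lambda>i\<in>{..<d}. \<Sum>j<length vs. e k j * (vs ! j) i)"
    "\<And>k j. k < length ws \<Longrightarrow> j < length vs \<Longrightarrow> 0 \<le> e k j"
    "\<And>k. k < length ws \<Longrightarrow> (\<Sum>j<length vs. e k j) = (1::real)"
    by simp_all
  show "x \<in> hull_of d vs"
  proof (rule hull_of_memI)
    show "0 \<le> (\<Sum>k<length ws. c k * e k j)" if "j < length vs" for j
      by (rule sum_nonneg, rule mult_nonneg_nonneg) (simp_all add: c(2) e(2)[OF _ that])
    have "(\<Sum>j<length vs. \<Sum>k<length ws. c k * e k j) = (\<Sum>k<length ws. \<Sum>j<length vs. c k * e k j)"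
      by (rule sum.swap)
    also have "\<dots> = (\<Sum>k<length ws. c k)"
      by (rule sum.cong[OF refl]) (simp add: sum_distrib_left[symmetric] e(3))
    finally show "(\<Sum>j<length vs. \<Sum>k<length ws. c k * e k j) = 1" using c(3) by simp
    have "(\<Sum>k<length ws. c k * (ws ! k) i) = (\<Sum>j<length vs. (\<Sum>k<length ws. c k * e k j) * (vs ! j) i)"
      if i: "i < d" for i
    proof -
      have "(\<Sum>k<length ws. c k * (ws ! k) i) = (\<Sum>k<length ws. \<Sum>j<length vs. c k * e k j * (vs ! j) i)"
      proof (rule sum.cong[OF refl])
        fix k assume "k \<in> {..<length ws}"
        then have "(ws ! k) i = (\<Sum>j<length vs. e k j * (vs ! j) i)"
          using fun_cong[OF e(1)[of k], of i] i by simp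
        then show "c k * (ws ! k) i = (\<Sum>j<length vs. c k * e k j * (vs ! j) i)"
          by (simp add: sum_distrib_left mult.assoc)
      qed
      also have "\<dots> = (\<Sum>j<length vs. \<Sum>k<length ws. c k * e k j * (vs ! j) i)"
        by (rule sum.swap)
      finally show ?thesis by (simp add: sum_distrib_right)
    qed
    then show "x = (\<lambda>i\<in>{..<d}. \<Sum>j<length vs. (\<Sum>k<length ws. c k * e k j) * (vs ! j) i)"
      unfolding c(1) by (intro restrict_ext) simp
  qed
qed

lemma bisect_child:
  assumes T: "well_tagged d T" and T': "T' \<in> bisect d T"
  shows "well_tagged d T'" "elem d T' \<subseteq> elem d T"
proof -
  obtain vs \<gamma> where T_eq: "T = (vs, \<gamma>)" by (cases T)
  have len: "length vs = d + 1" and \<gamma>: "\<gamma> < d" and sub: "set vs \<subseteq> Rn d"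
    using T by (auto simp: well_tagged_def T_eq)
  have d: "0 < d" using \<gamma> by simp
  define m where "m = (\<lambda>i\<in>{..<d}. ((vs ! 0) i + (vs ! d) i) / 2)"
  define xs where "xs = take \<gamma> (drop 1 vs)"
  define ys where "ys = drop (\<gamma> + 1) (take d vs)"
  have T'_cases: "T' = (vs ! 0 # m # xs @ ys, (\<gamma> + 1) mod d) \<or>
      T' = (vs ! d # m # xs @ rev ys, (\<gamma> + 1) mod d)"
    using T' unfolding bisect_def T_eq Let_def m_def xs_def ys_def by auto
  have vs0: "vs ! 0 \<in> set vs" "vs ! d \<in> set vs" using len by auto
  have "set xs \<subseteq> set vs" "set ys \<subseteq> set vs"
    unfolding xs_def ys_def by (meson set_take_subset set_drop_subset subset_trans)+
  then have verts: "set (fst T') \<subseteq> insert m (set vs)"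
    using T'_cases vs0 by auto
  have m_hull: "m \<in> hull_of d vs"
  proof (rule hull_of_memI)
    \<comment> \<open>The midpoint of the refinement edge, whose end points are the first and the last vertex.\<close>
    let ?c = "\<lambda>j. (if j = 0 then 1/2 else 0) + (if j = d then 1/2 else (0::real))"
    show "0 \<le> ?c j" for j by simp
    show "(\<Sum>j<length vs. ?c j) = 1" using len d by (simp add: sum.distrib)
    have "(\<Sum>j<length vs. ?c j * (vs ! j) i) = ((vs ! 0) i + (vs ! d) i) / 2" for i
    proof -
      have "(\<Sum>j<length vs. ?c j * (vs ! j) i) =
          (\<Sum>j<length vs. (if j = 0 then (vs ! j) i / 2 else 0) + (if j = d then (vs ! j) i / 2 else 0))"
        by (intro sum.cong) auto
      also have "\<dots> = ((vs ! 0) i + (vs ! d) i) / 2"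
        using len d by (simp add: sum.distrib add_divide_distrib)
      finally show ?thesis .
    qed
    then show "m = (\<lambda>i\<in>{..<d}. \<Sum>j<length vs. ?c j * (vs ! j) i)"
      by (simp only: m_def)
  qed
  have "set (fst T') \<subseteq> hull_of d vs"
    using verts m_hull vertex_in_hull_of sub by blast
  then show "elem d T' \<subseteq> elem d T"
    unfolding elem_def T_eq fst_conv by (rule hull_of_mono)
  have "set (fst T') \<subseteq> Rn d"
    using \<open>set (fst T') \<subseteq> hull_of d vs\<close> hull_of_subset_Rn by (rule subset_trans)
  moreover have "length (fst T') = d + 1" "snd T' < d"
    using T'_cases len \<gamma> by (auto simp: xs_def ys_def)
  ultimately show "well_tagged d T'" by (simp add: well_tagged_def)
qed

lemma nvb_steps_nested:
  assumes "(nvb_step d)\<^sup>*\<^sup>* \<S> \<S>'" "\<And>T. T \<in> \<S> \<Longrightarrow> well_tagged d T"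
  shows "\<forall>T'\<in>\<S>'. well_tagged d T' \<and> (\<exists>T\<in>\<S>. elem d T' \<subseteq> elem d T)"
  using assms(1)
proof (induction rule: rtranclp_induct)
  case base
  then show ?case using assms(2) by blast
next
  case (step \<S>1 \<S>2)
  obtain T where T: "T \<in> \<S>1" "\<S>2 = (\<S>1 - {T}) \<union> bisect d T"
    using step(2) unfolding nvb_step_def by blast
  show ?case
  proof
    fix T' assume "T' \<in> \<S>2"
    then consider "T' \<in> \<S>1" | "T' \<in> bisect d T" using T(2) by blast
    then show "well_tagged d T' \<and> (\<exists>T\<in>\<S>. elem d T' \<subseteq> elem d T)"
    proof cases
      case 1
      then show ?thesis using step.IH by blast
    next
      case 2
      then have "well_tagged d T'" "elem d T' \<subseteq> elem d T"
        using bisect_child[of d T T'] step.IH T(1) by blast+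
      then show ?thesis using step.IH T(1) by (meson subset_trans)
    qed
  qed
qed

lemma mesh_conforming: "\<S>' \<in> meshes P \<S> \<Longrightarrow> conforming_triangulation (mdim P) (mdom P) \<S>'"
  by (simp add: nvb_meshes_def)

lemma mesh_finite: "\<S>' \<in> meshes P \<S> \<Longrightarrow> finite \<S>'"
  using mesh_conforming conforming_triangulation_def by blast

lemma mesh_refl: "conforming_triangulation (mdim P) (mdom P) \<S> \<Longrightarrow> \<S> \<in> meshes P \<S>"
  by (simp add: nvb_meshes_def)

lemma mesh_trans: "\<S>' \<in> meshes P \<S> \<Longrightarrow> \<S>'' \<in> meshes P \<S>' \<Longrightarrow> \<S>'' \<in> meshes P \<S>"
  by (auto simp: nvb_meshes_def)

text \<open>
  Elements of the finer mesh lie inside elements of the coarser mesh, where the function is affine.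
\<close>

lemma XH_nested:
  assumes \<S>: "conforming_triangulation (mdim P) (mdom P) \<S>" and \<S>': "\<S>' \<in> meshes P \<S>" and v: "v \<in> XH P \<S>"
  shows "v \<in> XH P \<S>'"
proof -
  let ?d = "mdim P"
  have "\<exists>c b. AE x in leb_on ?d (elem_interior ?d T'). v x = c + (\<Sum>i<?d. b i * x i)" if T': "T' \<in> \<S>'" for T'
  proof -
    have "well_tagged ?d T" if "T \<in> \<S>" for T
      using \<S> that by (auto simp: conforming_triangulation_def is_simplex_def well_tagged_def)
    moreover have "(nvb_step ?d)\<^sup>*\<^sup>* \<S> \<S>'" using \<S>' by (simp add: nvb_meshes_def)
    ultimately obtain T where T: "T \<in> \<S>" "elem ?d T' \<subseteq> elem ?d T"
      using nvb_steps_nested[of ?d \<S> \<S>'] T' by blast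
    obtain c b where "AE x in leb_on ?d (elem_interior ?d T). v x = c + (\<Sum>i<?d. b i * x i)"
      using v T(1) unfolding XH_def by blast
    moreover have sets: "elem_interior ?d S \<in> sets (lebn ?d)" for S
      unfolding elem_interior_def by (rule openin_sets_lebn[OF openin_interior_of])
    ultimately have "AE x in lebn ?d. x \<in> elem_interior ?d T \<longrightarrow> v x = c + (\<Sum>i<?d. b i * x i)"
      by (simp add: leb_on_conv_lebn(3))
    moreover have "elem_interior ?d T' \<subseteq> elem_interior ?d T"
      unfolding elem_interior_def by (rule interior_of_mono[OF T(2)])
    ultimately have "AE x in lebn ?d. x \<in> elem_interior ?d T' \<longrightarrow> v x = c + (\<Sum>i<?d. b i * x i)"
      by (auto elim: eventually_mono)
    then show ?thesis using leb_on_conv_lebn(3)[OF sets] by blast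
  qed
  then show ?thesis using v unfolding XH_def by blast
qed

lemma XH_XX: "v \<in> XH P \<S> \<Longrightarrow> v \<in> XX P"
  by (simp add: XH_def)

lemma XH_lincomb:
  assumes mp: "model_problem P \<T>0" and u: "u \<in> XH P \<S>" and v: "v \<in> XH P \<S>"
  shows "(\<lambda>x. s * u x + t * v x) \<in> XH P \<S>"
proof -
  let ?d = "mdim P"
  have "\<exists>c b. AE x in leb_on ?d (elem_interior ?d T). s * u x + t * v x = c + (\<Sum>i<?d. b i * x i)"
    if T: "T \<in> \<S>" for T
  proof -
    obtain c b where 1: "AE x in leb_on ?d (elem_interior ?d T). u x = c + (\<Sum>i<?d. b i * x i)"
      using u T unfolding XH_def by blast
    obtain c' b' where 2: "AE x in leb_on ?d (elem_interior ?d T). v x = c' + (\<Sum>i<?d. b' i * x i)"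
      using v T unfolding XH_def by blast
    have "AE x in leb_on ?d (elem_interior ?d T). s * u x + t * v x =
        (s * c + t * c') + (\<Sum>i<?d. (s * b i + t * b' i) * x i)"
      using 1 2
    proof eventually_elim
      case (elim x)
      have "(\<Sum>i<?d. (s * b i + t * b' i) * x i) = s * (\<Sum>i<?d. b i * x i) + t * (\<Sum>i<?d. b' i * x i)"
        by (simp add: sum_distrib_left sum.distrib[symmetric] algebra_simps)
      then show ?case using elim by (simp add: algebra_simps)
    qed
    then show ?thesis by (intro exI[of _ "s * c + t * c'"] exI[of _ "\<lambda>i. s * b i + t * b' i"])
  qed
  then show ?thesis
    using XX_lincomb[OF mp XH_XX[OF u] XH_XX[OF v]] unfolding XH_def by blast
qed

lemma jump_norm_sq_nonneg: "0 \<le> jump_norm_sq d \<Omega> \<T> T \<sigma>"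
  unfolding jump_norm_sq_def by (intro sum_nonneg Bochner_Integration.integral_nonneg) simp

lemma eta_sq_nonneg: "0 \<le> eta_sq P \<T> T v"
  unfolding eta_sq_def Let_def
  by (intro add_nonneg_nonneg mult_nonneg_nonneg powr_ge_zero jump_norm_sq_nonneg
      Bochner_Integration.integral_nonneg) simp

lemma zeta_sq_nonneg: "0 \<le> zeta_sq P \<T> w T z"
  unfolding zeta_sq_def Let_def
  by (intro add_nonneg_nonneg mult_nonneg_nonneg powr_ge_zero jump_norm_sq_nonneg
      Bochner_Integration.integral_nonneg) simp

lemma eta_nonneg: "0 \<le> eta P \<T> \<U> v"
  by (simp add: eta_def sum_nonneg eta_sq_nonneg)

lemma zeta_nonneg: "0 \<le> zeta P \<T> w \<U> z"
  by (simp add: zeta_def sum_nonneg zeta_sq_nonneg)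

lemma eta_mono: "finite \<V> \<Longrightarrow> \<U> \<subseteq> \<V> \<Longrightarrow> eta P \<T> \<U> v \<le> eta P \<T> \<V> v"
  unfolding eta_def by (intro real_sqrt_le_mono sum_mono2 eta_sq_nonneg)

lemma eta_split:
  assumes "finite \<U>"
  shows "(eta P \<T> \<U> v)\<^sup>2 = (eta P \<T> (\<U> \<inter> \<V>) v)\<^sup>2 + (eta P \<T> (\<U> - \<V>) v)\<^sup>2"
  using sum.Int_Diff[OF assms, of "\<lambda>T. eta_sq P \<T> T v" \<V>]
  by (simp add: eta_def sum_nonneg eta_sq_nonneg)

section \<open>Perturbed contractions converge R-linearly\<close>

text \<open>
  If every tail sum is bounded by \<open>K\<close> times its first term, dropping that term reduces the tail sum by
  the factor \<open>1 - 1 / K\<close>.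
\<close>

lemma tail_sums_imp_geometric:
  fixes g :: "nat \<Rightarrow> real"
  assumes K: "1 < K" and g: "\<And>n. 0 \<le> g n"
    and tail: "\<And>n N. (\<Sum>j=n..<n+N. g j) \<le> K * g n"
  shows "g (m + n) \<le> K * (1 - 1 / K) ^ n * g m"
proof -
  define S where "S = (\<lambda>i. \<Sum>j=m+i..<m+n+1. g j)"
  have step: "S (Suc i) \<le> (1 - 1 / K) * S i" if "i \<le> n" for i
  proof -
    have "S i = g (m + i) + S (Suc i)"
      unfolding S_def using that by (subst sum.atLeast_Suc_lessThan) auto
    moreover have "S i \<le> K * g (m + i)"
      using tail[of "m + i" "n + 1 - i"] that unfolding S_def by simp
    then have "S i / K \<le> g (m + i)" using K by (simp add: field_simps)
    moreover have "(1 - 1 / K) * S i = S i - S i / K" by (simp add: left_diff_distrib)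
    ultimately show ?thesis by linarith
  qed
  have "i \<le> n \<Longrightarrow> S i \<le> (1 - 1 / K) ^ i * S 0" for i
  proof (induction i)
    case (Suc i)
    then have "S (Suc i) \<le> (1 - 1 / K) * S i" by (intro step) simp
    also have "\<dots> \<le> (1 - 1 / K) * ((1 - 1 / K) ^ i * S 0)"
      using Suc K by (intro mult_left_mono) auto
    finally show ?case by simp
  qed simp
  then have "S n \<le> (1 - 1 / K) ^ n * S 0" by simp
  also have "\<dots> \<le> (1 - 1 / K) ^ n * (K * g m)"
    using K tail[of m "n + 1"] by (intro mult_left_mono) (auto simp: S_def)
  finally show ?thesis by (simp add: S_def mult_ac)
qed

text \<open>
  Convexity of the square lets the contraction survive squaring with the same factor \<open>q\<close>, at the price
  of the factor \<open>C\<^sup>2 / (1 - q)\<close> in front of the perturbation; summation absorbs the shifted sum.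
\<close>

lemma perturbed_contraction_tail_sums:
  fixes H d :: "nat \<Rightarrow> real"
  assumes q: "0 < q" "q < 1" and D: "0 \<le> D"
    and H: "\<And>n. 0 \<le> H n" "\<And>n. H (Suc n) \<le> q * H n + C * d n"
    and d: "\<And>n N. (\<Sum>j=n..<n+N. (d j)\<^sup>2) \<le> D * (H n)\<^sup>2"
  shows "(\<Sum>j=n..<n+N. (H j)\<^sup>2) \<le> (1 + C\<^sup>2 / (1 - q) * D) / (1 - q) * (H n)\<^sup>2"
proof -
  define B where "B = C\<^sup>2 / (1 - q)"
  define K where "K = (1 + B * D) / (1 - q)"
  have B: "0 \<le> B" using q by (simp add: B_def)
  have K: "0 \<le> K" using q B D by (simp add: K_def)
  have step: "(H (Suc j))\<^sup>2 \<le> q * (H j)\<^sup>2 + B * (d j)\<^sup>2" for j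
  proof -
    \<comment> \<open>The perturbation becomes one summand of a convex combination with weights q and 1 - q.\<close>
    define c where "c = C * d j / (1 - q)"
    have c: "C * d j = (1 - q) * c" using q by (simp add: c_def)
    have "(H (Suc j))\<^sup>2 \<le> (q * H j + (1 - q) * c)\<^sup>2"
      using H(2)[of j] H(1)[of "Suc j"] unfolding c by (intro power_mono) auto
    also have "\<dots> = q * (H j)\<^sup>2 + (1 - q) * c\<^sup>2 - q * (1 - q) * (H j - c)\<^sup>2"
      by (simp add: power2_eq_square algebra_simps)
    also have "\<dots> \<le> q * (H j)\<^sup>2 + (1 - q) * c\<^sup>2"
      using q by simp
    also have "(1 - q) * c\<^sup>2 = B * (d j)\<^sup>2"
      using q by (simp add: c_def B_def power2_eq_square)
    finally show ?thesis .
  qed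
  have "(\<Sum>j=n..<n+N. (H j)\<^sup>2) \<le> K * (H n)\<^sup>2"
  proof (induction N)
    case 0
    then show ?case using K by simp
  next
    case (Suc N)
    have "(\<Sum>j=n..<n+Suc N. (H j)\<^sup>2) = (H n)\<^sup>2 + (\<Sum>j=n..<n+N. (H (Suc j))\<^sup>2)"
      using sum.shift_bounds_Suc_ivl[of "\<lambda>j. (H j)\<^sup>2" n "n + N"]
      by (simp add: sum.atLeast_Suc_lessThan del: sum.op_ivl_Suc sum.shift_bounds_Suc_ivl)
    also have "(\<Sum>j=n..<n+N. (H (Suc j))\<^sup>2) \<le> (\<Sum>j=n..<n+N. q * (H j)\<^sup>2 + B * (d j)\<^sup>2)"
      by (intro sum_mono step)
    also have "\<dots> = q * (\<Sum>j=n..<n+N. (H j)\<^sup>2) + B * (\<Sum>j=n..<n+N. (d j)\<^sup>2)"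
      by (simp add: sum.distrib sum_distrib_left)
    also have "q * (\<Sum>j=n..<n+N. (H j)\<^sup>2) \<le> q * (K * (H n)\<^sup>2)"
      using Suc q by (intro mult_left_mono) auto
    also have "B * (\<Sum>j=n..<n+N. (d j)\<^sup>2) \<le> B * (D * (H n)\<^sup>2)"
      by (intro mult_left_mono d B)
    also have "(H n)\<^sup>2 + (q * (K * (H n)\<^sup>2) + B * (D * (H n)\<^sup>2)) = ((1 + B * D) + q * K) * (H n)\<^sup>2"
      by (simp add: algebra_simps)
    also have "(1 + B * D) + q * K = K"
      using q by (simp add: K_def field_simps)
    finally show ?case by simp
  qed
  then show ?thesis by (simp add: K_def B_def)
qed

text \<open>
  The rate \<open>r\<close> and the constant \<open>K\<close> are obtained before the sequences, because they must be uniform over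
  all runs of the algorithm on all model problems.
\<close>

lemma perturbed_contraction_R_linear:
  fixes q C D :: real
  assumes q: "0 < q" "q < 1" and D: "0 \<le> D"
  obtains r K where "0 < r" "r < 1" "0 < K"
    "\<And>H d m n. (\<And>n. 0 \<le> H n) \<Longrightarrow> (\<And>n. H (Suc n) \<le> q * H n + C * d n) \<Longrightarrow>
      (\<And>n N. (\<Sum>j=n..<n+N. (d j)\<^sup>2) \<le> D * (H n)\<^sup>2) \<Longrightarrow> H (m + n) \<le> K * r ^ n * H m"
proof -
  define K where "K = (1 + C\<^sup>2 / (1 - q) * D) / (1 - q)"
  have "0 \<le> C\<^sup>2 / (1 - q) * D" using q D by simp
  then have "1 - q < 1 + C\<^sup>2 / (1 - q) * D" using q by linarith
  then have K: "1 < K" using q by (simp add: K_def)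
  show thesis
  proof (rule that[of "sqrt (1 - 1 / K)" "sqrt K"])
    fix H d :: "nat \<Rightarrow> real" and m n
    assume H: "\<And>n. 0 \<le> H n" "\<And>n. H (Suc n) \<le> q * H n + C * d n"
      "\<And>n N. (\<Sum>j=n..<n+N. (d j)\<^sup>2) \<le> D * (H n)\<^sup>2"
    have "(H (m + n))\<^sup>2 \<le> K * (1 - 1 / K) ^ n * (H m)\<^sup>2"
      using perturbed_contraction_tail_sums[OF q D H, folded K_def]
      by (intro tail_sums_imp_geometric[OF K, of "\<lambda>n. (H n)\<^sup>2"]) auto
    also have "\<dots> = (sqrt K * sqrt (1 - 1 / K) ^ n * H m)\<^sup>2"
    proof -
      have "(sqrt (1 - 1 / K) ^ n)\<^sup>2 = ((sqrt (1 - 1 / K))\<^sup>2) ^ n"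
        by (simp only: power_mult[symmetric] mult.commute)
      then show ?thesis using K by (simp add: power_mult_distrib)
    qed
    finally show "H (m + n) \<le> sqrt K * sqrt (1 - 1 / K) ^ n * H m"
      by (rule power2_le_imp_le) (use K H(1) in simp)
  qed (use K in auto)
qed

section \<open>Counting solver steps\<close>

lemma alg_pos_snd_pos: "1 \<le> snd (alg_pos stop n)"
  by (induction n) (auto split: prod.split)

lemma alg_pos_strict_lex:
  assumes "m < n"
  shows "fst (alg_pos stop m) < fst (alg_pos stop n) \<or>
    fst (alg_pos stop m) = fst (alg_pos stop n) \<and> snd (alg_pos stop m) < snd (alg_pos stop n)"
  using assms
proof (induction n)
  case (Suc n)
  have "fst (alg_pos stop n) < fst (alg_pos stop (Suc n)) \<or>
    fst (alg_pos stop n) = fst (alg_pos stop (Suc n)) \<and> snd (alg_pos stop n) < snd (alg_pos stop (Suc n))"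
    by (auto split: prod.split)
  then show ?case using Suc by (cases "m = n") auto
qed simp

lemma alg_pos_inj: "alg_pos stop m = alg_pos stop n \<Longrightarrow> m = n"
  using alg_pos_strict_lex[of m n stop] alg_pos_strict_lex[of n m stop]
  by (cases m n rule: linorder_cases) auto

text \<open>
  The algorithm never visits an index twice, so the counting function of the index set is the number
  of the solver step.
\<close>

lemma index_count_alg_pos: "index_count stop (alg_pos stop n) = n"
proof -
  have "{p \<in> index_set stop. computed_before stop p (alg_pos stop n)} = alg_pos stop ` {..<n}"
    unfolding index_set_def computed_before_def using alg_pos_inj[of stop] by blast
  moreover have "inj_on (alg_pos stop) {..<n}"
    using alg_pos_inj[of stop] by (intro inj_onI) blast
  ultimately show ?thesis by (simp add: index_count_def card_image)
qed

section \<open>Estimates for one solver step\<close>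

lemma zero_in_XH:
  assumes "model_problem P \<T>0" "u \<in> XH P \<S>"
  shows "(\<lambda>x. 0) \<in> XH P \<S>"
  using XH_lincomb[OF assms(1,2,2), of 0 0] by simp

text \<open>
  The discrete solution is the fixed point of the solver, which turns the contraction property into
  convergence of the solver to it.
\<close>

lemma zarantonello_at_solution:
  assumes mp: "model_problem P \<T>0" and u: "discrete_solution P \<S> u"
  shows "zarantonello P \<S> u (\<lambda>x. 0)"
proof -
  have uX: "u \<in> XH P \<S>" using u by (simp add: discrete_solution_def)
  have "a_form P (\<lambda>x. 0) v = 0" if "v \<in> XH P \<S>" for v
  proof -
    have "a_form P (\<lambda>x. 0 * u x + 0 * u x) v = 0 * a_form P u v + 0 * a_form P u v"
      using mp XH_XX[OF uX] XH_XX[OF that] unfolding model_problem_def a_scalar_product_def by blast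
    then show ?thesis by simp
  qed
  then show ?thesis
    using zero_in_XH[OF mp uX] u by (simp add: zarantonello_def discrete_solution_def)
qed

lemma solver_contraction:
  assumes mp: "model_problem P \<T>0" and ctr: "zarantonello_contraction P \<T>0 \<delta> q"
    and S: "\<S> \<in> meshes P \<T>0" and u: "discrete_solution P \<S> u"
    and w: "w \<in> XH P \<S>" and y: "zarantonello P \<S> w y"
  shows "enorm P (\<lambda>x. u x - (w x + \<delta> * y x)) \<le> q * enorm P (\<lambda>x. u x - w x)"
proof -
  have "u \<in> XH P \<S>" using u by (simp add: discrete_solution_def)
  then have "enorm P (\<lambda>x. (u x + \<delta> * 0) - (w x + \<delta> * y x)) \<le> q * enorm P (\<lambda>x. u x - w x)"
    using ctr S w y zarantonello_at_solution[OF mp u] unfolding zarantonello_contraction_def by blast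
  then show ?thesis by simp
qed

lemma update_norm_le_error:
  assumes mp: "model_problem P \<T>0" and ctr: "zarantonello_contraction P \<T>0 \<delta> q"
    and S: "\<S> \<in> meshes P \<T>0" and u: "discrete_solution P \<S> u"
    and w: "w \<in> XH P \<S>" and y: "zarantonello P \<S> w y" and \<delta>: "0 < \<delta>" and q: "q \<le> 1"
  shows "enorm P y \<le> 2 / \<delta> * enorm P (\<lambda>x. u x - w x)"
proof -
  have yX: "y \<in> XH P \<S>" using y by (simp add: zarantonello_def)
  have uX: "u \<in> XH P \<S>" using u by (simp add: discrete_solution_def)
  have w': "(\<lambda>x. w x + \<delta> * y x) \<in> XH P \<S>"
    using XH_lincomb[OF mp w yX, of 1 \<delta>] by simp
  note X = XH_XX[OF yX] XH_XX[OF uX] XH_XX[OF w] XH_XX[OF w']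
  have "\<delta> * enorm P y = enorm P (\<lambda>x. (w x + \<delta> * y x) - w x)"
    using enorm_scale[OF mp X(1), of \<delta>] \<delta> by simp
  also have "\<dots> \<le> enorm P (\<lambda>x. (w x + \<delta> * y x) - u x) + enorm P (\<lambda>x. u x - w x)"
    by (rule enorm_triangle_diff[OF mp X(4) X(2) X(3)])
  also have "enorm P (\<lambda>x. (w x + \<delta> * y x) - u x) = enorm P (\<lambda>x. u x - (w x + \<delta> * y x))"
    by (rule enorm_minus_commute[OF mp X(4) X(2)])
  also have "\<dots> \<le> q * enorm P (\<lambda>x. u x - w x)"
    by (rule solver_contraction[OF mp ctr S u w y])
  also have "\<dots> \<le> 1 * enorm P (\<lambda>x. u x - w x)"
    using q enorm_nonneg[OF mp XX_lincomb[OF mp X(2) X(3), of 1 "-1"]]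
    by (intro mult_right_mono) simp_all
  finally show ?thesis using \<delta> by (simp add: field_simps)
qed

text \<open>
  Both the distance of \<open>\<zeta>\<close> from the residual estimator of the updated iterate and the distance of that
  iterate from the discrete solution are of the order of the algebraic error.  The estimate also holds
  on subsets of the mesh, which transfers the marking criterion.
\<close>

lemma zeta_near_eta_of_solution:
  assumes mp: "model_problem P \<T>0" and ctr: "zarantonello_contraction P \<T>0 \<delta> q"
    and stab: "stability P \<T>0 Cstab" and eqv: "estimator_equivalence P \<T>0 \<delta> Ceqv"
    and S: "\<S> \<in> meshes P \<T>0" and u: "discrete_solution P \<S> u"
    and w: "w \<in> XH P \<S>" and y: "zarantonello P \<S> w y"
    and c: "0 < \<delta>" "q \<le> 1" "0 \<le> Cstab" "0 \<le> Ceqv" and U: "\<U> \<subseteq> \<S>"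
  shows "\<bar>zeta P \<S> w \<U> y - eta P \<S> \<U> u\<bar> \<le>
    ((1 + \<delta>) * Ceqv * (2 / \<delta>) + Cstab) * enorm P (\<lambda>x. u x - w x)"
proof -
  let ?a = "enorm P (\<lambda>x. u x - w x)" and ?w' = "\<lambda>x. w x + \<delta> * y x"
  have yX: "y \<in> XH P \<S>" using y by (simp add: zarantonello_def)
  have uX: "u \<in> XH P \<S>" using u by (simp add: discrete_solution_def)
  have w': "?w' \<in> XH P \<S>"
    using XH_lincomb[OF mp w yX, of 1 \<delta>] by simp
  have a0: "0 \<le> ?a"
    using enorm_nonneg[OF mp XX_lincomb[OF mp XH_XX[OF uX] XH_XX[OF w], of 1 "-1"]] by simp
  have "\<bar>zeta P \<S> w \<U> y - eta P \<S> \<U> ?w'\<bar> \<le> (1 + \<delta>) * Ceqv * enorm P y"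
    using eqv S U yX w unfolding estimator_equivalence_def by blast
  also have "\<dots> \<le> (1 + \<delta>) * Ceqv * (2 / \<delta> * ?a)"
    using c by (intro mult_left_mono update_norm_le_error[OF mp ctr S u w y]) auto
  finally have 1: "\<bar>zeta P \<S> w \<U> y - eta P \<S> \<U> ?w'\<bar> \<le> (1 + \<delta>) * Ceqv * (2 / \<delta>) * ?a"
    by (simp add: mult.assoc)
  have "\<S> \<in> meshes P \<S>" by (rule mesh_refl[OF mesh_conforming[OF S]])
  then have "\<bar>eta P \<S> \<U> u - eta P \<S> \<U> ?w'\<bar> \<le> Cstab * enorm P (\<lambda>x. u x - ?w' x)"
    using stab S U uX w' unfolding stability_def by blast
  also have "\<dots> \<le> Cstab * ?a"
  proof (rule mult_left_mono[OF _ c(3)])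
    have "enorm P (\<lambda>x. u x - ?w' x) \<le> q * ?a"
      by (rule solver_contraction[OF mp ctr S u w y])
    also have "\<dots> \<le> 1 * ?a" using c(2) a0 by (rule mult_right_mono)
    finally show "enorm P (\<lambda>x. u x - ?w' x) \<le> ?a" by simp
  qed
  finally have 2: "\<bar>eta P \<S> \<U> u - eta P \<S> \<U> ?w'\<bar> \<le> Cstab * ?a" .
  have "\<bar>zeta P \<S> w \<U> y - eta P \<S> \<U> u\<bar> \<le> (1 + \<delta>) * Ceqv * (2 / \<delta>) * ?a + Cstab * ?a"
    using 1 2 by linarith
  then show ?thesis by (simp only: distrib_right)
qed

text \<open>
  Estimator reduction when the marking criterion is violated by \<open>b\<close>: here \<open>x\<close> and \<open>x'\<close> are the estimators
  before and after refinement and \<open>y\<close> is the contribution of the marked elements.  Since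
  \<open>(y + b)\<^sup>2 \<le> 2 * y\<^sup>2 + 2 * b\<^sup>2\<close>, half of the bulk parameter survives.
\<close>

lemma inexact_marking_reduction:
  fixes x x' y b \<rho> \<theta> :: real
  assumes "x'\<^sup>2 \<le> x\<^sup>2 - \<rho> * y\<^sup>2" "sqrt \<theta> * x - b \<le> y"
    and "0 \<le> x" "0 \<le> y" "0 \<le> b" "0 < \<rho>" "\<rho> \<le> 1" "0 < \<theta>" "\<theta> \<le> 1"
  shows "x' \<le> sqrt (1 - \<rho> * \<theta> / 2) * x + b"
proof (rule power2_le_imp_le)
  have r: "\<rho> * \<theta> \<le> 1" using assms by (simp add: mult_le_one)
  have "(sqrt \<theta> * x)\<^sup>2 \<le> (y + b)\<^sup>2"
    using assms by (intro power_mono) auto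
  also have "\<dots> \<le> 2 * y\<^sup>2 + 2 * b\<^sup>2"
    using sq_lincomb_le[of 1 y 1 b] by simp
  finally have "\<theta> * x\<^sup>2 / 2 - b\<^sup>2 \<le> y\<^sup>2"
    using assms by (simp add: power_mult_distrib)
  then have "\<rho> * (\<theta> * x\<^sup>2 / 2 - b\<^sup>2) \<le> \<rho> * y\<^sup>2"
    using assms by (intro mult_left_mono) auto
  then have "x'\<^sup>2 \<le> (1 - \<rho> * \<theta> / 2) * x\<^sup>2 + \<rho> * b\<^sup>2"
    using assms(1) by (simp add: algebra_simps)
  also have "\<rho> * b\<^sup>2 \<le> b\<^sup>2"
    using assms by (simp add: mult_left_le_one_le)
  also have "(1 - \<rho> * \<theta> / 2) * x\<^sup>2 + b\<^sup>2 \<le> (sqrt (1 - \<rho> * \<theta> / 2) * x + b)\<^sup>2"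
    using r assms by (simp add: power2_sum power_mult_distrib)
  finally show "x'\<^sup>2 \<le> (sqrt (1 - \<rho> * \<theta> / 2) * x + b)\<^sup>2" by simp
  show "0 \<le> sqrt (1 - \<rho> * \<theta> / 2) * x + b"
    using r assms by simp
qed

text \<open>
  With the function fixed, stability shows that the contributions of the common elements do not change,
  and reduction applies to the others, among which are all marked elements.
\<close>

lemma estimator_reduction:
  assumes mp: "model_problem P \<T>0" and stab: "stability P \<T>0 Cstab" and red: "reduction P \<T>0 qred"
    and S: "\<S> \<in> meshes P \<T>0" and S': "\<S>' \<in> meshes P \<S>" and v: "v \<in> XH P \<S>"
    and M: "\<M> \<subseteq> \<S>" "\<M> \<inter> \<S>' = {}" and q: "0 < qred" "qred < 1"
  shows "(eta P \<S>' \<S>' v)\<^sup>2 \<le> (eta P \<S> \<S> v)\<^sup>2 - (1 - qred\<^sup>2) * (eta P \<S> \<M> v)\<^sup>2"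
proof -
  have v': "v \<in> XH P \<S>'" by (rule XH_nested[OF mesh_conforming[OF S] S' v])
  have fin: "finite \<S>" "finite \<S>'" using mesh_finite S S' by blast+
  have "\<bar>eta P \<S>' (\<S>' \<inter> \<S>) v - eta P \<S> (\<S>' \<inter> \<S>) v\<bar> \<le> Cstab * enorm P (\<lambda>x. v x - v x)"
    using stab S S' v v' unfolding stability_def by blast
  then have eq: "eta P \<S>' (\<S>' \<inter> \<S>) v = eta P \<S> (\<S> \<inter> \<S>') v"
    using enorm_zero[OF mp XH_XX[OF v]] by (simp add: Int_commute)
  have "eta P \<S>' (\<S>' - \<S>) v \<le> qred * eta P \<S> (\<S> - \<S>') v"
    using red S S' v unfolding reduction_def by blast
  then have "(eta P \<S>' (\<S>' - \<S>) v)\<^sup>2 \<le> (qred * eta P \<S> (\<S> - \<S>') v)\<^sup>2"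
    by (rule power_mono[OF _ eta_nonneg])
  then have "(eta P \<S>' \<S>' v)\<^sup>2 \<le> (eta P \<S> (\<S> \<inter> \<S>') v)\<^sup>2 + qred\<^sup>2 * (eta P \<S> (\<S> - \<S>') v)\<^sup>2"
    using eta_split[OF fin(2), of P \<S>' v \<S>] unfolding eq by (simp add: power_mult_distrib)
  also have "\<dots> = (eta P \<S> \<S> v)\<^sup>2 - (1 - qred\<^sup>2) * (eta P \<S> (\<S> - \<S>') v)\<^sup>2"
    using eta_split[OF fin(1), of P \<S> v \<S>'] by (simp add: algebra_simps)
  also have "\<dots> \<le> (eta P \<S> \<S> v)\<^sup>2 - (1 - qred\<^sup>2) * (eta P \<S> \<M> v)\<^sup>2"
  proof -
    have "eta P \<S> \<M> v \<le> eta P \<S> (\<S> - \<S>') v"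
      using M fin by (intro eta_mono) auto
    then have "(eta P \<S> \<M> v)\<^sup>2 \<le> (eta P \<S> (\<S> - \<S>') v)\<^sup>2"
      by (rule power_mono[OF _ eta_nonneg])
    moreover have "qred\<^sup>2 \<le> 1" using q by (simp add: power_le_one)
    ultimately show ?thesis by (simp add: mult_left_mono)
  qed
  finally show ?thesis .
qed

text \<open>
  Nestedness makes each discrete solution an admissible competitor on all later meshes, so that the
  lower energy bound can be summed and telescopes.  The upper bound compares the first and the last
  discrete solution, whose distance is controlled by the estimator on the first mesh through discrete
  reliability.
\<close>

lemma quasi_orthogonality:
  assumes mp: "model_problem P \<T>0" and ml: "monotone_lipschitz P \<alpha> L"
    and sol: "\<forall>\<S>\<in>meshes P \<T>0. discrete_solution P \<S> (ud \<S>)"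
    and drel: "discrete_reliability P \<T>0 ud Cdrel" and c: "0 < \<alpha>" "0 \<le> L" "0 \<le> Cdrel"
    and S: "\<And>n. S n \<in> meshes P \<T>0" "\<And>n. S (Suc n) \<in> meshes P (S n)"
  shows "(\<Sum>j=n..<n+N. (enorm P (\<lambda>x. ud (S (Suc j)) x - ud (S j) x))\<^sup>2) \<le>
    4 * L / \<alpha> * Cdrel\<^sup>2 * (eta P (S n) (S n) (ud (S n)))\<^sup>2"
proof -
  have nest: "S (n + k) \<in> meshes P (S n)" for n k
  proof (induction k)
    case 0
    then show ?case using mesh_refl[OF mesh_conforming[OF S(1)]] by simp
  next
    case (Suc k)
    then show ?case using mesh_trans S(2) by fastforce
  qed
  have uX: "ud (S n) \<in> XH P (S n)" for n
    using sol S(1) by (simp add: discrete_solution_def)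
  note uXX = XH_XX[OF uX]
  have gal: "A_op P (ud (S (n + k))) (\<lambda>x. ud (S n) x - ud (S (n + k)) x) =
      F_fun P (\<lambda>x. ud (S n) x - ud (S (n + k)) x)" for n k
  proof -
    have "ud (S n) \<in> XH P (S (n + k))"
      by (rule XH_nested[OF mesh_conforming[OF S(1)] nest uX])
    then have "(\<lambda>x. ud (S n) x - ud (S (n + k)) x) \<in> XH P (S (n + k))"
      using XH_lincomb[OF mp _ uX[of "n + k"], of "ud (S n)" 1 "-1"] by simp
    then show ?thesis using sol S(1) unfolding discrete_solution_def by blast
  qed
  have low: "\<alpha> / 4 * (enorm P (\<lambda>x. ud (S (Suc j)) x - ud (S j) x))\<^sup>2 \<le>
      energy P (ud (S j)) - energy P (ud (S (Suc j)))" for j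
    using energy_lower_bound[OF mp ml uXX uXX gal[of j 1]] enorm_minus_commute[OF mp uXX uXX, of "Suc j" j]
    by simp
  have "\<alpha> / 4 * (\<Sum>j=n..<n+N. (enorm P (\<lambda>x. ud (S (Suc j)) x - ud (S j) x))\<^sup>2) \<le>
      (\<Sum>j=n..<n+N. energy P (ud (S j)) - energy P (ud (S (Suc j))))"
    unfolding sum_distrib_left by (intro sum_mono low)
  also have "\<dots> = energy P (ud (S n)) - energy P (ud (S (n + N)))"
    by (induction N) simp_all
  also have "\<dots> \<le> L * (enorm P (\<lambda>x. ud (S n) x - ud (S (n + N)) x))\<^sup>2"
    by (rule energy_upper_bound[OF mp ml uXX uXX gal])
  also have "enorm P (\<lambda>x. ud (S n) x - ud (S (n + N)) x) = enorm P (\<lambda>x. ud (S (n + N)) x - ud (S n) x)"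
    by (rule enorm_minus_commute[OF mp uXX uXX])
  also have "L * (enorm P (\<lambda>x. ud (S (n + N)) x - ud (S n) x))\<^sup>2 \<le>
      L * (Cdrel * eta P (S n) (S n) (ud (S n)))\<^sup>2"
  proof (intro mult_left_mono power_mono c)
    have "enorm P (\<lambda>x. ud (S (n + N)) x - ud (S n) x) \<le> Cdrel * eta P (S n) (S n - S (n + N)) (ud (S n))"
      using drel S(1) nest unfolding discrete_reliability_def by blast
    also have "\<dots> \<le> Cdrel * eta P (S n) (S n) (ud (S n))"
      using mesh_finite[OF S(1)] c by (intro mult_left_mono eta_mono) auto
    finally show "enorm P (\<lambda>x. ud (S (n + N)) x - ud (S n) x) \<le> Cdrel * eta P (S n) (S n) (ud (S n))" .
    show "0 \<le> enorm P (\<lambda>x. ud (S (n + N)) x - ud (S n) x)"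
      using enorm_nonneg[OF mp XX_lincomb[OF mp uXX uXX, of 1 "n + N" "-1" n]] by simp
  qed
  finally have "\<alpha> / 4 * (\<Sum>j=n..<n+N. (enorm P (\<lambda>x. ud (S (Suc j)) x - ud (S j) x))\<^sup>2) \<le>
      L * (Cdrel * eta P (S n) (S n) (ud (S n)))\<^sup>2" .
  then show ?thesis using c(1) by (simp add: field_simps power_mult_distrib)
qed

section \<open>The adaptive algorithm\<close>

text \<open>
  The run of the algorithm read as a single sequence of solver steps.  Keeping the mesh is a trivial
  refinement, so the relations between consecutive steps need no distinction between continuing the
  solver and changing the level; only the final alternative records which test was decisive.
\<close>

lemma adaptive_run_steps:
  fixes P :: model and lam :: real and \<T> :: "nat \<Rightarrow> tsimplex set" and u z :: "nat \<Rightarrow> nat \<Rightarrow> sfun"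
  defines "pos \<equiv> alg_pos (alg_stop P lam \<T> u z)"
  defines "S \<equiv> \<lambda>n. \<T> (fst (pos n))" and "w \<equiv> \<lambda>n. u (fst (pos n)) (snd (pos n) - 1)"
    and "y \<equiv> \<lambda>n. z (fst (pos n)) (snd (pos n))"
  assumes mp: "model_problem P \<T>0" and run: "adaptive_run P \<T>0 \<theta> lam Cmark \<delta> \<T> \<M> u z"
  shows "S n \<in> meshes P \<T>0" "w n \<in> XH P (S n)" "zarantonello P (S n) (w n) (y n)"
    "S (Suc n) \<in> meshes P (S n)" "w (Suc n) = (\<lambda>x. w n x + \<delta> * y n x)"
    "(S (Suc n) = S n \<and> lam * zeta P (S n) (w n) (S n) (y n) < enorm P (y n)) \<or>
      (\<exists>N\<in>doerfler P \<theta> (S n) (w n) (y n). N \<inter> S (Suc n) = {})"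
proof -
  let ?stop = "alg_stop P lam \<T> u z"
  have conf0: "conforming_triangulation (mdim P) (mdom P) \<T>0"
    using mp by (simp add: model_problem_def)
  have step: "zarantonello P (S n) (w n) (y n) \<and>
      (S n \<in> meshes P \<T>0 \<longrightarrow> S (Suc n) \<in> meshes P (S n)) \<and>
      w (Suc n) = (\<lambda>x. w n x + \<delta> * y n x) \<and>
      ((S (Suc n) = S n \<and> lam * zeta P (S n) (w n) (S n) (y n) < enorm P (y n)) \<or>
      (\<exists>N\<in>doerfler P \<theta> (S n) (w n) (y n). N \<inter> S (Suc n) = {}))" for n
  proof -
    obtain l k where lk: "pos n = (l, k)" by (cases "pos n")
    have k: "1 \<le> k" using alg_pos_snd_pos[of ?stop n] lk by (simp add: pos_def)
    have "(l, k) \<in> index_set ?stop"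
      unfolding index_set_def using lk by (metis pos_def rangeI)
    then have R: "zarantonello P (\<T> l) (u l (k - 1)) (z l k)"
      "u l k = (\<lambda>x. u l (k - 1) x + \<delta> * z l k x)"
      "?stop l k \<Longrightarrow> \<M> l \<in> doerfler P \<theta> (\<T> l) (u l (k - 1)) (z l k) \<and>
          is_refine (mdim P) (mdom P) (\<T> l) (\<M> l) (\<T> (Suc l)) \<and> u (Suc l) 0 = u l k"
      using run unfolding adaptive_run_def by blast+
    have n: "S n = \<T> l" "w n = u l (k - 1)" "y n = z l k"
      by (simp_all add: S_def w_def y_def lk)
    have pos_next: "pos (Suc n) = (if ?stop l k then (Suc l, 1) else (l, Suc k))"
      using lk by (simp add: pos_def)
    show ?thesis
    proof (cases "?stop l k")
      case True
      have n': "S (Suc n) = \<T> (Suc l)" "w (Suc n) = u (Suc l) 0"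
        using True by (simp_all add: S_def w_def pos_next)
      have "\<T> (Suc l) \<in> meshes P (\<T> l)" "\<M> l \<inter> \<T> (Suc l) = {}"
        using R(3)[OF True] by (simp_all add: is_refine_def)
      then show ?thesis
        unfolding n n' using R(1,2) R(3)[OF True] by auto
    next
      case False
      have n': "S (Suc n) = \<T> l" "w (Suc n) = u l k"
        using False by (simp_all add: S_def w_def pos_next)
      have "\<T> l \<in> meshes P (\<T> l)" if "\<T> l \<in> meshes P \<T>0"
        by (rule mesh_refl[OF mesh_conforming[OF that]])
      moreover have "lam * zeta P (\<T> l) (u l (k - 1)) (\<T> l) (z l k) < enorm P (z l k)"
        using False by (simp add: alg_stop_def)
      ultimately show ?thesis
        unfolding n n' using R(1,2) by auto
    qed
  qed
  have mesh: "S n \<in> meshes P \<T>0 \<and> w n \<in> XH P (S n)" for n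
  proof (induction n)
    case 0
    then show ?case
      using run mesh_refl[OF conf0] by (simp add: S_def w_def pos_def adaptive_run_def)
  next
    case (Suc n)
    have S': "S (Suc n) \<in> meshes P (S n)" using step Suc by blast
    have "y n \<in> XH P (S n)" using step[of n] by (simp add: zarantonello_def)
    then have "(\<lambda>x. w n x + \<delta> * y n x) \<in> XH P (S n)"
      using XH_lincomb[OF mp, of "w n" "S n" "y n" 1 \<delta>] Suc by simp
    then have "w (Suc n) \<in> XH P (S n)" using step by simp
    then have "w (Suc n) \<in> XH P (S (Suc n))"
      using XH_nested[OF mesh_conforming S'] Suc by blast
    then show ?case using mesh_trans S' Suc by blast
  qed
  show "S n \<in> meshes P \<T>0" "w n \<in> XH P (S n)" "zarantonello P (S n) (w n) (y n)"
    "S (Suc n) \<in> meshes P (S n)" "w (Suc n) = (\<lambda>x. w n x + \<delta> * y n x)"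
    "(S (Suc n) = S n \<and> lam * zeta P (S n) (w n) (S n) (y n) < enorm P (y n)) \<or>
      (\<exists>N\<in>doerfler P \<theta> (S n) (w n) (y n). N \<inter> S (Suc n) = {})"
    using mesh step by blast+
qed

lemma error_recursion:
  assumes mp: "model_problem P \<T>0" and ctr: "zarantonello_contraction P \<T>0 \<delta> q"
    and S: "\<S> \<in> meshes P \<T>0" and S': "\<S>' \<in> meshes P \<S>"
    and u: "discrete_solution P \<S> v" and u': "discrete_solution P \<S>' v'"
    and w: "w \<in> XH P \<S>" and y: "zarantonello P \<S> w y"
  shows "enorm P (\<lambda>x. v' x - (w x + \<delta> * y x)) \<le>
    q * enorm P (\<lambda>x. v x - w x) + enorm P (\<lambda>x. v' x - v x)"
proof -
  have yX: "y \<in> XH P \<S>" using y by (simp add: zarantonello_def)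
  have X: "v \<in> XX P" "v' \<in> XX P" using u u' by (auto simp: discrete_solution_def XH_XX)
  have "(\<lambda>x. w x + \<delta> * y x) \<in> XX P"
    using XH_XX[OF XH_lincomb[OF mp w yX, of 1 \<delta>]] by simp
  then have "enorm P (\<lambda>x. v' x - (w x + \<delta> * y x)) \<le>
      enorm P (\<lambda>x. v' x - v x) + enorm P (\<lambda>x. v x - (w x + \<delta> * y x))"
    by (rule enorm_triangle_diff[OF mp X(2,1)])
  then show ?thesis using solver_contraction[OF mp ctr S u w y] by linarith
qed

text \<open>
  The two alternatives are the continuation of the solver and the refinement of the mesh.  In the first
  one the failed stopping test bounds the whole estimator by the algebraic error; in the second one the
  marking criterion is passed on from \<open>\<zeta>\<close> to the residual estimator of the discrete solution.
\<close>

lemma estimator_recursion: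
  fixes \<theta> lam \<delta> q Ceqv Cstab qred :: real
  defines "c \<equiv> (1 + \<delta>) * Ceqv * (2 / \<delta>) + Cstab"
  assumes mp: "model_problem P \<T>0" and ctr: "zarantonello_contraction P \<T>0 \<delta> q"
    and stab: "stability P \<T>0 Cstab" and red: "reduction P \<T>0 qred"
    and eqv: "estimator_equivalence P \<T>0 \<delta> Ceqv"
    and S: "\<S> \<in> meshes P \<T>0" and S': "\<S>' \<in> meshes P \<S>"
    and u: "discrete_solution P \<S> v" and u': "discrete_solution P \<S>' v'"
    and w: "w \<in> XH P \<S>" and y: "zarantonello P \<S> w y"
    and alt: "(\<S>' = \<S> \<and> v' = v \<and> lam * zeta P \<S> w \<S> y < enorm P y) \<or>
      (\<exists>N\<in>doerfler P \<theta> \<S> w y. N \<inter> \<S>' = {})"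
    and pos: "0 < \<theta>" "\<theta> \<le> 1" "0 < lam" "0 < \<delta>" "q \<le> 1" "0 < Cstab" "0 < Ceqv" "0 < qred" "qred < 1"
  shows "eta P \<S>' \<S>' v' \<le> sqrt (1 - (1 - qred\<^sup>2) * \<theta> / 2) * eta P \<S> \<S> v +
    (2 * c + 2 / (\<delta> * lam)) * enorm P (\<lambda>x. v x - w x) + Cstab * enorm P (\<lambda>x. v' x - v x)"
proof -
  let ?a = "enorm P (\<lambda>x. v x - w x)" and ?q = "sqrt (1 - (1 - qred\<^sup>2) * \<theta> / 2)"
  have vX: "v \<in> XH P \<S>" and v'X: "v' \<in> XH P \<S>'"
    using u u' by (simp_all add: discrete_solution_def)
  have a: "0 \<le> ?a"
    using enorm_nonneg[OF mp XX_lincomb[OF mp XH_XX[OF vX] XH_XX[OF w], of 1 "-1"]] by simp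
  have d: "0 \<le> enorm P (\<lambda>x. v' x - v x)"
    using enorm_nonneg[OF mp XX_lincomb[OF mp XH_XX[OF v'X] XH_XX[OF vX], of 1 "-1"]] by simp
  have c0: "0 \<le> c" using pos by (simp add: c_def)
  have \<rho>: "0 < 1 - qred\<^sup>2" "1 - qred\<^sup>2 \<le> 1"
    using pos by (simp_all add: power_less_one_iff)
  have cmp: "\<bar>zeta P \<S> w \<U> y - eta P \<S> \<U> v\<bar> \<le> c * ?a" if "\<U> \<subseteq> \<S>" for \<U>
    unfolding c_def using pos by (intro zeta_near_eta_of_solution[OF mp ctr stab eqv S u w y _ _ _ _ that]) auto
  from alt show ?thesis
  proof
    assume A: "\<S>' = \<S> \<and> v' = v \<and> lam * zeta P \<S> w \<S> y < enorm P y"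
    have "lam * zeta P \<S> w \<S> y \<le> 2 / \<delta> * ?a"
      using A update_norm_le_error[OF mp ctr S u w y] pos by force
    then have "zeta P \<S> w \<S> y \<le> 2 / (\<delta> * lam) * ?a"
      using pos by (simp add: field_simps)
    then have "eta P \<S> \<S> v \<le> (c + 2 / (\<delta> * lam)) * ?a"
      using cmp[OF order_refl] by (simp add: distrib_right)
    also have "\<dots> \<le> (2 * c + 2 / (\<delta> * lam)) * ?a"
      using c0 a by (intro mult_right_mono) auto
    finally have "eta P \<S> \<S> v \<le> (2 * c + 2 / (\<delta> * lam)) * ?a" .
    moreover have "0 \<le> ?q * eta P \<S> \<S> v"
      using \<rho> pos eta_nonneg[of P \<S> \<S> v] mult_le_one[of "1 - qred\<^sup>2" \<theta>]
      by (intro mult_nonneg_nonneg) auto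
    moreover have "0 \<le> Cstab * enorm P (\<lambda>x. v' x - v x)"
      using d pos by simp
    ultimately show ?thesis using A by simp
  next
    assume "\<exists>N\<in>doerfler P \<theta> \<S> w y. N \<inter> \<S>' = {}"
    then obtain N where N: "N \<subseteq> \<S>" "\<theta> * (zeta P \<S> w \<S> y)\<^sup>2 \<le> (zeta P \<S> w N y)\<^sup>2" "N \<inter> \<S>' = {}"
      by (auto simp: doerfler_def)
    have "(sqrt \<theta> * zeta P \<S> w \<S> y)\<^sup>2 \<le> (zeta P \<S> w N y)\<^sup>2"
      using N(2) pos by (simp add: power_mult_distrib)
    then have mark: "sqrt \<theta> * zeta P \<S> w \<S> y \<le> zeta P \<S> w N y"
      by (rule power2_le_imp_le[OF _ zeta_nonneg])
    have "eta P \<S> \<S> v - c * ?a \<le> zeta P \<S> w \<S> y"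
      using cmp[OF order_refl] by linarith
    then have "sqrt \<theta> * (eta P \<S> \<S> v - c * ?a) \<le> sqrt \<theta> * zeta P \<S> w \<S> y"
      using pos by (intro mult_left_mono) auto
    moreover have "sqrt \<theta> * (c * ?a) \<le> 1 * (c * ?a)"
      using pos c0 a by (intro mult_right_mono mult_nonneg_nonneg) auto
    ultimately have "sqrt \<theta> * eta P \<S> \<S> v - 2 * c * ?a \<le> eta P \<S> N v"
      using mark cmp[OF N(1)] by (simp add: right_diff_distrib)
    then have 1: "eta P \<S>' \<S>' v \<le> ?q * eta P \<S> \<S> v + 2 * c * ?a"
      using \<rho> pos c0 a
      by (intro inexact_marking_reduction[OF estimator_reduction[OF mp stab red S S' vX N(1,3)]])
        (auto simp: eta_nonneg)
    have "\<S>' \<in> meshes P \<T>0" by (rule mesh_trans[OF S S'])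
    moreover have "\<S>' \<in> meshes P \<S>'" by (rule mesh_refl[OF mesh_conforming[OF S']])
    moreover have "v \<in> XH P \<S>'" by (rule XH_nested[OF mesh_conforming[OF S] S' vX])
    ultimately have "\<bar>eta P \<S>' \<S>' v' - eta P \<S>' \<S>' v\<bar> \<le> Cstab * enorm P (\<lambda>x. v' x - v x)"
      using stab v'X unfolding stability_def by blast
    then have "eta P \<S>' \<S>' v' \<le> ?q * eta P \<S> \<S> v + 2 * c * ?a + Cstab * enorm P (\<lambda>x. v' x - v x)"
      using 1 by linarith
    also have "2 * c * ?a \<le> (2 * c + 2 / (\<delta> * lam)) * ?a"
      using a pos by (intro mult_right_mono) auto
    finally show ?thesis by simp
  qed
qed

theorem theorem9:
  fixes \<theta> lam \<delta> qctr Ceqv \<alpha> L Cstab qred Crel Cdrel Cmon :: real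
  assumes "0 < \<theta>" and "\<theta> \<le> 1" and "0 < lam"
    and "0 < \<alpha>" and "\<alpha> \<le> L" and "0 < \<delta>" and "\<delta> < 2 * \<alpha> / L\<^sup>2"
    and "0 < qctr" and "qctr < 1" and "0 < Ceqv"
    and "0 < Cstab" and "0 < qred" and "qred < 1" and "0 < Crel" and "0 < Cdrel" and "0 < Cmon"
  shows "\<exists>qlin Clin. 0 < qlin \<and> qlin < 1 \<and> 0 < Clin \<and>
    (\<forall>(P :: model) \<T>0 ustar ud Cmark \<T> \<M> u z.
      model_problem P \<T>0 \<and> monotone_lipschitz P \<alpha> L \<and>
      exact_solution P ustar \<and> (\<forall>\<S>\<in>meshes P \<T>0. discrete_solution P \<S> (ud \<S>)) \<and>
      zarantonello_contraction P \<T>0 \<delta> qctr \<and>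
      stability P \<T>0 Cstab \<and> reduction P \<T>0 qred \<and> reliability P \<T>0 ustar ud Crel \<and>
      discrete_reliability P \<T>0 ud Cdrel \<and> quasi_monotonicity P \<T>0 ud Cmon \<and>
      estimator_equivalence P \<T>0 \<delta> Ceqv \<and>
      1 \<le> Cmark \<and> adaptive_run P \<T>0 \<theta> lam Cmark \<delta> \<T> \<M> u z
      \<longrightarrow> (let stop = alg_stop P lam \<T> u z; Z = quasi_error P ud \<T> u z in
           \<forall>p'\<in>index_set stop. \<forall>p\<in>index_set stop. index_count stop p' \<le> index_count stop p \<longrightarrow>
             Z p \<le> Clin * qlin ^ (index_count stop p - index_count stop p') * Z p'))"
proof -
  define c where "c = (1 + \<delta>) * Ceqv * (2 / \<delta>) + Cstab"
  define c' where "c' = 2 * c + 2 / (\<delta> * lam)"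
  define q1 where "q1 = sqrt (1 - (1 - qred\<^sup>2) * \<theta> / 2)"
  \<comment> \<open>With this weight the factor of the algebraic error becomes (1 + qctr) / 2 times K.\<close>
  define K where "K = 2 * c' / (1 - qctr)"
  define q where "q = max q1 ((1 + qctr) / 2)"
  define D where "D = 4 * L / \<alpha> * Cdrel\<^sup>2"
  have c: "0 < c" using assms by (simp add: c_def add_pos_pos)
  have c': "0 < c'" using c assms by (simp add: c'_def add_pos_pos)
  have K: "0 < K" using c' assms by (simp add: K_def)
  have Kq: "c' + K * qctr = K * ((1 + qctr) / 2)"
    using assms by (simp add: K_def field_simps)
  have "qred\<^sup>2 < 1" using assms by (simp add: power_less_one_iff)
  then have "0 < (1 - qred\<^sup>2) * \<theta>" using assms by simp
  then have "q1 < 1" by (simp add: q1_def)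
  then have q: "0 < q" "q < 1" using assms(8,9) by (simp_all add: q_def less_max_iff_disj)
  have D: "0 \<le> D" using assms by (simp add: D_def)
  obtain r C where r: "0 < r" "r < 1" and C: "0 < C"
    and lin: "\<And>H d m n. (\<And>n. 0 \<le> H n) \<Longrightarrow> (\<And>n. H (Suc n) \<le> q * H n + (Cstab + K) * d n) \<Longrightarrow>
      (\<And>n N. (\<Sum>j=n..<n+N. (d j)\<^sup>2) \<le> D * (H n)\<^sup>2) \<Longrightarrow> H (m + n) \<le> C * r ^ n * H m"
    using perturbed_contraction_R_linear[OF q D] by blast
  define Clin where "Clin = (1 + (1 + c) / K) * C * (1 + c + K)"
  have Clin: "0 < Clin" using c K C by (simp add: Clin_def add_pos_pos)
  show ?thesis
  proof (rule exI[of _ r], rule exI[of _ Clin], intro conjI r Clin allI impI)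
    fix P :: model and \<T>0 ustar ud Cmark \<T> \<M> u z
    assume *: "model_problem P \<T>0 \<and> monotone_lipschitz P \<alpha> L \<and>
      exact_solution P ustar \<and> (\<forall>\<S>\<in>meshes P \<T>0. discrete_solution P \<S> (ud \<S>)) \<and>
      zarantonello_contraction P \<T>0 \<delta> qctr \<and>
      stability P \<T>0 Cstab \<and> reduction P \<T>0 qred \<and> reliability P \<T>0 ustar ud Crel \<and>
      discrete_reliability P \<T>0 ud Cdrel \<and> quasi_monotonicity P \<T>0 ud Cmon \<and>
      estimator_equivalence P \<T>0 \<delta> Ceqv \<and>
      1 \<le> Cmark \<and> adaptive_run P \<T>0 \<theta> lam Cmark \<delta> \<T> \<M> u z"
    then have mp: "model_problem P \<T>0" and ml: "monotone_lipschitz P \<alpha> L"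
      and sol: "\<forall>\<S>\<in>meshes P \<T>0. discrete_solution P \<S> (ud \<S>)"
      and ctr: "zarantonello_contraction P \<T>0 \<delta> qctr"
      and stab: "stability P \<T>0 Cstab" and red: "reduction P \<T>0 qred"
      and drel: "discrete_reliability P \<T>0 ud Cdrel"
      and eqv: "estimator_equivalence P \<T>0 \<delta> Ceqv"
      and run: "adaptive_run P \<T>0 \<theta> lam Cmark \<delta> \<T> \<M> u z"
      by blast+
    define stop where "stop = alg_stop P lam \<T> u z"
    define S where "S = (\<lambda>n. \<T> (fst (alg_pos stop n)))"
    define w where "w = (\<lambda>n. u (fst (alg_pos stop n)) (snd (alg_pos stop n) - 1))"
    define y where "y = (\<lambda>n. z (fst (alg_pos stop n)) (snd (alg_pos stop n)))"
    have steps: "S n \<in> meshes P \<T>0" "w n \<in> XH P (S n)" "zarantonello P (S n) (w n) (y n)"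
      "S (Suc n) \<in> meshes P (S n)" "w (Suc n) = (\<lambda>x. w n x + \<delta> * y n x)"
      "(S (Suc n) = S n \<and> lam * zeta P (S n) (w n) (S n) (y n) < enorm P (y n)) \<or>
        (\<exists>N\<in>doerfler P \<theta> (S n) (w n) (y n). N \<inter> S (Suc n) = {})" for n
      unfolding S_def w_def y_def stop_def by (rule adaptive_run_steps[OF mp run])+
    define a where "a = (\<lambda>n. enorm P (\<lambda>x. ud (S n) x - w n x))"
    define e where "e = (\<lambda>n. eta P (S n) (S n) (ud (S n)))"
    define d where "d = (\<lambda>n. enorm P (\<lambda>x. ud (S (Suc n)) x - ud (S n) x))"
    define Z where "Z = (\<lambda>n. a n + zeta P (S n) (w n) (S n) (y n))"
    define H where "H = (\<lambda>n. e n + K * a n)"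
    have dsol: "discrete_solution P (S n) (ud (S n))" for n using sol steps(1) by blast
    have uX: "ud (S n) \<in> XX P" for n
      using dsol[of n] by (intro XH_XX[of _ P "S n"]) (simp add: discrete_solution_def)
    have wX: "w n \<in> XX P" for n by (rule XH_XX[OF steps(2)])
    have a0: "0 \<le> a n" for n
      using enorm_nonneg[OF mp XX_lincomb[OF mp uX wX, of 1 n "-1" n]] by (simp add: a_def)
    have e0: "0 \<le> e n" for n by (simp add: e_def eta_nonneg)
    have H0: "0 \<le> H n" for n using a0 e0 K by (simp add: H_def)
    have a_rec: "a (Suc n) \<le> qctr * a n + d n" for n
      unfolding a_def d_def steps(5)
      by (rule error_recursion[OF mp ctr steps(1) steps(4) dsol dsol steps(2) steps(3)])
    have e_rec: "e (Suc n) \<le> q1 * e n + c' * a n + Cstab * d n" for n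
    proof -
      have "(S (Suc n) = S n \<and> ud (S (Suc n)) = ud (S n) \<and>
          lam * zeta P (S n) (w n) (S n) (y n) < enorm P (y n)) \<or>
        (\<exists>N\<in>doerfler P \<theta> (S n) (w n) (y n). N \<inter> S (Suc n) = {})"
        using steps(6)[of n] by auto
      from estimator_recursion[OF mp ctr stab red eqv steps(1) steps(4) dsol dsol steps(2) steps(3) this]
      show ?thesis
        unfolding e_def a_def d_def q1_def c'_def c_def using assms by simp
    qed
    have H_rec: "H (Suc n) \<le> q * H n + (Cstab + K) * d n" for n
    proof -
      have "H (Suc n) \<le> (q1 * e n + c' * a n + Cstab * d n) + K * (qctr * a n + d n)"
        unfolding H_def using K by (intro add_mono e_rec mult_left_mono a_rec) auto
      also have "\<dots> = q1 * e n + (c' + K * qctr) * a n + (Cstab + K) * d n"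
        by (simp add: algebra_simps)
      also have "\<dots> = q1 * e n + (1 + qctr) / 2 * (K * a n) + (Cstab + K) * d n"
        unfolding Kq by simp
      also have "\<dots> \<le> q * e n + q * (K * a n) + (Cstab + K) * d n"
        using e0 a0 K by (intro add_mono mult_right_mono order_refl) (auto simp: q_def)
      finally show ?thesis by (simp add: H_def algebra_simps)
    qed
    have sums: "(\<Sum>j=n..<n+N. (d j)\<^sup>2) \<le> D * (H n)\<^sup>2" for n N
    proof -
      have "(\<Sum>j=n..<n+N. (d j)\<^sup>2) \<le> D * (e n)\<^sup>2"
        unfolding d_def D_def e_def using assms(4,5,15)
        by (intro quasi_orthogonality[OF mp ml sol drel, where S=S] steps(1,4)) auto
      also have "\<dots> \<le> D * (H n)\<^sup>2"
        using D e0 a0 K by (intro mult_left_mono power_mono) (auto simp: H_def)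
      finally show ?thesis .
    qed
    have cmp: "\<bar>zeta P (S n) (w n) (S n) (y n) - e n\<bar> \<le> c * a n" for n
      unfolding c_def a_def e_def using assms
      by (intro zeta_near_eta_of_solution[OF mp ctr stab eqv steps(1) dsol steps(2) steps(3)]) auto
    have ZH: "Z n \<le> (1 + (1 + c) / K) * H n" for n
    proof -
      have "Z n \<le> e n + (1 + c) * a n"
        using cmp[of n] by (simp add: Z_def algebra_simps)
      also have "\<dots> = 1 * e n + (1 + c) / K * (K * a n)" using K by simp
      also have "\<dots> \<le> (1 + (1 + c) / K) * e n + (1 + (1 + c) / K) * (K * a n)"
        using K c e0 a0 by (intro add_mono mult_right_mono) auto
      finally show ?thesis by (simp add: H_def distrib_left)
    qed
    have HZ: "H n \<le> (1 + c + K) * Z n" for n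
    proof -
      have "H n \<le> zeta P (S n) (w n) (S n) (y n) + (c + K) * a n"
        using cmp[of n] by (simp add: H_def algebra_simps)
      also have "\<dots> \<le> (1 + c + K) * zeta P (S n) (w n) (S n) (y n) + (1 + c + K) * a n"
        using c K a0 zeta_nonneg[of P "S n" "w n" "S n" "y n"]
        by (intro add_mono mult_right_mono mult_le_cancel_right1[THEN iffD2]) auto
      finally show ?thesis by (simp add: Z_def algebra_simps)
    qed
    have main: "Z (m + n) \<le> Clin * r ^ n * Z m" for m n
    proof -
      have "Z (m + n) \<le> (1 + (1 + c) / K) * H (m + n)" by (rule ZH)
      also have "\<dots> \<le> (1 + (1 + c) / K) * (C * r ^ n * H m)"
        using c K lin[OF H0 H_rec sums] by (intro mult_left_mono) auto
      also have "\<dots> \<le> (1 + (1 + c) / K) * (C * r ^ n * ((1 + c + K) * Z m))"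
        using c K C r HZ by (intro mult_left_mono) auto
      finally show ?thesis by (simp add: Clin_def mult_ac)
    qed
    have quasi: "quasi_error P ud \<T> u z (alg_pos stop n) = Z n" for n
      by (simp add: quasi_error_def Z_def a_def S_def w_def y_def split_beta)
    show "let stop = alg_stop P lam \<T> u z; Z = quasi_error P ud \<T> u z in
           \<forall>p'\<in>index_set stop. \<forall>p\<in>index_set stop. index_count stop p' \<le> index_count stop p \<longrightarrow>
             Z p \<le> Clin * r ^ (index_count stop p - index_count stop p') * Z p'"
      unfolding Let_def stop_def[symmetric]
    proof (intro ballI impI)
      fix p' p assume "p' \<in> index_set stop" "p \<in> index_set stop"
        and le: "index_count stop p' \<le> index_count stop p"
      then obtain m n where p: "p' = alg_pos stop m" "p = alg_pos stop n"
        unfolding index_set_def by blast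
      have "m \<le> n" using le by (simp add: p index_count_alg_pos)
      then show "quasi_error P ud \<T> u z p \<le>
          Clin * r ^ (index_count stop p - index_count stop p') * quasi_error P ud \<T> u z p'"
        unfolding p index_count_alg_pos quasi using main[of m "n - m"] by simp
    qed
  qed
qed

end
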